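(* Let $d\ge 1$. A minimal set of homogeneous generators for $\mathcal{A}(d)$ as a $\mathbb{Q}$-algebra contains one element in each norm $j$ with $1\le j\le d/2$ (and no other elements). In other words, the module of indecomposables $\mathcal{A}(d)_+/\mathcal{A}(d)_+^2$ has dimension $1$ over $\mathbb{Q}$ in each norm $j$ with $1\le j\le d/2$, and vanishes in all other norms.
   Context: $\mathcal{A}(d):=H^*(\mathrm{Hilb}^d(\mathbb{C}^2);\mathbb{Q})$ is the rational cohomology algebra of the Hilbert scheme of $d$ points of $\mathbb{C}^2$; it is a finite-dimensional graded commutative $\mathbb{Q}$-algebra concentrated in even degrees. The norm of a homogeneous element of even degree is half its degree. $\mathcal{A}(d)_j$ is the homogeneous component of norm $j$, and $\mathcal{A}(d)_+=\bigoplus_{j\ge1}\mathcal{A}(d)_j$. By a theorem of Lehn and Sorger, $\mathcal{A}(d)$ is identified, as a graded $\mathbb{Q}$-algebra, with the following combinatorial algebra. For $\sigma$ in the symmetric group $\mathfrak{S}_d$ let $N(\sigma)$ be the minimal number of transpositions whose product is $\sigma$ (equivalently, $d$ minus the number of cycles of $\sigma$, fixed points included). Let $\mathrm{grad}^N\mathbb{Q}[\mathfrak{S}_d]$ be the $\mathbb{Q}$-vector space with basis $\{[\sigma]:\sigma\in\mathfrak{S}_d\}$, with $[\sigma]$ of norm $N(\sigma)$ (degree $2N(\sigma)$), and with multiplication $[\sigma]\cdot[\tau]=[\sigma\tau]$ if $N(\sigma\tau)=N(\sigma)+N(\tau)$, and $[\sigma]\cdot[\tau]=0$ otherwise. Then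 $\mathcal{A}(d)\cong(\mathrm{grad}^N\mathbb{Q}[\mathfrak{S}_d])^{\mathfrak{S}_d}$, the subalgebra of invariants under the conjugation action of $\mathfrak{S}_d$. *)

theory Defs
  imports
    "HOL-Algebra.Sym_Groups"
    "HOL-Algebra.Ideal_Product"
    "HOL-Algebra.QuotRing"
    "Jordan_Normal_Form.VS_Connect"
begin

text \<open>The algebra \<open>H\<^sup>*(Hilb\<^sup>d(\<complex>\<^sup>2); \<rat>)\<close> is represented by its Lehn--Sorger model: the conjugation
  invariants of the graded group algebra \<open>grad\<^sup>N \<rat>[S\<^sub>d]\<close>.\<close>

abbreviation rat_field :: "rat ring" where
  "rat_field \<equiv> class_ring"

definition transpositions :: "nat \<Rightarrow> (nat \<Rightarrow> nat) set" where
  "transpositions d = {transpose a b | a b. a \<in> {1..d} \<and> b \<in> {1..d} \<and> a \<noteq> b}"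

definition perm_norm :: "nat \<Rightarrow> (nat \<Rightarrow> nat) \<Rightarrow> nat" where
  "perm_norm d \<sigma> =
     (LEAST n. \<exists>ts. length ts = n \<and> set ts \<subseteq> transpositions d \<and> foldr (\<circ>) ts id = \<sigma>)"

text \<open>A formal linear combination \<open>\<Sum>\<^sub>\<sigma> f(\<sigma>)[\<sigma>]\<close> is its coefficient function \<open>f\<close>, which
  vanishes outside \<open>S\<^sub>d\<close>. The product is the bilinear extension of the rule for basis elements,
  see \<open>grad_mult_perm_basis\<close> below.\<close>

definition perm_basis :: "(nat \<Rightarrow> nat) \<Rightarrow> (nat \<Rightarrow> nat) \<Rightarrow> rat" where
  "perm_basis \<sigma> = (\<lambda>\<rho>. if \<rho> = \<sigma> then 1 else 0)"

definition grad_mult ::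
  "nat \<Rightarrow> ((nat \<Rightarrow> nat) \<Rightarrow> rat) \<Rightarrow> ((nat \<Rightarrow> nat) \<Rightarrow> rat) \<Rightarrow> (nat \<Rightarrow> nat) \<Rightarrow> rat" where
  "grad_mult d f g = (\<lambda>\<rho>. \<Sum>(\<sigma>, \<tau>) \<in> {(\<sigma>, \<tau>).
      \<sigma> \<in> carrier (sym_group d) \<and> \<tau> \<in> carrier (sym_group d) \<and> \<sigma> \<circ> \<tau> = \<rho> \<and>
      perm_norm d (\<sigma> \<circ> \<tau>) = perm_norm d \<sigma> + perm_norm d \<tau>}. f \<sigma> * g \<tau>)"

definition grad_group_algebra :: "nat \<Rightarrow> (rat, (nat \<Rightarrow> nat) \<Rightarrow> rat) module" where
  "grad_group_algebra d =
    \<lparr>carrier = {f. \<forall>\<sigma>. \<sigma> \<notin> carrier (sym_group d) \<longrightarrow> f \<sigma> = 0},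
     mult = grad_mult d,
     one = perm_basis id,
     zero = (\<lambda>_. 0),
     add = (\<lambda>f g \<sigma>. f \<sigma> + g \<sigma>),
     smult = (\<lambda>c f \<sigma>. c * f \<sigma>)\<rparr>"

text \<open>The linear extension of \<open>\<pi> \<cdot> [\<sigma>] = [\<pi>\<sigma>\<pi>\<^sup>-\<^sup>1]\<close>, on coefficient functions.\<close>

definition conj_act :: "(nat \<Rightarrow> nat) \<Rightarrow> ((nat \<Rightarrow> nat) \<Rightarrow> rat) \<Rightarrow> (nat \<Rightarrow> nat) \<Rightarrow> rat" where
  "conj_act \<pi> f = (\<lambda>\<sigma>. f (inv' \<pi> \<circ> \<sigma> \<circ> \<pi>))"

definition hilb_algebra :: "nat \<Rightarrow> (rat, (nat \<Rightarrow> nat) \<Rightarrow> rat) module" where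
  "hilb_algebra d = (grad_group_algebra d)
     \<lparr>carrier := {f \<in> carrier (grad_group_algebra d).
                    \<forall>\<pi> \<in> carrier (sym_group d). conj_act \<pi> f = f}\<rparr>"

definition hilb_component :: "nat \<Rightarrow> nat \<Rightarrow> ((nat \<Rightarrow> nat) \<Rightarrow> rat) set" where
  "hilb_component d j = {f \<in> carrier (hilb_algebra d). \<forall>\<sigma>. f \<sigma> \<noteq> 0 \<longrightarrow> perm_norm d \<sigma> = j}"

definition hilb_plus :: "nat \<Rightarrow> ((nat \<Rightarrow> nat) \<Rightarrow> rat) set" where
  "hilb_plus d = LinearCombinations.module.span rat_field (hilb_algebra d)
                   (\<Union>j \<in> {1..}. hilb_component d j)"

definition hilb_plus_sq :: "nat \<Rightarrow> ((nat \<Rightarrow> nat) \<Rightarrow> rat) set" where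
  "hilb_plus_sq d = hilb_plus d \<cdot>\<^bsub>hilb_algebra d\<^esub> hilb_plus d"

text \<open>The quotient \<open>M/I\<close> of an algebra by an ideal, with its module structure. As for
  \<^const>\<open>rcoset_mult\<close>, the union only makes \<open>c (I + x) = I + cx\<close> independent of a choice
  of representative; for \<open>c = 0\<close> the elementwise image would be too small.\<close>

definition quotient_module ::
  "('a, 'b, 'm) module_scheme \<Rightarrow> 'b set \<Rightarrow> ('a, 'b set) module" where
  "quotient_module M I = ring.extend (M Quot I)
     \<lparr>smult = (\<lambda>c X. \<Union>x\<in>X. I +>\<^bsub>M\<^esub> (c \<odot>\<^bsub>M\<^esub> x))\<rparr>"

definition indecomposables :: "nat \<Rightarrow> (rat, ((nat \<Rightarrow> nat) \<Rightarrow> rat) set) module" where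
  "indecomposables d = (quotient_module (hilb_algebra d) (hilb_plus_sq d))
     \<lparr>carrier := {hilb_plus_sq d +>\<^bsub>hilb_algebra d\<^esub> x | x. x \<in> hilb_plus d}\<rparr>"

text \<open>The component of norm \<open>j\<close>: the image of the norm \<open>j\<close> part of the augmentation ideal.\<close>

definition indecomposables_component ::
  "nat \<Rightarrow> nat \<Rightarrow> (rat, ((nat \<Rightarrow> nat) \<Rightarrow> rat) set) module" where
  "indecomposables_component d j = (indecomposables d)
     \<lparr>carrier := {hilb_plus_sq d +>\<^bsub>hilb_algebra d\<^esub> x | x. x \<in> hilb_plus d \<inter> hilb_component d j}\<rparr>"

text \<open>The unital subalgebra generated by a set.\<close>

inductive_set generated_algebra ::
  "('a, 'c) ring_scheme \<Rightarrow> ('a, 'b, 'm) module_scheme \<Rightarrow> 'b set \<Rightarrow> 'b set"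
  for K and M and G where
    gen: "x \<in> G \<Longrightarrow> x \<in> generated_algebra K M G"
  | one: "\<one>\<^bsub>M\<^esub> \<in> generated_algebra K M G"
  | add: "x \<in> generated_algebra K M G \<Longrightarrow> y \<in> generated_algebra K M G
            \<Longrightarrow> x \<oplus>\<^bsub>M\<^esub> y \<in> generated_algebra K M G"
  | smult: "c \<in> carrier K \<Longrightarrow> x \<in> generated_algebra K M G
            \<Longrightarrow> c \<odot>\<^bsub>M\<^esub> x \<in> generated_algebra K M G"
  | mult: "x \<in> generated_algebra K M G \<Longrightarrow> y \<in> generated_algebra K M G
            \<Longrightarrow> x \<otimes>\<^bsub>M\<^esub> y \<in> generated_algebra K M G"

definition homogeneous_generators :: "nat \<Rightarrow> ((nat \<Rightarrow> nat) \<Rightarrow> rat) set \<Rightarrow> bool" where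
  "homogeneous_generators d G \<longleftrightarrow>
     G \<subseteq> (\<Union>j. hilb_component d j) \<and>
     generated_algebra rat_field (hilb_algebra d) G = carrier (hilb_algebra d)"

text \<open>Minimality is with respect to inclusion.\<close>

definition minimal_homogeneous_generators :: "nat \<Rightarrow> ((nat \<Rightarrow> nat) \<Rightarrow> rat) set \<Rightarrow> bool" where
  "minimal_homogeneous_generators d G \<longleftrightarrow> minimal G (homogeneous_generators d)"

lemma grad_mult_perm_basis:
  assumes "\<sigma> \<in> carrier (sym_group d)" "\<tau> \<in> carrier (sym_group d)"
  shows "grad_mult d (perm_basis \<sigma>) (perm_basis \<tau>) =
    (if perm_norm d (\<sigma> \<circ> \<tau>) = perm_norm d \<sigma> + perm_norm d \<tau>
     then perm_basis (\<sigma> \<circ> \<tau>) else (\<lambda>_. 0))"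
proof
  fix \<rho>
  let ?P = "\<lambda>\<sigma> \<tau>. \<sigma> \<in> carrier (sym_group d) \<and> \<tau> \<in> carrier (sym_group d) \<and> \<sigma> \<circ> \<tau> = \<rho> \<and>
      perm_norm d (\<sigma> \<circ> \<tau>) = perm_norm d \<sigma> + perm_norm d \<tau>"
  let ?S = "{(\<sigma>, \<tau>). ?P \<sigma> \<tau>}"
  have "finite (carrier (sym_group d))"
    by (simp add: sym_group_def finite_permutations)
  then have "finite (carrier (sym_group d) \<times> carrier (sym_group d))"
    by simp
  then have fin: "finite ?S"
    by (rule finite_subset[rotated]) blast
  have "grad_mult d (perm_basis \<sigma>) (perm_basis \<tau>) \<rho> =
      (\<Sum>p\<in>?S. if p = (\<sigma>, \<tau>) then 1 else 0)"
    unfolding grad_mult_def by (rule sum.cong) (auto simp: perm_basis_def split: if_splits)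
  also have "\<dots> = (if ?P \<sigma> \<tau> then 1 else 0)"
    using fin by (simp add: sum.delta)
  finally show "grad_mult d (perm_basis \<sigma>) (perm_basis \<tau>) \<rho> =
    (if perm_norm d (\<sigma> \<circ> \<tau>) = perm_norm d \<sigma> + perm_norm d \<tau>
     then perm_basis (\<sigma> \<circ> \<tau>) else (\<lambda>_. 0)) \<rho>"
    using assms by (auto simp: perm_basis_def)
qed

lemma conj_act_perm_basis:
  assumes "\<pi> \<in> carrier (sym_group d)"
  shows "conj_act \<pi> (perm_basis \<sigma>) = perm_basis (\<pi> \<circ> \<sigma> \<circ> inv' \<pi>)"
proof -
  have 1: "\<pi> \<circ> inv' \<pi> = id" "inv' \<pi> \<circ> \<pi> = id"
    using assms permutes_inv_o by (auto simp: sym_group_def)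
  have "inv' \<pi> \<circ> \<rho> \<circ> \<pi> = \<sigma> \<longleftrightarrow> \<rho> = \<pi> \<circ> \<sigma> \<circ> inv' \<pi>" for \<rho>
    using 1 by (metis comp_assoc comp_id id_comp)
  then show ?thesis
    by (auto simp: conj_act_def perm_basis_def)
qed

end

theory Submission
  imports Defs "HOL-Combinatorics.Orbits"
begin

text \<open>Write \<open>A\<close> for the algebra, \<open>A\<^sub>+\<close> for its augmentation ideal, \<open>P(\<sigma>)\<close> for the sum of all conjugates
  of \<open>\<sigma>\<close>, and \<open>K\<^sub>a\<close> for the sum of the \<open>(a+1)\<close>-cycles (each one as often as it is written as a
  list). The proof rests on one observation: in the graded algebra, multiplication by \<open>K\<^sub>a\<close> only
  joins orbits. If \<open>c\<close> is an \<open>(a+1)\<close>-cycle, then \<open>N(c\<tau>) = N(c) + N(\<tau>)\<close> holds exactly when the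
  \<open>a+1\<close> points of \<open>c\<close> lie in distinct orbits of \<open>\<tau>\<close>, and then \<open>c\<tau>\<close> has these orbits merged into
  one (\<open>geodesic_cycle_iff\<close>, \<open>orbits_cycle_merge\<close>). Hence \<open>K\<^sub>a P(\<tau>)\<close> is the sum of \<open>P(c\<tau>)\<close> over
  all such \<open>c\<close>.

  Upper bound. Let \<open>\<sigma>\<close> have norm \<open>n\<close> and at least two nontrivial orbits. Cut one of them, of
  size \<open>a+1\<close>, into fixed points to get \<open>\<tau>\<close>. In \<open>K\<^sub>a P(\<tau>)\<close> the terms that join fixed points only
  are equal to \<open>P(\<sigma>)\<close>, and all other terms have fewer nontrivial orbits than \<open>\<sigma>\<close>. By induction,
  every \<open>P(\<sigma>)\<close> of norm \<open>n\<close> is a multiple of one element \<open>E\<^sub>n\<close>, a multiple of \<open>P\<close> of an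
  \<open>(n+1)\<close>-cycle, modulo the products \<open>K\<^sub>a h\<close> with \<open>a \<ge> 1\<close> and \<open>h \<in> A\<^sub>+\<close>. The multiple is
  \<open>w(\<sigma>)\<close>, up to a common factor, where \<open>w(\<sigma>)\<close> is the product of all orbit sizes times
  \<open>(-1)\<^sup>r (n+r-1)! (d-n-r)!\<close> and \<open>r\<close> is the number of nontrivial orbits. What makes this choice
  consistent is that the sum of \<open>w(c\<tau>)\<close> over the cycles \<open>c\<close> as above vanishes for every
  \<open>\<tau> \<noteq> id\<close> with more than \<open>a\<close> fixed points (\<open>sum_perm_weight_eq_0\<close>). After a count of the sets of
  \<open>a+1\<close> orbits, this is an identity of alternating sums of factorials that follows from Pascal's
  rule.

  Lower bound for \<open>n \<le> d/2\<close>. If \<open>\<tau>\<close> has norm \<open>n - a\<close>, then it has at least \<open>d - 2(n - a) \<ge> 2a\<close>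
  fixed points, so the identity applies to every \<open>\<tau>\<close> that occurs. Therefore the functional
  \<open>\<phi>\<^sub>n(f) = \<Sum> f(\<sigma>) w(\<sigma>)\<close>, over the \<open>\<sigma>\<close> of norm \<open>n\<close>, kills all \<open>K\<^sub>a h\<close> with \<open>h \<in> A\<^sub>+\<close>. The upper
  bound also shows that \<open>A\<^sub>+\<close> is spanned by products \<open>K\<^sub>a h\<close> with \<open>a \<ge> 1\<close> and \<open>h \<in> A\<close>, so \<open>\<phi>\<^sub>n\<close> kills \<open>A\<^sub>+\<^sup>2\<close>
  by associativity. As \<open>\<phi>\<^sub>n(E\<^sub>n) = 1\<close>, the indecomposables of norm \<open>n\<close> have dimension \<open>1\<close>.

  Vanishing for \<open>n > d/2\<close>. All norms are less than \<open>d\<close>, so let \<open>n < d\<close>. As \<open>2(d - n) + 1 \<le> d\<close>,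
  there is a \<open>\<tau>\<close> with \<open>d - n\<close> nontrivial orbits and a single fixed point. It has norm \<open>n - 1\<close>, and for \<open>a = 1\<close> the identity just fails:
  the sum of \<open>w(c\<tau>)\<close> is nonzero (\<open>sum_perm_weight_neq_0\<close>). Comparing with \<open>K\<^sub>1 P(\<tau>) \<in> A\<^sub>+\<^sup>2\<close> shows
  that \<open>E\<^sub>n\<close> itself is decomposable.

  Generators. A set of homogeneous elements generates \<open>A\<close> if and only if for each \<open>j\<close> with
  \<open>1 \<le> j \<le> d/2\<close> it contains an element of norm \<open>j\<close> on which \<open>\<phi>\<^sub>j\<close> does not vanish
  (\<open>homogeneous_generators_iff\<close>). So a minimal one has exactly one element in each of these
  norms.\<close>

section \<open>Orbits under composition with transpositions and cycles\<close>

definition orbits :: "'a set \<Rightarrow> ('a \<Rightarrow> 'a) \<Rightarrow> 'a set set" where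
  "orbits A \<sigma> = orbit \<sigma> ` A"

lemma permutation_transpose_comp: "permutation \<sigma> \<Longrightarrow> permutation (transpose a b \<circ> \<sigma>)"
  by (simp add: permutation_compose permutation_swap_id)

lemma orbit_eq_if_mem:
  assumes "permutation \<sigma>" "y \<in> orbit \<sigma> x"
  shows "orbit \<sigma> y = orbit \<sigma> x"
  using assms by (metis cyclic_on_orbit' orbit_cyclic_eq3)

text \<open>Follow the orbit of \<open>a\<close> under \<open>\<sigma>\<close>: the transposition interferes only at the step that would
  return to \<open>a\<close>, because \<open>b\<close> is never met.\<close>

lemma orbit_subset_orbit_transpose:
  assumes perm: "permutation \<sigma>" and notin: "b \<notin> orbit \<sigma> a"
  shows "orbit \<sigma> a \<subseteq> orbit (transpose a b \<circ> \<sigma>) a"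
proof
  define \<tau> where "\<tau> = transpose a b \<circ> \<sigma>"
  have \<tau>: "\<tau> x = transpose a b (\<sigma> x)" for x by (simp add: \<tau>_def)
  have self: "a \<in> orbit \<tau> a"
    unfolding \<tau>_def by (rule permutation_self_in_orbit[OF permutation_transpose_comp[OF perm]])
  fix z assume "z \<in> orbit \<sigma> a"
  then have "z \<in> orbit \<tau> a"
  proof induct
    case base
    have "\<sigma> a \<noteq> b" using notin orbit.base[of \<sigma> a] by auto
    then show ?case
      using self orbit.base[of \<tau> a] \<tau>[of a] by (cases "\<sigma> a = a") auto
  next
    case (step y)
    have "\<sigma> y \<noteq> b" using notin orbit.step[OF step(1)] by auto
    then show ?case
      using self orbit.step[OF step(2)] \<tau>[of y] by (cases "\<sigma> y = a") auto
  qed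
  then show "z \<in> orbit (transpose a b \<circ> \<sigma>) a" by (simp only: \<tau>_def)
qed

text \<open>The step of \<open>\<sigma>\<close> that closes the orbit of \<open>a\<close> is redirected to \<open>b\<close>, and the one that closes the
  orbit of \<open>b\<close> is redirected to \<open>a\<close>.\<close>

lemma orbit_transpose_merge:
  assumes perm: "permutation \<sigma>" and notin: "b \<notin> orbit \<sigma> a"
  shows "orbit (transpose a b \<circ> \<sigma>) a = orbit \<sigma> a \<union> orbit \<sigma> b"
proof -
  define \<tau> where "\<tau> = transpose a b \<circ> \<sigma>"
  have \<tau>: "\<tau> x = transpose a b (\<sigma> x)" for x by (simp add: \<tau>_def)
  have permt: "permutation \<tau>"
    unfolding \<tau>_def by (rule permutation_transpose_comp[OF perm])
  note self = permutation_self_in_orbit[OF perm]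
  have notin': "a \<notin> orbit \<sigma> b"
    using notin orbit_eq_if_mem[OF perm, of a b] self[of b] by auto
  have "orbit \<sigma> a \<union> orbit \<sigma> b \<subseteq> orbit \<tau> a"
  proof -
    have 1: "orbit \<sigma> a \<subseteq> orbit \<tau> a"
      using orbit_subset_orbit_transpose[OF assms] by (simp only: \<tau>_def)
    obtain z where z: "z \<in> orbit \<sigma> a" "\<sigma> z = a"
      using self[of a] by (cases rule: orbit.cases) (use self[of a] in auto)
    have "b \<in> orbit \<tau> a"
      using orbit.step[of z \<tau> a] z 1 \<tau>[of z] by auto
    then have "orbit \<tau> b = orbit \<tau> a" by (rule orbit_eq_if_mem[OF permt])
    moreover have "orbit \<sigma> b \<subseteq> orbit \<tau> b"
      using orbit_subset_orbit_transpose[OF perm notin'] by (simp only: \<tau>_def transpose_commute)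
    ultimately show ?thesis using 1 by simp
  qed
  moreover have "orbit \<tau> a \<subseteq> orbit \<sigma> a \<union> orbit \<sigma> b"
  proof
    fix z assume "z \<in> orbit \<tau> a"
    then show "z \<in> orbit \<sigma> a \<union> orbit \<sigma> b"
    proof induct
      case base
      show ?case
        using orbit.base[of \<sigma> a] self \<tau>[of a] by (auto simp: transpose_def)
    next
      case (step y)
      then show ?case
        using orbit.step[of y \<sigma>] self \<tau>[of y] by (auto simp: transpose_def)
    qed
  qed
  ultimately show ?thesis by (auto simp only: \<tau>_def)
qed

lemma orbit_transpose_other:
  assumes perm: "permutation \<sigma>" and "a \<notin> orbit \<sigma> z" "b \<notin> orbit \<sigma> z"
  shows "orbit (transpose a b \<circ> \<sigma>) z = orbit \<sigma> z"
proof (rule orbit_cong)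
  show "z \<in> orbit \<sigma> z" by (simp add: perm permutation_self_in_orbit)
  fix s assume "s \<in> orbit \<sigma> z"
  then have "\<sigma> s \<in> orbit \<sigma> z" by (rule orbit.step)
  then have "\<sigma> s \<noteq> a" "\<sigma> s \<noteq> b" using assms by auto
  then show "(transpose a b \<circ> \<sigma>) s = \<sigma> s" by simp
qed

context
  fixes A :: "'a set"
  assumes fin: "finite A"
begin

lemma orbits_cover:
  assumes "\<sigma> permutes A" "O1 \<in> orbits A \<sigma>"
  shows "O1 \<subseteq> A" "O1 \<noteq> {}" "finite O1"
proof -
  obtain x where x: "x \<in> A" "O1 = orbit \<sigma> x" using assms(2) by (auto simp: orbits_def)
  show "O1 \<subseteq> A" unfolding x(2) by (rule permutes_orbit_subset[OF assms(1) x(1)])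
  then show "finite O1" by (rule finite_subset[OF _ fin])
  show "O1 \<noteq> {}" unfolding x(2) by (rule orbit_nonempty)
qed

lemma orbits_eq_orbit:
  assumes "\<sigma> permutes A" "O1 \<in> orbits A \<sigma>" "x \<in> O1"
  shows "O1 = orbit \<sigma> x"
  using assms orbit_eq_if_mem[OF permutes_imp_permutation[OF fin assms(1)]]
  by (auto simp: orbits_def)

lemma finite_orbits: "finite (orbits A \<sigma>)"
  using fin by (simp add: orbits_def)

lemma self_in_orbit: "\<sigma> permutes A \<Longrightarrow> x \<in> orbit \<sigma> x"
  by (rule permutation_self_in_orbit[OF permutes_imp_permutation[OF fin]])

lemma Union_orbits: "\<sigma> permutes A \<Longrightarrow> \<Union>(orbits A \<sigma>) = A"
  using orbits_cover self_in_orbit by (fastforce simp: orbits_def)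

lemma orbits_disjoint:
  assumes "\<sigma> permutes A" "O1 \<in> orbits A \<sigma>" "O2 \<in> orbits A \<sigma>" "O1 \<noteq> O2"
  shows "O1 \<inter> O2 = {}"
proof (rule ccontr)
  assume "O1 \<inter> O2 \<noteq> {}"
  then obtain x where "x \<in> O1" "x \<in> O2" by blast
  then have "O1 = orbit \<sigma> x" "O2 = orbit \<sigma> x"
    using orbits_eq_orbit[OF assms(1,2)] orbits_eq_orbit[OF assms(1,3)] by blast+
  then show False using assms(4) by simp
qed

lemma sum_card_orbits:
  assumes "\<sigma> permutes A"
  shows "(\<Sum>O1\<in>orbits A \<sigma>. card O1) = card A"
proof -
  have "card (\<Union>(orbits A \<sigma>)) = (\<Sum>O1\<in>orbits A \<sigma>. card O1)"
  proof (rule card_Union_disjoint)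
    show "pairwise disjnt (orbits A \<sigma>)"
      by (rule pairwiseI) (simp add: disjnt_def orbits_disjoint[OF assms])
    show "finite O1" if "O1 \<in> orbits A \<sigma>" for O1
      by (rule orbits_cover(3)[OF assms that])
  qed
  then show ?thesis using Union_orbits[OF assms] by simp
qed

lemma transpose_comp_permutes:
  "\<sigma> permutes A \<Longrightarrow> a \<in> A \<Longrightarrow> b \<in> A \<Longrightarrow> transpose a b \<circ> \<sigma> permutes A"
  by (simp add: permutes_compose permutes_swap_id)

lemma orbits_transpose_merge:
  assumes perm: "\<sigma> permutes A" and ab: "a \<in> A" "b \<in> A" and notin: "b \<notin> orbit \<sigma> a"
  shows "orbits A (transpose a b \<circ> \<sigma>) =
    insert (orbit \<sigma> a \<union> orbit \<sigma> b) (orbits A \<sigma> - {orbit \<sigma> a, orbit \<sigma> b})"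
proof -
  define \<tau> where "\<tau> = transpose a b \<circ> \<sigma>"
  define U where "U = orbit \<sigma> a \<union> orbit \<sigma> b"
  have p: "permutation \<sigma>" by (rule permutes_imp_permutation[OF fin perm])
  have pt: "permutation \<tau>" unfolding \<tau>_def by (rule permutation_transpose_comp[OF p])
  have self: "z \<in> orbit \<sigma> z" for z by (rule self_in_orbit[OF perm])
  have \<tau>a: "orbit \<tau> a = U"
    unfolding \<tau>_def U_def by (rule orbit_transpose_merge[OF p notin])
  have inU: "orbit \<tau> z = U" if "z \<in> U" for z
    using orbit_eq_if_mem[OF pt, of z a] that \<tau>a by simp
  have notinU: "orbit \<tau> z = orbit \<sigma> z" if "z \<notin> U" for z
  proof -
    have "a \<notin> orbit \<sigma> z" "b \<notin> orbit \<sigma> z"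
      using orbit_eq_if_mem[OF p, of a z] orbit_eq_if_mem[OF p, of b z] self[of z] that
      unfolding U_def by blast+
    then show ?thesis unfolding \<tau>_def by (rule orbit_transpose_other[OF p])
  qed
  have e: "z \<in> U \<longleftrightarrow> orbit \<sigma> z \<in> {orbit \<sigma> a, orbit \<sigma> b}" for z
    using orbit_eq_if_mem[OF p, of z a] orbit_eq_if_mem[OF p, of z b] self[of z]
    unfolding U_def by blast
  have "orbit \<tau> ` A = insert U (orbit \<sigma> ` A - {orbit \<sigma> a, orbit \<sigma> b})"
  proof (intro equalityI subsetI)
    fix P assume "P \<in> orbit \<tau> ` A"
    then obtain z where z: "z \<in> A" "P = orbit \<tau> z" by blast
    show "P \<in> insert U (orbit \<sigma> ` A - {orbit \<sigma> a, orbit \<sigma> b})"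
    proof (cases "z \<in> U")
      case True
      then show ?thesis using inU[OF True] z(2) by simp
    next
      case False
      then show ?thesis using notinU[OF False] z e[of z] by simp
    qed
  next
    fix P assume "P \<in> insert U (orbit \<sigma> ` A - {orbit \<sigma> a, orbit \<sigma> b})"
    then consider "P = U" | z where "z \<in> A" "P = orbit \<sigma> z" "P \<notin> {orbit \<sigma> a, orbit \<sigma> b}"
      by blast
    then show "P \<in> orbit \<tau> ` A"
    proof cases
      case 1
      then show ?thesis using \<tau>a ab(1) by blast
    next
      case 2
      then show ?thesis using e[of z] notinU[of z] by auto
    qed
  qed
  then show ?thesis unfolding orbits_def \<tau>_def U_def .
qed

lemma card_orbits_transpose_merge:
  assumes "\<sigma> permutes A" "a \<in> A" "b \<in> A" "b \<notin> orbit \<sigma> a"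
  shows "Suc (card (orbits A (transpose a b \<circ> \<sigma>))) = card (orbits A \<sigma>)"
proof -
  have "orbit \<sigma> a \<noteq> orbit \<sigma> b" using assms(4) self_in_orbit[OF assms(1), of b] by auto
  moreover have "orbit \<sigma> a \<in> orbits A \<sigma>" "orbit \<sigma> b \<in> orbits A \<sigma>"
    using assms by (auto simp: orbits_def)
  ultimately have "card (orbits A \<sigma> - {orbit \<sigma> a, orbit \<sigma> b}) + 2 = card (orbits A \<sigma>)"
    using card_Diff_subset[of "{orbit \<sigma> a, orbit \<sigma> b}" "orbits A \<sigma>"]
      card_mono[OF finite_orbits[of \<sigma>], of "{orbit \<sigma> a, orbit \<sigma> b}"] by simp
  moreover have "orbit \<sigma> a \<union> orbit \<sigma> b \<notin> orbits A \<sigma> - {orbit \<sigma> a, orbit \<sigma> b}"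
  proof
    assume *: "orbit \<sigma> a \<union> orbit \<sigma> b \<in> orbits A \<sigma> - {orbit \<sigma> a, orbit \<sigma> b}"
    have "orbit \<sigma> a \<union> orbit \<sigma> b = orbit \<sigma> a"
      by (rule orbits_eq_orbit[OF assms(1)]) (use * self_in_orbit[OF assms(1), of a] in blast)+
    then show False using * by simp
  qed
  ultimately show ?thesis
    using orbits_transpose_merge[OF assms] finite_orbits by simp
qed

text \<open>If \<open>a\<close> and \<open>b\<close> already lie in one orbit, each orbit of \<open>\<sigma>\<close> is a union of orbits of the product,
  so sending an orbit of the product to the orbit of \<open>\<sigma>\<close> that contains it is surjective.\<close>

lemma card_orbits_transpose_same:
  assumes perm: "\<sigma> permutes A" and a: "a \<in> A" and b: "b \<in> orbit \<sigma> a"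
  shows "card (orbits A \<sigma>) \<le> card (orbits A (transpose a b \<circ> \<sigma>))"
proof -
  define \<tau> where "\<tau> = transpose a b \<circ> \<sigma>"
  have p: "permutation \<sigma>" by (rule permutes_imp_permutation[OF fin perm])
  have bA: "b \<in> A" using permutes_orbit_subset[OF perm a] b by blast
  have pt: "\<tau> permutes A" unfolding \<tau>_def by (rule transpose_comp_permutes[OF perm a bA])
  have tr: "orbit \<sigma> (\<tau> x) = orbit \<sigma> x" for x
    using orbit_eq_if_mem[OF p b] orbit_eq_if_mem[OF p orbit.base, of x]
    unfolding \<tau>_def by (cases "\<sigma> x = a"; cases "\<sigma> x = b") auto
  have sub: "orbit \<sigma> y = orbit \<sigma> z" if "y \<in> orbit \<tau> z" for y z
    using that by induct (simp_all add: tr)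
  have "orbits A \<sigma> = (\<lambda>P. orbit \<sigma> (SOME x. x \<in> P)) ` orbits A \<tau>"
  proof -
    have "orbit \<sigma> (SOME x. x \<in> orbit \<tau> z) = orbit \<sigma> z" for z
      by (rule sub, rule someI[of "\<lambda>x. x \<in> orbit \<tau> z"], rule self_in_orbit[OF pt])
    then show ?thesis unfolding orbits_def image_image by simp
  qed
  then show ?thesis unfolding \<tau>_def by (metis card_image_le finite_orbits)
qed

lemma cycle_comp_permutes:
  "\<sigma> permutes A \<Longrightarrow> set xs \<subseteq> A \<Longrightarrow> cycle_of_list xs \<circ> \<sigma> permutes A"
  by (meson cycle_permutes permutes_compose permutes_subset)

lemma orbits_cycle_merge:
  assumes perm: "\<sigma> permutes A" and "set xs \<subseteq> A" "xs \<noteq> []" "distinct (map (orbit \<sigma>) xs)"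
  shows "orbits A (cycle_of_list xs \<circ> \<sigma>) =
    insert (\<Union>(orbit \<sigma> ` set xs)) (orbits A \<sigma> - orbit \<sigma> ` set xs)"
  using assms(2-)
proof (induct xs rule: cycle_of_list.induct)
  case (1 x y ys)
  define \<tau> where "\<tau> = cycle_of_list (y # ys) \<circ> \<sigma>"
  define Y where "Y = orbit \<sigma> ` set (y # ys)"
  have IH: "orbits A \<tau> = insert (\<Union>Y) (orbits A \<sigma> - Y)"
    unfolding \<tau>_def Y_def by (rule 1(1)) (use 1(2,4) in auto)
  have pt: "\<tau> permutes A"
    unfolding \<tau>_def by (rule cycle_comp_permutes[OF perm]) (use 1(2) in simp)
  have xA: "x \<in> A" "y \<in> A" using 1(2) by auto
  \<comment> \<open>The points of \<open>y # ys\<close> are already merged into \<open>\<Union>Y\<close>; the transposition adds the orbit of \<open>x\<close>.\<close>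
  have xY: "orbit \<sigma> x \<notin> Y" using 1(4) unfolding Y_def by auto
  have yU: "y \<in> \<Union>Y" using self_in_orbit[OF perm, of y] unfolding Y_def by auto
  have xo: "orbit \<sigma> x \<in> orbits A \<sigma>" using xA unfolding orbits_def by blast
  have ox: "orbit \<tau> x = orbit \<sigma> x"
    by (rule orbits_eq_orbit[OF pt, symmetric])
      (use IH xo xY self_in_orbit[OF perm, of x] in blast)+
  have oy: "orbit \<tau> y = \<Union>Y"
    by (rule orbits_eq_orbit[OF pt, symmetric]) (use IH yU in blast)+
  have UY: "\<Union>Y \<notin> orbits A \<sigma> - Y"
  proof
    assume *: "\<Union>Y \<in> orbits A \<sigma> - Y"
    then have "\<Union>Y = orbit \<sigma> y" using orbits_eq_orbit[OF perm _ yU] by blast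
    then show False using * unfolding Y_def by simp
  qed
  have ynotin: "y \<notin> orbit \<tau> x"
  proof
    assume "y \<in> orbit \<tau> x"
    then have "orbit \<sigma> x = orbit \<sigma> y" using orbits_eq_orbit[OF perm xo] ox by blast
    then show False using xY unfolding Y_def by simp
  qed
  have "cycle_of_list (x # y # ys) \<circ> \<sigma> = transpose x y \<circ> \<tau>"
    by (simp add: \<tau>_def comp_assoc)
  then have "orbits A (cycle_of_list (x # y # ys) \<circ> \<sigma>) =
      insert (orbit \<sigma> x \<union> \<Union>Y) (orbits A \<tau> - {orbit \<sigma> x, \<Union>Y})"
    using orbits_transpose_merge[OF pt xA ynotin] ox oy by simp
  also have "orbits A \<tau> - {orbit \<sigma> x, \<Union>Y} = orbits A \<sigma> - insert (orbit \<sigma> x) Y"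
    using IH UY by blast
  finally show ?case by (simp add: Y_def)
next
  case ("2_2" x)
  then show ?case by (auto simp: orbits_def)
qed simp

text \<open>A cycle on \<open>m\<close> points is a product of \<open>m - 1\<close> transpositions, each of which lowers the number of
  orbits by at most one. The bound is attained only if every one of them merges two orbits.\<close>

lemma card_orbits_cycle_merge:
  assumes perm: "\<sigma> permutes A" and sub: "set xs \<subseteq> A" and ne: "xs \<noteq> []"
  shows "card (orbits A \<sigma>) + 1 = card (orbits A (cycle_of_list xs \<circ> \<sigma>)) + length xs \<longleftrightarrow>
    distinct (map (orbit \<sigma>) xs)" (is "?eq xs \<longleftrightarrow> ?dist xs")
proof
  assume dist: "?dist xs"
  define Y where "Y = orbit \<sigma> ` set xs"
  have YO: "Y \<subseteq> orbits A \<sigma>" using sub by (auto simp: Y_def orbits_def)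
  have cY: "card Y = length xs" using distinct_card[OF dist] by (simp add: Y_def)
  obtain y where "y \<in> set xs" using ne by (cases xs) auto
  then have y: "orbit \<sigma> y \<in> Y" "y \<in> \<Union>Y"
    using self_in_orbit[OF perm, of y] unfolding Y_def by blast+
  have "\<Union>Y \<notin> orbits A \<sigma> - Y"
  proof
    assume *: "\<Union>Y \<in> orbits A \<sigma> - Y"
    then have "\<Union>Y = orbit \<sigma> y" using orbits_eq_orbit[OF perm _ y(2)] by blast
    then show False using * y(1) by simp
  qed
  then show "?eq xs"
    unfolding orbits_cycle_merge[OF perm sub ne dist, folded Y_def]
    using card_Diff_subset[OF finite_subset[OF YO finite_orbits] YO] card_mono[OF finite_orbits YO]
      finite_orbits[of \<sigma>] cY by simp
next
  have "card (orbits A \<sigma>) + 1 \<le> card (orbits A (cycle_of_list xs \<circ> \<sigma>)) + length xs \<and>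
      (?eq xs \<longrightarrow> ?dist xs)"
    using sub ne
  proof (induct xs rule: cycle_of_list.induct)
    case (1 x y ys)
    define \<tau> where "\<tau> = cycle_of_list (y # ys) \<circ> \<sigma>"
    have "card (orbits A \<sigma>) + 1 \<le> card (orbits A \<tau>) + length (y # ys) \<and>
      (card (orbits A \<sigma>) + 1 = card (orbits A \<tau>) + length (y # ys) \<longrightarrow> ?dist (y # ys))"
      unfolding \<tau>_def by (rule 1(1)) (use 1(2) in auto)
    then have IH: "card (orbits A \<sigma>) + 1 \<le> card (orbits A \<tau>) + length (y # ys)"
      "card (orbits A \<sigma>) + 1 = card (orbits A \<tau>) + length (y # ys) \<longrightarrow> ?dist (y # ys)"
      by blast+
    have pt: "\<tau> permutes A"
      unfolding \<tau>_def by (rule cycle_comp_permutes[OF perm]) (use 1(2) in simp)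
    have xA: "x \<in> A" "y \<in> A" using 1(2) by auto
    have eq: "cycle_of_list (x # y # ys) \<circ> \<sigma> = transpose x y \<circ> \<tau>"
      by (simp add: \<tau>_def comp_assoc)
    show ?case
    proof (cases "y \<in> orbit \<tau> x")
      case True
      show ?thesis
        using card_orbits_transpose_same[OF pt xA(1) True] IH(1) unfolding eq list.size by linarith
    next
      case False
      have c: "Suc (card (orbits A (transpose x y \<circ> \<tau>))) = card (orbits A \<tau>)"
        by (rule card_orbits_transpose_merge[OF pt xA False])
      have "?dist (x # y # ys)" if dist: "?dist (y # ys)"
      proof -
        define Y where "Y = orbit \<sigma> ` set (y # ys)"
        have o: "orbits A \<tau> = insert (\<Union>Y) (orbits A \<sigma> - Y)"
          unfolding \<tau>_def Y_def by (rule orbits_cycle_merge[OF perm]) (use 1(2) dist in auto)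
        have "orbit \<sigma> x \<notin> Y"
        proof
          assume *: "orbit \<sigma> x \<in> Y"
          have "\<Union>Y = orbit \<tau> x"
            by (rule orbits_eq_orbit[OF pt])
              (use o * self_in_orbit[OF perm, of x] in blast)+
          moreover have "y \<in> \<Union>Y" using self_in_orbit[OF perm, of y] unfolding Y_def by auto
          ultimately show False using False by simp
        qed
        then show ?thesis using dist unfolding Y_def by auto
      qed
      then show ?thesis using IH c unfolding eq list.size(4)[of x] by linarith
    qed
  next
    case ("2_2" x)
    then show ?case by simp
  qed simp
  then show "?eq xs \<Longrightarrow> ?dist xs" by blast
qed

lemma orbit_conjugate:
  assumes "\<pi> permutes A" "\<sigma> permutes A"
  shows "orbit (\<pi> \<circ> \<sigma> \<circ> inv' \<pi>) (\<pi> x) = \<pi> ` orbit \<sigma> x"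
  by (rule orbit_inverse[symmetric])
    (simp_all add: self_in_orbit[OF assms(2)] permutes_inverses(2)[OF assms(1)])

lemma orbits_conjugate:
  assumes "\<pi> permutes A" "\<sigma> permutes A"
  shows "orbits A (\<pi> \<circ> \<sigma> \<circ> inv' \<pi>) = image \<pi> ` orbits A \<sigma>"
proof -
  have "orbits A (\<pi> \<circ> \<sigma> \<circ> inv' \<pi>) = orbit (\<pi> \<circ> \<sigma> \<circ> inv' \<pi>) ` (\<pi> ` A)"
    unfolding orbits_def permutes_image[OF assms(1)] ..
  also have "\<dots> = image \<pi> ` orbits A \<sigma>"
    unfolding image_image orbits_def orbit_conjugate[OF assms] ..
  finally show ?thesis .
qed

end

lemma orbits_id: "orbits A id = (\<lambda>x. {x}) ` A"
  unfolding orbits_def by (intro image_cong refl) (simp add: orbit_eq_singleton_iff)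

lemma card_orbits_id: "card (orbits A id) = card A"
  unfolding orbits_id by (rule card_image) simp

section \<open>The norm and the number of orbits\<close>

lemma foldr_comp_append:
  "foldr (\<circ>) (ts @ us) id = foldr (\<circ>) ts id \<circ> foldr (\<circ>) us id"
  by (induct ts) (simp_all add: comp_assoc)

text \<open>The identity has \<open>d\<close> orbits and a transposition removes at most one: at least
  \<open>d - card (orbits {1..d} \<sigma>)\<close> factors are needed.\<close>

lemma foldr_transpositions:
  assumes "set ts \<subseteq> transpositions d"
  shows "foldr (\<circ>) ts id permutes {1..d}"
    and "d \<le> card (orbits {1..d} (foldr (\<circ>) ts id)) + length ts"
proof -
  have "foldr (\<circ>) ts id permutes {1..d} \<and>
      d \<le> card (orbits {1..d} (foldr (\<circ>) ts id)) + length ts"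
    using assms
  proof (induct ts)
    case Nil
    show "foldr (\<circ>) [] id permutes {1..d} \<and>
        d \<le> card (orbits {1..d} (foldr (\<circ>) [] id)) + length []"
      using card_orbits_id[of "{1..d}"] by simp
  next
    case (Cons t ts)
    define \<tau> where "\<tau> = foldr (\<circ>) ts id"
    have IH: "\<tau> permutes {1..d}" "d \<le> card (orbits {1..d} \<tau>) + length ts"
      using Cons(1)[OF order.trans[OF set_subset_Cons Cons(2)]] unfolding \<tau>_def by blast+
    obtain a b where t: "t = transpose a b" "a \<in> {1..d}" "b \<in> {1..d}"
      using Cons(2) by (auto simp: transpositions_def)
    have e: "foldr (\<circ>) (t # ts) id = transpose a b \<circ> \<tau>" by (simp add: t \<tau>_def)
    have "card (orbits {1..d} \<tau>) \<le> Suc (card (orbits {1..d} (transpose a b \<circ> \<tau>)))"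
    proof (cases "b \<in> orbit \<tau> a")
      case True
      then show ?thesis
        using card_orbits_transpose_same[OF finite_atLeastAtMost IH(1) t(2) True] by linarith
    next
      case False
      then show ?thesis
        using card_orbits_transpose_merge[OF finite_atLeastAtMost IH(1) t(2,3) False] by linarith
    qed
    then show "foldr (\<circ>) (t # ts) id permutes {1..d} \<and>
        d \<le> card (orbits {1..d} (foldr (\<circ>) (t # ts) id)) + length (t # ts)"
      unfolding e using IH transpose_comp_permutes[OF finite_atLeastAtMost IH(1) t(2,3)] by simp
  qed
  then show "foldr (\<circ>) ts id permutes {1..d}"
    and "d \<le> card (orbits {1..d} (foldr (\<circ>) ts id)) + length ts" by blast+
qed

lemma card_orbits_le:
  "card (orbits {1..d} \<sigma>) \<le> d"
  unfolding orbits_def using card_image_le[of "{1..d}" "orbit \<sigma>"] by simp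

text \<open>This many factors suffice: if \<open>\<sigma> a \<noteq> a\<close>, then composing with the transposition of \<open>a\<close> and
  \<open>\<sigma> a\<close> makes \<open>a\<close> a fixed point, which splits one orbit into two.\<close>

lemma transposition_factorization:
  assumes "\<sigma> permutes {1..d}"
  shows "\<exists>ts. length ts + card (orbits {1..d} \<sigma>) = d \<and> set ts \<subseteq> transpositions d \<and>
    foldr (\<circ>) ts id = \<sigma>"
  using assms
proof (induct "d - card (orbits {1..d} \<sigma>)" arbitrary: \<sigma> rule: less_induct)
  case less
  show ?case
  proof (cases "\<sigma> = id")
    case True
    then show ?thesis using card_orbits_id[of "{1..d}"] by (intro exI[of _ "[]"]) simp
  next
    case False
    then obtain a where a: "\<sigma> a \<noteq> a" by (auto simp: fun_eq_iff)
    then have aA: "a \<in> {1..d}" using permutes_not_in[OF less(2)] by blast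
    define b where "b = \<sigma> a"
    have bA: "b \<in> {1..d}" unfolding b_def using aA permutes_in_image[OF less(2), of a] by simp
    define \<tau> where "\<tau> = transpose a b \<circ> \<sigma>"
    have pt: "\<tau> permutes {1..d}"
      unfolding \<tau>_def by (rule transpose_comp_permutes[OF finite_atLeastAtMost less(2) aA bA])
    have "\<tau> a = a" unfolding \<tau>_def b_def by simp
    then have "orbit \<tau> a = {a}" by (simp add: orbit_eq_singleton_iff)
    then have nb: "b \<notin> orbit \<tau> a" using a b_def by simp
    have eq: "transpose a b \<circ> \<tau> = \<sigma>"
      unfolding \<tau>_def by (simp add: fun_eq_iff)
    have c: "Suc (card (orbits {1..d} \<sigma>)) = card (orbits {1..d} \<tau>)"
      using card_orbits_transpose_merge[OF finite_atLeastAtMost pt aA bA nb] unfolding eq .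
    have "d - card (orbits {1..d} \<tau>) < d - card (orbits {1..d} \<sigma>)"
      using c card_orbits_le[of d \<tau>] by linarith
    from less(1)[OF this pt] obtain ts where ts: "length ts + card (orbits {1..d} \<tau>) = d"
      "set ts \<subseteq> transpositions d" "foldr (\<circ>) ts id = \<tau>"
      by blast
    have "transpose a b \<in> transpositions d"
      unfolding transpositions_def
      by (intro CollectI exI[of _ a] exI[of _ b] conjI refl aA bA) (simp add: b_def a[symmetric])
    then show ?thesis
      using ts c eq by (intro exI[of _ "transpose a b # ts"]) auto
  qed
qed

theorem perm_norm_orbits:
  assumes "\<sigma> permutes {1..d}"
  shows "perm_norm d \<sigma> + card (orbits {1..d} \<sigma>) = d"
proof -
  obtain ts where ts: "length ts + card (orbits {1..d} \<sigma>) = d" "set ts \<subseteq> transpositions d"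
    "foldr (\<circ>) ts id = \<sigma>"
    using transposition_factorization[OF assms] by blast
  have "perm_norm d \<sigma> = d - card (orbits {1..d} \<sigma>)"
    unfolding perm_norm_def
  proof (rule Least_equality)
    show "\<exists>ts. length ts = d - card (orbits {1..d} \<sigma>) \<and> set ts \<subseteq> transpositions d \<and>
        foldr (\<circ>) ts id = \<sigma>"
      using ts by (intro exI[of _ ts]) auto
    fix n assume "\<exists>ts. length ts = n \<and> set ts \<subseteq> transpositions d \<and> foldr (\<circ>) ts id = \<sigma>"
    then obtain us where "length us = n" "set us \<subseteq> transpositions d" "foldr (\<circ>) us id = \<sigma>"
      by blast
    then show "d - card (orbits {1..d} \<sigma>) \<le> n"
      using foldr_transpositions(2)[of us d] by simp
  qed
  then show ?thesis using card_orbits_le[of d \<sigma>] by simp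
qed

lemma perm_norm_factorization:
  assumes "\<sigma> permutes {1..d}"
  obtains ts where "length ts = perm_norm d \<sigma>" "set ts \<subseteq> transpositions d" "foldr (\<circ>) ts id = \<sigma>"
proof -
  obtain ts where ts: "length ts + card (orbits {1..d} \<sigma>) = d" "set ts \<subseteq> transpositions d"
    "foldr (\<circ>) ts id = \<sigma>"
    using transposition_factorization[OF assms] by blast
  show thesis by (rule that[OF _ ts(2,3)]) (use ts(1) perm_norm_orbits[OF assms] in linarith)
qed

lemma perm_norm_comp_le:
  assumes "\<sigma> permutes {1..d}" "\<tau> permutes {1..d}"
  shows "perm_norm d (\<sigma> \<circ> \<tau>) \<le> perm_norm d \<sigma> + perm_norm d \<tau>"
proof -
  obtain ts where ts: "length ts = perm_norm d \<sigma>" "set ts \<subseteq> transpositions d" "foldr (\<circ>) ts id = \<sigma>"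
    using perm_norm_factorization[OF assms(1)] .
  obtain us where us: "length us = perm_norm d \<tau>" "set us \<subseteq> transpositions d" "foldr (\<circ>) us id = \<tau>"
    using perm_norm_factorization[OF assms(2)] .
  have "foldr (\<circ>) (ts @ us) id = \<sigma> \<circ> \<tau>" by (simp only: foldr_comp_append ts us)
  then have "perm_norm d (\<sigma> \<circ> \<tau>) \<le> length (ts @ us)"
    unfolding perm_norm_def using ts us by (intro Least_le exI[of _ "ts @ us"]) simp
  then show ?thesis by (simp add: ts us)
qed

lemma perm_norm_id [simp]: "perm_norm d id = 0"
  using perm_norm_orbits[OF permutes_id, of d] card_orbits_id[of "{1..d}"] by simp

lemma perm_norm_eq_0_iff:
  assumes "\<sigma> permutes {1..d}"
  shows "perm_norm d \<sigma> = 0 \<longleftrightarrow> \<sigma> = id"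
proof
  assume "perm_norm d \<sigma> = 0"
  then show "\<sigma> = id" by (rule_tac perm_norm_factorization[OF assms]) simp
qed simp

lemma perm_norm_less:
  assumes "\<sigma> permutes {1..d}" "d \<ge> 1"
  shows "perm_norm d \<sigma> < d"
proof -
  have "orbits {1..d} \<sigma> \<noteq> {}" using assms(2) by (simp add: orbits_def)
  then have "card (orbits {1..d} \<sigma>) > 0" using finite_orbits[OF finite_atLeastAtMost] by (simp add: card_gt_0_iff)
  then show ?thesis using perm_norm_orbits[OF assms(1)] by linarith
qed

lemma perm_norm_conjugate:
  assumes "\<pi> permutes {1..d}" "\<sigma> permutes {1..d}"
  shows "perm_norm d (\<pi> \<circ> \<sigma> \<circ> inv' \<pi>) = perm_norm d \<sigma>"
proof -
  have "card (image \<pi> ` orbits {1..d} \<sigma>) = card (orbits {1..d} \<sigma>)"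
    by (rule card_image) (simp add: inj_on_def inj_image_eq_iff[OF permutes_inj[OF assms(1)]])
  then have "card (orbits {1..d} (\<pi> \<circ> \<sigma> \<circ> inv' \<pi>)) = card (orbits {1..d} \<sigma>)"
    by (simp only: orbits_conjugate[OF finite_atLeastAtMost assms])
  moreover have "\<pi> \<circ> \<sigma> \<circ> inv' \<pi> permutes {1..d}"
    using assms by (intro permutes_compose permutes_inv)
  ultimately show ?thesis
    using perm_norm_orbits[OF assms(2)] perm_norm_orbits[of "\<pi> \<circ> \<sigma> \<circ> inv' \<pi>" d] by simp
qed

text \<open>Joining distinct orbits is the only way in which the norms of a cycle and of a permutation can
  add up. Everything below depends on this.\<close>

lemma perm_norm_cycle_comp:
  assumes "\<sigma> permutes {1..d}" "set xs \<subseteq> {1..d}" "xs \<noteq> []"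
  shows "perm_norm d (cycle_of_list xs \<circ> \<sigma>) = perm_norm d \<sigma> + (length xs - 1) \<longleftrightarrow>
    distinct (map (orbit \<sigma>) xs)"
proof -
  have p: "cycle_of_list xs \<circ> \<sigma> permutes {1..d}"
    by (rule cycle_comp_permutes[OF finite_atLeastAtMost assms(1,2)])
  have l: "length xs > 0" using assms(3) by simp
  show ?thesis
    unfolding card_orbits_cycle_merge[OF finite_atLeastAtMost assms, symmetric]
    using l perm_norm_orbits[OF p] perm_norm_orbits[OF assms(1)] by linarith
qed

lemma orbit_id [simp]: "orbit id x = {x}"
  by (simp add: orbit_eq_singleton_iff)

lemma perm_norm_cycle:
  assumes "distinct xs" "set xs \<subseteq> {1..d}" "xs \<noteq> []"
  shows "perm_norm d (cycle_of_list xs) = length xs - 1"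
proof -
  have "distinct (map (orbit id) xs)" using assms(1) by (simp add: distinct_map inj_on_def)
  then show ?thesis using perm_norm_cycle_comp[OF permutes_id assms(2,3)] by simp
qed

section \<open>Sums over subsets and over lists that meet distinct orbits\<close>

definition subsets_of_card :: "'a set \<Rightarrow> nat \<Rightarrow> 'a set set" where
  "subsets_of_card Q m = {S. S \<subseteq> Q \<and> card S = m}"

lemma finite_subsets_of_card: "finite Q \<Longrightarrow> finite (subsets_of_card Q m)"
  by (simp add: subsets_of_card_def)

text \<open>Both sides run over the pairs of a set of \<open>m + 1\<close> elements and one of its elements.\<close>

lemma sum_insert_subsets:
  fixes F :: "'a \<Rightarrow> 'a set \<Rightarrow> 'b::comm_monoid_add"
  assumes "finite Q"
  shows "(\<Sum>S\<in>subsets_of_card Q m. \<Sum>x\<in>Q - S. F x (insert x S)) =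
    (\<Sum>T\<in>subsets_of_card Q (Suc m). \<Sum>x\<in>T. F x T)"
proof -
  have fin: "finite S" if "S \<in> subsets_of_card Q k" for S k
    using that assms finite_subset by (auto simp: subsets_of_card_def)
  have "(\<Sum>S\<in>subsets_of_card Q m. \<Sum>x\<in>Q - S. F x (insert x S)) =
      (\<Sum>(S, x)\<in>(SIGMA S:subsets_of_card Q m. Q - S). F x (insert x S))"
    using assms by (intro sum.Sigma) (simp_all add: finite_subsets_of_card)
  also have "\<dots> = (\<Sum>(T, x)\<in>(SIGMA T:subsets_of_card Q (Suc m). T). F x T)"
  proof (rule sum.reindex_bij_witness[where
        i = "\<lambda>(T, x). (T - {x}, x)" and j = "\<lambda>(S, x). (insert x S, x)"])
    fix p assume p: "p \<in> (SIGMA S:subsets_of_card Q m. Q - S)"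
    then obtain S x where Sx: "p = (S, x)" "S \<in> subsets_of_card Q m" "x \<in> Q" "x \<notin> S"
      by auto
    show "(\<lambda>(T, x). (T - {x}, x)) ((\<lambda>(S, x). (insert x S, x)) p) = p" using Sx by simp
    show "(\<lambda>(S, x). (insert x S, x)) p \<in> (SIGMA T:subsets_of_card Q (Suc m). T)"
      using Sx fin[of S m] by (simp add: subsets_of_card_def)
    show "(case (\<lambda>(S, x). (insert x S, x)) p of (T, x) \<Rightarrow> F x T) = (case p of (S, x) \<Rightarrow> F x (insert x S))"
      using Sx by simp
  next
    fix p assume p: "p \<in> (SIGMA T:subsets_of_card Q (Suc m). T)"
    then obtain T x where Tx: "p = (T, x)" "T \<in> subsets_of_card Q (Suc m)" "x \<in> T" by auto
    show "(\<lambda>(S, x). (insert x S, x)) ((\<lambda>(T, x). (T - {x}, x)) p) = p"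
      using Tx by (simp add: insert_absorb)
    show "(\<lambda>(T, x). (T - {x}, x)) p \<in> (SIGMA S:subsets_of_card Q m. Q - S)"
      using Tx fin[of T "Suc m"] by (auto simp: subsets_of_card_def)
  qed
  also have "\<dots> = (\<Sum>T\<in>subsets_of_card Q (Suc m). \<Sum>x\<in>T. F x T)"
    using assms fin by (intro sum.Sigma[symmetric]) (auto simp: finite_subsets_of_card)
  finally show ?thesis .
qed

lemma sum_subsets_split_element:
  fixes F :: "'a \<Rightarrow> 'a set \<Rightarrow> 'b::comm_monoid_add"
  assumes "finite Q"
  shows "(\<Sum>T\<in>subsets_of_card Q (Suc m). \<Sum>x\<in>T. F x T) =
    (\<Sum>x\<in>Q. \<Sum>S\<in>subsets_of_card (Q - {x}) m. F x (insert x S))"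
proof -
  have "(\<Sum>T\<in>subsets_of_card Q (Suc m). \<Sum>x\<in>T. F x T) =
      (\<Sum>S\<in>subsets_of_card Q m. \<Sum>x\<in>Q. if x \<notin> S then F x (insert x S) else 0)"
    unfolding sum_insert_subsets[OF assms, symmetric]
    using assms by (intro sum.cong refl sum.mono_neutral_cong_left) auto
  also have "\<dots> = (\<Sum>x\<in>Q. \<Sum>S\<in>subsets_of_card Q m. if x \<notin> S then F x (insert x S) else 0)"
    by (rule sum.swap)
  also have "\<dots> = (\<Sum>x\<in>Q. \<Sum>S\<in>subsets_of_card (Q - {x}) m. F x (insert x S))"
    using assms
    by (intro sum.cong refl sum.mono_neutral_cong_right) (auto simp: subsets_of_card_def)
  finally show ?thesis .
qed

lemma card_subsets_split:
  assumes "finite B" "finite U" "B \<inter> U = {}" "k \<le> m"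
  shows "card {S \<in> subsets_of_card (B \<union> U) m. card (S \<inter> B) = k} =
    (card B choose k) * (card U choose (m - k))"
proof -
  have "bij_betw (\<lambda>(X, Y). X \<union> Y) (subsets_of_card B k \<times> subsets_of_card U (m - k))
      {S \<in> subsets_of_card (B \<union> U) m. card (S \<inter> B) = k}"
  proof (rule bij_betw_byWitness[where f' = "\<lambda>S. (S \<inter> B, S \<inter> U)"])
    show "\<forall>p\<in>subsets_of_card B k \<times> subsets_of_card U (m - k).
        ((case p of (X, Y) \<Rightarrow> X \<union> Y) \<inter> B, (case p of (X, Y) \<Rightarrow> X \<union> Y) \<inter> U) = p"
      using assms(3) by (auto simp: subsets_of_card_def)
    show "\<forall>S\<in>{S \<in> subsets_of_card (B \<union> U) m. card (S \<inter> B) = k}.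
        (case (S \<inter> B, S \<inter> U) of (X, Y) \<Rightarrow> X \<union> Y) = S"
      by (auto simp: subsets_of_card_def)
    show "(\<lambda>(X, Y). X \<union> Y) ` (subsets_of_card B k \<times> subsets_of_card U (m - k)) \<subseteq>
        {S \<in> subsets_of_card (B \<union> U) m. card (S \<inter> B) = k}"
    proof clarify
      fix X Y assume XY: "X \<in> subsets_of_card B k" "Y \<in> subsets_of_card U (m - k)"
      then have "X \<inter> Y = {}" "finite X" "finite Y" "(X \<union> Y) \<inter> B = X"
        using assms finite_subset by (auto simp: subsets_of_card_def)
      then show "X \<union> Y \<in> subsets_of_card (B \<union> U) m \<and> card ((X \<union> Y) \<inter> B) = k"
        using XY assms(4) by (auto simp: subsets_of_card_def card_Un_disjoint)
    qed
    show "(\<lambda>S. (S \<inter> B, S \<inter> U)) ` {S \<in> subsets_of_card (B \<union> U) m. card (S \<inter> B) = k} \<subseteq>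
        subsets_of_card B k \<times> subsets_of_card U (m - k)"
    proof (rule image_subsetI)
      fix S assume S: "S \<in> {S \<in> subsets_of_card (B \<union> U) m. card (S \<inter> B) = k}"
      then have "S = (S \<inter> B) \<union> (S \<inter> U)" "(S \<inter> B) \<inter> (S \<inter> U) = {}"
        using assms(3) by (auto simp: subsets_of_card_def)
      then have "card S = card (S \<inter> B) + card (S \<inter> U)"
        using assms(1,2) by (metis card_Un_disjoint finite_Int)
      then show "(S \<inter> B, S \<inter> U) \<in> subsets_of_card B k \<times> subsets_of_card U (m - k)"
        using S by (auto simp: subsets_of_card_def)
    qed
  qed
  then have "card {S \<in> subsets_of_card (B \<union> U) m. card (S \<inter> B) = k} =
      card (subsets_of_card B k \<times> subsets_of_card U (m - k))"
    by (rule bij_betw_same_card[symmetric])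
  then show ?thesis
    using assms(1,2) by (simp add: card_cartesian_product subsets_of_card_def n_subsets)
qed

text \<open>The summand only depends on the size of the intersection with \<open>B\<close>, and the number of subsets
  with a given intersection size is a product of two binomial coefficients.\<close>

lemma sum_subsets_by_card_Int:
  fixes f :: "nat \<Rightarrow> 'b::comm_semiring_1"
  assumes "finite B" "finite U" "B \<inter> U = {}"
  shows "(\<Sum>S\<in>subsets_of_card (B \<union> U) m. f (card (S \<inter> B))) =
    (\<Sum>k\<le>m. of_nat ((card B choose k) * (card U choose (m - k))) * f k)"
proof -
  have le: "card (S \<inter> B) \<le> m" if "S \<in> subsets_of_card (B \<union> U) m" for S
  proof -
    have "finite S" using that assms finite_subset by (auto simp: subsets_of_card_def)
    then show ?thesis using that card_mono[of S "S \<inter> B"] by (auto simp: subsets_of_card_def)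
  qed
  have "(\<Sum>S\<in>subsets_of_card (B \<union> U) m. f (card (S \<inter> B))) =
      (\<Sum>k\<le>m. \<Sum>S\<in>{S \<in> subsets_of_card (B \<union> U) m. card (S \<inter> B) = k}. f (card (S \<inter> B)))"
    using assms le
    by (intro sum.group[symmetric]) (auto simp: finite_subsets_of_card)
  also have "\<dots> = (\<Sum>k\<le>m. of_nat ((card B choose k) * (card U choose (m - k))) * f k)"
  proof (rule sum.cong[OF refl])
    fix k assume "k \<in> {..m}"
    have "(\<Sum>S\<in>{S \<in> subsets_of_card (B \<union> U) m. card (S \<inter> B) = k}. f (card (S \<inter> B))) =
        (\<Sum>S\<in>{S \<in> subsets_of_card (B \<union> U) m. card (S \<inter> B) = k}. f k)"
      by (rule sum.cong) auto
    then show "(\<Sum>S\<in>{S \<in> subsets_of_card (B \<union> U) m. card (S \<inter> B) = k}. f (card (S \<inter> B))) =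
        of_nat ((card B choose k) * (card U choose (m - k))) * f k"
      using card_subsets_split[OF assms, of k m] \<open>k \<in> {..m}\<close> by simp
  qed
  finally show ?thesis .
qed

text \<open>Pascal's rule \<open>(q+1 choose k+1) = (q choose k+1) + (q choose k)\<close> turns the left-hand side into
  a sum over first differences of \<open>f m = (D+m)!/m!\<close>, and \<open>f (m+1) - f m = D (D+m)!/(m+1)!\<close>.\<close>

lemma alternating_factorial_sum:
  fixes q D a :: nat
  assumes "D \<ge> 1"
  shows "(\<Sum>k\<le>a. (-1) ^ k * of_nat (Suc q choose k) * (fact (D + (a - k)) / fact (a - k))) =
    of_nat D * (\<Sum>k\<le>a. (-1) ^ k * of_nat (q choose k) *
      (fact (D + (a - k) - 1) / fact (a - k)) :: rat)"
proof -
  define f :: "nat \<Rightarrow> rat" where "f m = fact (D + m) / fact m" for m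
  define g :: "nat \<Rightarrow> rat" where "g m = fact (D + m - 1) / fact m" for m
  obtain D' where D: "D = Suc D'" using assms by (cases D) auto
  have f0: "f 0 = of_nat D * g 0" by (simp add: f_def g_def D)
  have fS: "f (Suc m) - f m = of_nat D * g (Suc m)" for m
    unfolding f_def g_def D by (simp add: field_simps del: of_nat_Suc) (simp add: algebra_simps)
  have "(\<Sum>k\<le>a. (-1) ^ k * of_nat (Suc q choose k) * f (a - k)) =
      of_nat D * (\<Sum>k\<le>a. (-1) ^ k * of_nat (q choose k) * g (a - k))"
  proof (cases a)
    case 0
    then show ?thesis by (simp add: f0)
  next
    case (Suc b)
    have "(\<Sum>k\<le>Suc b. (-1) ^ k * of_nat (Suc q choose k) * f (Suc b - k)) =
        f (Suc b) + (\<Sum>k\<le>b. (-1) ^ Suc k * of_nat (Suc q choose Suc k) * f (b - k))"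
      by (subst sum.atMost_Suc_shift) simp
    also have "(\<Sum>k\<le>b. (-1) ^ Suc k * of_nat (Suc q choose Suc k) * f (b - k)) =
        (\<Sum>k\<le>b. (-1) ^ Suc k * of_nat (q choose Suc k) * f (b - k)) -
        (\<Sum>k\<le>b. (-1) ^ k * of_nat (q choose k) * f (b - k))"
      unfolding sum_subtractf[symmetric] by (intro sum.cong refl) (simp add: algebra_simps)
    also have "f (Suc b) + ((\<Sum>k\<le>b. (-1) ^ Suc k * of_nat (q choose Suc k) * f (b - k)) -
        (\<Sum>k\<le>b. (-1) ^ k * of_nat (q choose k) * f (b - k))) =
        (\<Sum>k\<le>Suc b. (-1) ^ k * of_nat (q choose k) * f (Suc b - k)) -
        (\<Sum>k\<le>b. (-1) ^ k * of_nat (q choose k) * f (b - k))"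
      by (subst sum.atMost_Suc_shift) simp
    also have "\<dots> = (\<Sum>k\<le>b. (-1) ^ k * of_nat (q choose k) * (f (Suc (b - k)) - f (b - k))) +
        (-1) ^ Suc b * of_nat (q choose Suc b) * f 0"
      by (simp add: sum_subtractf[symmetric] algebra_simps Suc_diff_le cong: sum.cong_simp)
    also have "\<dots> = of_nat D * (\<Sum>k\<le>Suc b. (-1) ^ k * of_nat (q choose k) * g (Suc b - k))"
      unfolding fS f0
      by (simp add: sum_distrib_left algebra_simps Suc_diff_le cong: sum.cong_simp)
    finally show ?thesis unfolding Suc .
  qed
  then show ?thesis unfolding f_def g_def .
qed


text \<open>Such a list is the notation of a cycle that joins \<open>m\<close> distinct orbits of \<open>\<tau>\<close>. Lists are more
  convenient than cycles because they are conjugated and counted entry by entry; for \<open>m \<ge> 2\<close>,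
  every cycle on \<open>m\<close> points is counted \<open>m\<close> times.\<close>

definition spread_lists :: "'a set \<Rightarrow> ('a \<Rightarrow> 'a) \<Rightarrow> nat \<Rightarrow> 'a list set" where
  "spread_lists A \<tau> m = {xs. length xs = m \<and> set xs \<subseteq> A \<and> distinct (map (orbit \<tau>) xs)}"

lemma finite_spread_lists: "finite A \<Longrightarrow> finite (spread_lists A \<tau> m)"
  by (rule finite_subset[OF _ finite_lists_length_eq[of A m]]) (auto simp: spread_lists_def)

lemma sum_points_by_orbit:
  fixes G :: "'a set \<Rightarrow> rat"
  assumes fin: "finite A" and perm: "\<tau> permutes A"
  shows "(\<Sum>x\<in>{x \<in> A. orbit \<tau> x \<notin> S}. G (orbit \<tau> x)) =
    (\<Sum>P\<in>orbits A \<tau> - S. of_nat (card P) * G P)"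
proof -
  have "(\<Sum>x\<in>{x \<in> A. orbit \<tau> x \<notin> S}. G (orbit \<tau> x)) =
      (\<Sum>P\<in>orbits A \<tau> - S. \<Sum>x\<in>{x \<in> {x \<in> A. orbit \<tau> x \<notin> S}. orbit \<tau> x = P}. G (orbit \<tau> x))"
    by (rule sum.group[symmetric])
      (use fin finite_orbits[OF fin] in \<open>auto simp: orbits_def\<close>)
  also have "\<dots> = (\<Sum>P\<in>orbits A \<tau> - S. of_nat (card P) * G P)"
  proof (rule sum.cong[OF refl])
    fix P assume P: "P \<in> orbits A \<tau> - S"
    have "{x \<in> {x \<in> A. orbit \<tau> x \<notin> S}. orbit \<tau> x = P} = P"
    proof (intro equalityI subsetI)
      fix x assume "x \<in> {x \<in> {x \<in> A. orbit \<tau> x \<notin> S}. orbit \<tau> x = P}"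
      then show "x \<in> P" using self_in_orbit[OF fin perm, of x] by auto
    next
      fix x assume x: "x \<in> P"
      then have "orbit \<tau> x = P" using orbits_eq_orbit[OF fin perm] P by blast
      moreover have "x \<in> A" using orbits_cover(1)[OF fin perm] P x by blast
      ultimately show "x \<in> {x \<in> {x \<in> A. orbit \<tau> x \<notin> S}. orbit \<tau> x = P}" using P by auto
    qed
    moreover have "(\<Sum>x\<in>{x \<in> {x \<in> A. orbit \<tau> x \<notin> S}. orbit \<tau> x = P}. G (orbit \<tau> x)) =
        (\<Sum>x\<in>{x \<in> {x \<in> A. orbit \<tau> x \<notin> S}. orbit \<tau> x = P}. G P)"
      by (rule sum.cong) auto
    ultimately show "(\<Sum>x\<in>{x \<in> {x \<in> A. orbit \<tau> x \<notin> S}. orbit \<tau> x = P}. G (orbit \<tau> x)) =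
        of_nat (card P) * G P" by simp
  qed
  finally show ?thesis .
qed

text \<open>A set \<open>S\<close> of \<open>m\<close> orbits is met by \<open>m!\<close> orderings times one point from each orbit.\<close>

lemma sum_spread_lists:
  fixes h :: "'a set set \<Rightarrow> rat"
  assumes fin: "finite A" and perm: "\<tau> permutes A"
  shows "(\<Sum>xs\<in>spread_lists A \<tau> m. h (orbit \<tau> ` set xs)) =
    fact m * (\<Sum>S\<in>subsets_of_card (orbits A \<tau>) m. (\<Prod>P\<in>S. of_nat (card P)) * h S)"
proof (induct m arbitrary: h)
  case 0
  have "spread_lists A \<tau> 0 = {[]}" by (auto simp: spread_lists_def)
  moreover have "subsets_of_card (orbits A \<tau>) 0 = {{}}"
    by (auto simp: subsets_of_card_def card_eq_0_iff
        dest: finite_subset[OF _ finite_orbits[OF fin]])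
  ultimately show ?case by simp
next
  case (Suc m)
  let ?Q = "orbits A \<tau>"
  let ?c = "\<lambda>P. of_nat (card P) :: rat"
  define h' where "h' S = (\<Sum>P\<in>?Q - S. ?c P * h (insert P S))" for S
  have "(\<Sum>ys\<in>spread_lists A \<tau> (Suc m). h (orbit \<tau> ` set ys)) =
      (\<Sum>(xs, x)\<in>(SIGMA xs:spread_lists A \<tau> m. {x \<in> A. orbit \<tau> x \<notin> orbit \<tau> ` set xs}).
        h (insert (orbit \<tau> x) (orbit \<tau> ` set xs)))"
    by (rule sum.reindex_bij_witness[where j = "\<lambda>ys. (tl ys, hd ys)" and i = "\<lambda>(xs, x). x # xs"])
      (auto simp: spread_lists_def length_Suc_conv)
  also have "\<dots> = (\<Sum>xs\<in>spread_lists A \<tau> m. \<Sum>x\<in>{x \<in> A. orbit \<tau> x \<notin> orbit \<tau> ` set xs}.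
        h (insert (orbit \<tau> x) (orbit \<tau> ` set xs)))"
    using fin by (intro sum.Sigma[symmetric]) (simp_all add: finite_spread_lists)
  also have "\<dots> = (\<Sum>xs\<in>spread_lists A \<tau> m. h' (orbit \<tau> ` set xs))"
    unfolding h'_def
    by (intro sum.cong refl sum_points_by_orbit[OF fin perm, where G = "\<lambda>P. h (insert P T)" for T])
  also have "\<dots> = fact m * (\<Sum>S\<in>subsets_of_card ?Q m. (\<Prod>P\<in>S. ?c P) * h' S)"
    by (rule Suc)
  also have "(\<Sum>S\<in>subsets_of_card ?Q m. (\<Prod>P\<in>S. ?c P) * h' S) =
      (\<Sum>S\<in>subsets_of_card ?Q m. \<Sum>P\<in>?Q - S. (\<Prod>P\<in>insert P S. ?c P) * h (insert P S))"
  proof (rule sum.cong[OF refl])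
    fix S assume "S \<in> subsets_of_card ?Q m"
    then have "finite S"
      using finite_subset[OF _ finite_orbits[OF fin, of \<tau>], of S]
      by (simp add: subsets_of_card_def)
    then show "(\<Prod>P\<in>S. ?c P) * h' S =
        (\<Sum>P\<in>?Q - S. (\<Prod>P\<in>insert P S. ?c P) * h (insert P S))"
      unfolding h'_def sum_distrib_left by (intro sum.cong refl) simp
  qed
  also have "\<dots> = (\<Sum>T\<in>subsets_of_card ?Q (Suc m). \<Sum>P\<in>T. (\<Prod>P\<in>T. ?c P) * h T)"
    by (rule sum_insert_subsets[OF finite_orbits[OF fin], where F = "\<lambda>_ T. (\<Prod>P\<in>T. ?c P) * h T"])
  also have "\<dots> = of_nat (Suc m) * (\<Sum>T\<in>subsets_of_card ?Q (Suc m). (\<Prod>P\<in>T. ?c P) * h T)"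
    unfolding sum_distrib_left by (intro sum.cong refl) (simp add: subsets_of_card_def)
  finally show ?case by (simp add: algebra_simps)
qed

section \<open>Weights of permutations\<close>

definition nontrivial_orbits :: "'a set \<Rightarrow> ('a \<Rightarrow> 'a) \<Rightarrow> 'a set set" where
  "nontrivial_orbits A \<sigma> = {P \<in> orbits A \<sigma>. card P \<noteq> 1}"

definition trivial_orbits :: "'a set \<Rightarrow> ('a \<Rightarrow> 'a) \<Rightarrow> 'a set set" where
  "trivial_orbits A \<sigma> = {P \<in> orbits A \<sigma>. card P = 1}"

text \<open>Where the formula comes from: up to a constant, the orbit sizes and automorphism factors, it is
  the coefficient of a monomial of degree \<open>r\<close> in \<open>[u\<^sup>n] (1 + h\<^sub>1 u + h\<^sub>2 u\<^sup>2 + \<dots>)\<^bsup>-n\<^esup>\<close>. By Lagrange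
  inversion, this expresses the \<open>n\<close>-th power sum, a primitive element of the ring of symmetric
  functions, in the multiplicative basis that is dual to the class sums for large \<open>d\<close>.\<close>

definition orbit_weight :: "nat \<Rightarrow> nat \<Rightarrow> nat \<Rightarrow> rat" where
  "orbit_weight d n r = (-1) ^ r * fact (n + r - 1) * fact (d - n - r)"

definition perm_weight :: "nat \<Rightarrow> nat \<Rightarrow> (nat \<Rightarrow> nat) \<Rightarrow> rat" where
  "perm_weight d n \<sigma> = (\<Prod>P\<in>orbits {1..d} \<sigma>. of_nat (card P)) *
     orbit_weight d n (card (nontrivial_orbits {1..d} \<sigma>))"

lemma orbits_split:
  "orbits A \<sigma> = nontrivial_orbits A \<sigma> \<union> trivial_orbits A \<sigma>"
  "nontrivial_orbits A \<sigma> \<inter> trivial_orbits A \<sigma> = {}"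
  by (auto simp: nontrivial_orbits_def trivial_orbits_def)

lemma finite_orbits_split:
  assumes "finite A"
  shows "finite (nontrivial_orbits A \<sigma>)" "finite (trivial_orbits A \<sigma>)"
  using finite_orbits[OF assms, of \<sigma>]
  by (auto simp: nontrivial_orbits_def trivial_orbits_def)

lemma orbits_spread_merge:
  assumes fin: "finite A" and perm: "\<tau> permutes A" and xs: "xs \<in> spread_lists A \<tau> (Suc a)" and "a \<ge> 1"
  defines "S \<equiv> orbit \<tau> ` set xs"
  shows "S \<in> subsets_of_card (orbits A \<tau>) (Suc a)"
    and "orbits A (cycle_of_list xs \<circ> \<tau>) = insert (\<Union>S) (orbits A \<tau> - S)"
    and "\<Union>S \<notin> orbits A \<tau> - S"
    and "card (\<Union>S) = (\<Sum>P\<in>S. card P)"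
    and "card (\<Union>S) \<ge> 2"
    and "nontrivial_orbits A (cycle_of_list xs \<circ> \<tau>) = insert (\<Union>S) (nontrivial_orbits A \<tau> - S)"
    and "trivial_orbits A (cycle_of_list xs \<circ> \<tau>) = trivial_orbits A \<tau> - S"
proof -
  have x: "length xs = Suc a" "set xs \<subseteq> A" "distinct (map (orbit \<tau>) xs)"
    using xs by (auto simp: spread_lists_def)
  have ne: "xs \<noteq> []" using x(1) by auto
  show S: "S \<in> subsets_of_card (orbits A \<tau>) (Suc a)"
    using x distinct_card[OF x(3)] by (auto simp: S_def subsets_of_card_def orbits_def)
  then have SQ: "S \<subseteq> orbits A \<tau>" "card S = Suc a" by (auto simp: subsets_of_card_def)
  show o: "orbits A (cycle_of_list xs \<circ> \<tau>) = insert (\<Union>S) (orbits A \<tau> - S)"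
    unfolding S_def by (rule orbits_cycle_merge[OF fin perm x(2) ne x(3)])
  obtain y where y: "y \<in> set xs" using ne by (cases xs) auto
  then have yS: "orbit \<tau> y \<in> S" "y \<in> \<Union>S"
    using self_in_orbit[OF fin perm, of y] unfolding S_def by blast+
  show n: "\<Union>S \<notin> orbits A \<tau> - S"
  proof
    assume *: "\<Union>S \<in> orbits A \<tau> - S"
    then have "\<Union>S = orbit \<tau> y" using orbits_eq_orbit[OF fin perm _ yS(2)] by blast
    then show False using * yS(1) by simp
  qed
  show c: "card (\<Union>S) = (\<Sum>P\<in>S. card P)"
  proof (rule card_Union_disjoint)
    show "pairwise disjnt S"
      using SQ(1) orbits_disjoint[OF fin perm] by (intro pairwiseI) (simp add: disjnt_def subset_iff)
    show "finite P" if "P \<in> S" for P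
      using orbits_cover(3)[OF fin perm] SQ(1) that by blast
  qed
  have pos: "card P \<ge> 1" if "P \<in> S" for P
    using orbits_cover(2,3)[OF fin perm, of P] SQ(1) that by (simp add: Suc_le_eq card_gt_0_iff subset_iff)
  have "Suc a = (\<Sum>P\<in>S. 1)" using SQ(2) by simp
  also have "\<dots> \<le> (\<Sum>P\<in>S. card P)" by (rule sum_mono) (rule pos)
  finally show g: "card (\<Union>S) \<ge> 2" using c assms(4) by simp
  show "nontrivial_orbits A (cycle_of_list xs \<circ> \<tau>) = insert (\<Union>S) (nontrivial_orbits A \<tau> - S)"
    unfolding nontrivial_orbits_def o using g by auto
  show "trivial_orbits A (cycle_of_list xs \<circ> \<tau>) = trivial_orbits A \<tau> - S"
    unfolding trivial_orbits_def o using g by auto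
qed

lemma card_orbit_pos:
  "finite A \<Longrightarrow> \<tau> permutes A \<Longrightarrow> P \<in> orbits A \<tau> \<Longrightarrow> card P > 0"
  using orbits_cover(2,3)[of A \<tau> P] by (simp add: card_gt_0_iff)

text \<open>Merging the orbits in \<open>S\<close> replaces the product of their sizes by the sum of their sizes. For
  \<open>a \<ge> 1\<close> the merged orbit is nontrivial, which accounts for the \<open>+ 1\<close>.\<close>

lemma perm_weight_merge:
  assumes perm: "\<tau> permutes {1..d}" and xs: "xs \<in> spread_lists {1..d} \<tau> (Suc a)" and a: "a \<ge> 1"
  defines "S \<equiv> orbit \<tau> ` set xs"
  shows "perm_weight d n (cycle_of_list xs \<circ> \<tau>) =
    (\<Prod>P\<in>orbits {1..d} \<tau>. of_nat (card P)) / (\<Prod>P\<in>S. of_nat (card P)) * of_nat (\<Sum>P\<in>S. card P) *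
    orbit_weight d n (card (nontrivial_orbits {1..d} \<tau>) + 1 - card (S \<inter> nontrivial_orbits {1..d} \<tau>))"
proof -
  let ?A = "{1..d}" and ?Q = "orbits {1..d} \<tau>" and ?B = "nontrivial_orbits {1..d} \<tau>"
  note m = orbits_spread_merge[OF finite_atLeastAtMost perm xs a, folded S_def]
  have fQ: "finite ?Q" by (rule finite_orbits) simp
  have SQ: "S \<subseteq> ?Q" using m(1) by (simp add: subsets_of_card_def)
  have fB: "finite ?B" by (rule finite_orbits_split) simp
  have "(\<Prod>P\<in>?Q. of_nat (card P)) = (\<Prod>P\<in>?Q - S. of_nat (card P)) * (\<Prod>P\<in>S. of_nat (card P) :: rat)"
    by (rule prod.subset_diff[OF SQ fQ])
  moreover have "(\<Prod>P\<in>S. of_nat (card P) :: rat) \<noteq> 0"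
    using card_orbit_pos[OF finite_atLeastAtMost perm] SQ finite_subset[OF SQ fQ] by (auto simp: subset_iff)
  moreover have "(\<Prod>P\<in>orbits ?A (cycle_of_list xs \<circ> \<tau>). of_nat (card P)) =
      of_nat (\<Sum>P\<in>S. card P) * (\<Prod>P\<in>?Q - S. of_nat (card P) :: rat)"
    unfolding m(2) using fQ m(3,4) by (subst prod.insert) simp_all
  moreover have "card (nontrivial_orbits ?A (cycle_of_list xs \<circ> \<tau>)) = card ?B + 1 - card (S \<inter> ?B)"
  proof -
    have "\<Union>S \<notin> ?B - S" using m(3) by (auto simp: nontrivial_orbits_def)
    moreover have "card (?B - S) = card ?B - card (S \<inter> ?B)"
      using card_Diff_subset_Int[of ?B S] fB by (simp add: Int_commute)
    moreover have "card (S \<inter> ?B) \<le> card ?B" using fB by (intro card_mono) auto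
    ultimately show ?thesis unfolding m(6) using fB by (simp add: Suc_diff_le)
  qed
  ultimately show ?thesis unfolding perm_weight_def by simp
qed

text \<open>By the previous lemmas, the sum is a constant times the sum over sets \<open>S\<close> of \<open>a+1\<close> orbits of
  \<open>(\<Sum>P\<in>S. card P)\<close> times an orbit weight that depends only on the number of nontrivial orbits in
  \<open>S\<close>. Single out the orbit \<open>P\<close> of the inner sum. The nontrivial choices of \<open>P\<close> have total size
  \<open>d - u\<close> and the trivial ones total size \<open>u\<close>; the other \<open>a\<close> orbits are counted by binomial
  coefficients.\<close>

lemma sum_perm_weight:
  assumes perm: "\<tau> permutes {1..d}" and a: "a \<ge> 1"
  defines "r \<equiv> card (nontrivial_orbits {1..d} \<tau>)" and "u \<equiv> card (trivial_orbits {1..d} \<tau>)"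
  shows "(\<Sum>xs\<in>spread_lists {1..d} \<tau> (Suc a). perm_weight d n (cycle_of_list xs \<circ> \<tau>)) =
    fact (Suc a) * (\<Prod>P\<in>orbits {1..d} \<tau>. of_nat (card P)) *
     (of_nat (d - u) * (\<Sum>k\<le>a. of_nat ((r - 1 choose k) * (u choose (a - k))) * orbit_weight d n (r - k)) +
      of_nat u * (\<Sum>k\<le>a. of_nat ((r choose k) * (u - 1 choose (a - k))) * orbit_weight d n (r + 1 - k)))"
proof -
  let ?Q = "orbits {1..d} \<tau>" and ?B = "nontrivial_orbits {1..d} \<tau>" and ?U = "trivial_orbits {1..d} \<tau>"
  let ?c = "\<lambda>P. of_nat (card P) :: rat"
  let ?w = "\<lambda>S. orbit_weight d n (r + 1 - card (S \<inter> ?B))"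
  have fQ: "finite ?Q" by (rule finite_orbits) simp
  have fB: "finite ?B" "finite ?U" by (rule finite_orbits_split, simp)+
  note QBU = orbits_split[of "{1..d}" \<tau>]
  define h where "h S = (\<Prod>P\<in>?Q. ?c P) / (\<Prod>P\<in>S. ?c P) * of_nat (\<Sum>P\<in>S. card P) * ?w S" for S
  have "(\<Sum>xs\<in>spread_lists {1..d} \<tau> (Suc a). perm_weight d n (cycle_of_list xs \<circ> \<tau>)) =
      (\<Sum>xs\<in>spread_lists {1..d} \<tau> (Suc a). h (orbit \<tau> ` set xs))"
    unfolding h_def r_def by (intro sum.cong refl perm_weight_merge[OF perm _ a])
  also have "\<dots> = fact (Suc a) * (\<Sum>S\<in>subsets_of_card ?Q (Suc a). (\<Prod>P\<in>S. ?c P) * h S)"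
    by (rule sum_spread_lists[OF _ perm]) simp
  also have "(\<Sum>S\<in>subsets_of_card ?Q (Suc a). (\<Prod>P\<in>S. ?c P) * h S) =
      (\<Prod>P\<in>?Q. ?c P) * (\<Sum>S\<in>subsets_of_card ?Q (Suc a). \<Sum>P\<in>S. ?c P * ?w S)"
    unfolding sum_distrib_left
  proof (intro sum.cong refl)
    fix S assume "S \<in> subsets_of_card ?Q (Suc a)"
    then have SQ: "S \<subseteq> ?Q" by (simp add: subsets_of_card_def)
    then have "(\<Prod>P\<in>S. ?c P) \<noteq> 0"
      using card_orbit_pos[OF finite_atLeastAtMost perm] finite_subset[OF SQ fQ] by (auto simp: subset_iff)
    then show "(\<Prod>P\<in>S. ?c P) * h S = (\<Sum>P\<in>S. (\<Prod>P\<in>?Q. ?c P) * (?c P * ?w S))"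
      unfolding h_def by (simp add: sum_distrib_left[symmetric] sum_distrib_right[symmetric])
  qed
  also have "(\<Sum>S\<in>subsets_of_card ?Q (Suc a). \<Sum>P\<in>S. ?c P * ?w S) =
      (\<Sum>P\<in>?Q. \<Sum>S\<in>subsets_of_card (?Q - {P}) a. ?c P * ?w (insert P S))"
    by (rule sum_subsets_split_element[OF fQ, where F = "\<lambda>P S. ?c P * ?w S"])
  also have "\<dots> = (\<Sum>P\<in>?B. \<Sum>S\<in>subsets_of_card (?Q - {P}) a. ?c P * ?w (insert P S)) +
      (\<Sum>P\<in>?U. \<Sum>S\<in>subsets_of_card (?Q - {P}) a. ?c P * ?w (insert P S))"
    by (subst QBU(1), rule sum.union_disjoint[OF fB QBU(2)])
  also have "(\<Sum>P\<in>?B. \<Sum>S\<in>subsets_of_card (?Q - {P}) a. ?c P * ?w (insert P S)) =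
      (\<Sum>P\<in>?B. ?c P * (\<Sum>k\<le>a. of_nat ((r - 1 choose k) * (u choose (a - k))) * orbit_weight d n (r - k)))"
  proof (rule sum.cong[OF refl])
    fix P assume P: "P \<in> ?B"
    have "(\<Sum>S\<in>subsets_of_card (?Q - {P}) a. ?c P * ?w (insert P S)) =
        ?c P * (\<Sum>S\<in>subsets_of_card ((?B - {P}) \<union> ?U) a. orbit_weight d n (r - card (S \<inter> (?B - {P}))))"
      unfolding sum_distrib_left
    proof (intro sum.cong)
      show "subsets_of_card (?Q - {P}) a = subsets_of_card ((?B - {P}) \<union> ?U) a"
        using QBU P by (auto simp: subsets_of_card_def)
      fix S assume "S \<in> subsets_of_card ((?B - {P}) \<union> ?U) a"
      then have S: "S \<subseteq> (?B - {P}) \<union> ?U" by (simp add: subsets_of_card_def)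
      have "P \<notin> ?U" using QBU(2) P by auto
      then have "insert P S \<inter> ?B = insert P (S \<inter> (?B - {P}))" using P S by auto
      then have "card (insert P S \<inter> ?B) = Suc (card (S \<inter> (?B - {P})))"
        using fB by simp
      then show "?c P * ?w (insert P S) = ?c P * orbit_weight d n (r - card (S \<inter> (?B - {P})))" by simp
    qed
    also have "(\<Sum>S\<in>subsets_of_card ((?B - {P}) \<union> ?U) a. orbit_weight d n (r - card (S \<inter> (?B - {P})))) =
        (\<Sum>k\<le>a. of_nat ((card (?B - {P}) choose k) * (card ?U choose (a - k))) * orbit_weight d n (r - k))"
      by (rule sum_subsets_by_card_Int[where f = "\<lambda>k. orbit_weight d n (r - k)"]) (use fB QBU(2) in auto)
    finally show "(\<Sum>S\<in>subsets_of_card (?Q - {P}) a. ?c P * ?w (insert P S)) =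
        ?c P * (\<Sum>k\<le>a. of_nat ((r - 1 choose k) * (u choose (a - k))) * orbit_weight d n (r - k))"
      using P by (simp add: r_def u_def)
  qed
  also have "(\<Sum>P\<in>?U. \<Sum>S\<in>subsets_of_card (?Q - {P}) a. ?c P * ?w (insert P S)) =
      (\<Sum>P\<in>?U. \<Sum>k\<le>a. of_nat ((r choose k) * (u - 1 choose (a - k))) * orbit_weight d n (r + 1 - k))"
  proof (rule sum.cong[OF refl])
    fix P assume P: "P \<in> ?U"
    then have cP: "?c P = 1" by (simp add: trivial_orbits_def)
    have PB: "P \<notin> ?B" using QBU(2) P by auto
    have "(\<Sum>S\<in>subsets_of_card (?Q - {P}) a. ?c P * ?w (insert P S)) =
        (\<Sum>S\<in>subsets_of_card (?B \<union> (?U - {P})) a. orbit_weight d n (r + 1 - card (S \<inter> ?B)))"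
    proof (intro sum.cong)
      show "subsets_of_card (?Q - {P}) a = subsets_of_card (?B \<union> (?U - {P})) a"
        using QBU PB by (auto simp: subsets_of_card_def)
      fix S assume "S \<in> subsets_of_card (?B \<union> (?U - {P})) a"
      have "insert P S \<inter> ?B = S \<inter> ?B" using PB by auto
      then show "?c P * ?w (insert P S) = orbit_weight d n (r + 1 - card (S \<inter> ?B))" by (simp add: cP)
    qed
    also have "\<dots> = (\<Sum>k\<le>a. of_nat ((card ?B choose k) * (card (?U - {P}) choose (a - k))) *
        orbit_weight d n (r + 1 - k))"
      by (rule sum_subsets_by_card_Int[where f = "\<lambda>k. orbit_weight d n (r + 1 - k)"]) (use fB QBU(2) in auto)
    finally show "(\<Sum>S\<in>subsets_of_card (?Q - {P}) a. ?c P * ?w (insert P S)) =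
        (\<Sum>k\<le>a. of_nat ((r choose k) * (u - 1 choose (a - k))) * orbit_weight d n (r + 1 - k))"
      using P by (simp add: r_def u_def)
  qed
  also have "(\<Sum>P\<in>?B. ?c P * (\<Sum>k\<le>a. of_nat ((r - 1 choose k) * (u choose (a - k))) * orbit_weight d n (r - k))) =
      of_nat (d - u) * (\<Sum>k\<le>a. of_nat ((r - 1 choose k) * (u choose (a - k))) * orbit_weight d n (r - k))"
  proof -
    have "(\<Sum>P\<in>?Q. card P) = d" using sum_card_orbits[OF _ perm] by simp
    moreover have "(\<Sum>P\<in>?Q. card P) = (\<Sum>P\<in>?B. card P) + (\<Sum>P\<in>?U. card P)"
      by (subst QBU(1), rule sum.union_disjoint[OF fB QBU(2)])
    moreover have "(\<Sum>P\<in>?U. card P) = u" by (simp add: trivial_orbits_def u_def)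
    ultimately have "(\<Sum>P\<in>?B. card P) = d - u" by simp
    then show ?thesis by (simp add: sum_distrib_right[symmetric] flip: of_nat_sum)
  qed
  also have "(\<Sum>P\<in>?U. \<Sum>k\<le>a. of_nat ((r choose k) * (u - 1 choose (a - k))) * orbit_weight d n (r + 1 - k)) =
      of_nat u * (\<Sum>k\<le>a. of_nat ((r choose k) * (u - 1 choose (a - k))) * orbit_weight d n (r + 1 - k))"
    by (simp add: u_def)
  finally show ?thesis by (simp only: mult.assoc)
qed

lemma card_orbits_split:
  "finite A \<Longrightarrow> card (orbits A \<sigma>) = card (nontrivial_orbits A \<sigma>) + card (trivial_orbits A \<sigma>)"
  using orbits_split[of A \<sigma>] finite_orbits_split[of A \<sigma>] by (metis card_Un_disjoint)

lemma nontrivial_orbits_eq_empty_iff: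
  assumes "finite A" "\<sigma> permutes A"
  shows "nontrivial_orbits A \<sigma> = {} \<longleftrightarrow> \<sigma> = id"
proof
  assume e: "nontrivial_orbits A \<sigma> = {}"
  show "\<sigma> = id"
  proof
    fix x
    show "\<sigma> x = id x"
    proof (cases "x \<in> A")
      case True
      then have "card (orbit \<sigma> x) = 1" using e by (auto simp: nontrivial_orbits_def orbits_def)
      then obtain y where "orbit \<sigma> x = {y}" by (auto simp: card_1_singleton_iff)
      then have "orbit \<sigma> x = {x}" using self_in_orbit[OF assms, of x] by auto
      then show ?thesis by (simp add: orbit_eq_singleton_iff)
    next
      case False
      then show ?thesis using permutes_not_in[OF assms(2)] by simp
    qed
  qed
next
  assume "\<sigma> = id"
  then show "nontrivial_orbits A \<sigma> = {}" by (auto simp: nontrivial_orbits_def orbits_id)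
qed

lemma orbit_numbers:
  assumes "\<tau> permutes {1..d}"
  shows "perm_norm d \<tau> + card (nontrivial_orbits {1..d} \<tau>) + card (trivial_orbits {1..d} \<tau>) = d"
  using perm_norm_orbits[OF assms] card_orbits_split[of "{1..d}" \<tau>] by simp

lemma minus_one_power_diff:
  assumes "k \<le> r"
  shows "(-1 :: 'a::comm_ring_1) ^ (r - k) = (-1) ^ r * (-1) ^ k"
proof -
  obtain j where "r = k + j" using assms le_iff_add by blast
  then show ?thesis by (simp add: power_add mult_ac)
qed

text \<open>With \<open>D = d - u\<close>, the factorials of the orbit weights cancel against the binomial coefficients
  for the trivial orbits, and the two sums of \<open>sum_perm_weight\<close> become the two sides of
  \<open>alternating_factorial_sum\<close>, with opposite signs. The cancellation needs \<open>a < u\<close>: only then is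
  it possible that all \<open>a + 1\<close> joined orbits are trivial.\<close>

theorem sum_perm_weight_eq_0:
  assumes perm: "\<tau> permutes {1..d}" and "\<tau> \<noteq> id" and a: "a \<ge> 1"
    and au: "a < card (trivial_orbits {1..d} \<tau>)"
  shows "(\<Sum>xs\<in>spread_lists {1..d} \<tau> (Suc a).
    perm_weight d (perm_norm d \<tau> + a) (cycle_of_list xs \<circ> \<tau>)) = 0"
proof -
  define r where "r = card (nontrivial_orbits {1..d} \<tau>)"
  define u where "u = card (trivial_orbits {1..d} \<tau>)"
  define n where "n = perm_norm d \<tau> + a"
  define D where "D = d - u"
  have num: "perm_norm d \<tau> + r + u = d" using orbit_numbers[OF perm] by (simp add: r_def u_def)
  have r1: "r \<ge> 1"
    using nontrivial_orbits_eq_empty_iff[OF finite_atLeastAtMost perm] assms(2)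
      finite_orbits_split(1)[of "{1..d}" \<tau>] by (simp add: r_def Suc_le_eq card_gt_0_iff)
  then obtain q where q: "r = Suc q" by (cases r) auto
  have D1: "D \<ge> 1" and nr: "n + r = D + a" and dn: "d - n + a = r + u" and ua: "u \<ge> a + 1"
    using num r1 au by (auto simp: D_def n_def u_def)
  have bin: "of_nat (m choose i) * fact (m - i) = (fact m / fact i :: rat)" if "i \<le> m" for m i
    using binomial_fact[OF that, where ?'a = rat] by simp
  \<comment> \<open>For \<open>k > q\<close> the truncated difference \<open>r - k\<close> is harmless, as the binomial coefficient is \<open>0\<close>.\<close>
  have s1: "of_nat ((r - 1 choose k) * (u choose (a - k))) * orbit_weight d n (r - k) =
      fact u * (-1) ^ r * ((-1) ^ k * of_nat (q choose k) * (fact (D + (a - k) - 1) / fact (a - k)))"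
    if "k \<le> a" for k
  proof (cases "k \<le> q")
    case True
    have e: "n + (r - k) - 1 = D + (a - k) - 1" "d - n - (r - k) = u - (a - k)"
      using nr dn that True q ua by auto
    have p: "(-1 :: rat) ^ (r - k) = (-1) ^ r * (-1) ^ k"
      by (rule minus_one_power_diff) (use True q in simp)
    show ?thesis
    proof -
      have "of_nat (u choose (a - k)) * fact (u - (a - k)) = (fact u / fact (a - k) :: rat)"
        by (rule bin) (use ua in simp)
      then have "(-1) ^ q * (-1) ^ k * of_nat (q choose k) * fact (D + (a - k) - 1) *
          (of_nat (u choose (a - k)) * fact (u - (a - k))) =
          (-1) ^ q * (-1) ^ k * of_nat (q choose k) * fact (D + (a - k) - 1) *
          (fact u / fact (a - k) :: rat)" by (simp only:)
      then show ?thesis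
        unfolding orbit_weight_def e p of_nat_mult by (simp add: q mult_ac)
    qed
  next
    case False
    then show ?thesis by (simp add: q binomial_eq_0)
  qed
  have s2: "of_nat u * (of_nat ((r choose k) * (u - 1 choose (a - k))) * orbit_weight d n (r + 1 - k)) =
      - (fact u * (-1) ^ r * ((-1) ^ k * of_nat (Suc q choose k) * (fact (D + (a - k)) / fact (a - k))))"
    if "k \<le> a" for k
  proof (cases "k \<le> r")
    case True
    have e: "n + (r + 1 - k) - 1 = D + (a - k)" "d - n - (r + 1 - k) = u - 1 - (a - k)"
      using nr dn that True q ua by auto
    have p: "(-1 :: rat) ^ (r + 1 - k) = - ((-1) ^ r * (-1) ^ k)"
      using minus_one_power_diff[of k "Suc r", where ?'a = rat] True by simp
    have f: "fact u = of_nat u * (fact (u - 1) :: rat)" using ua by (simp add: fact_reduce)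
    show ?thesis
    proof -
      have "of_nat (u - 1 choose (a - k)) * fact (u - 1 - (a - k)) =
          (fact (u - 1) / fact (a - k) :: rat)"
        by (rule bin) (use ua in simp)
      then show ?thesis
        unfolding orbit_weight_def e p f of_nat_mult by (simp add: q mult_ac)
    qed
  next
    case False
    then show ?thesis by (simp add: q binomial_eq_0)
  qed
  have "(\<Sum>xs\<in>spread_lists {1..d} \<tau> (Suc a). perm_weight d n (cycle_of_list xs \<circ> \<tau>)) =
    fact (Suc a) * (\<Prod>P\<in>orbits {1..d} \<tau>. of_nat (card P)) *
     (of_nat D * (\<Sum>k\<le>a. of_nat ((r - 1 choose k) * (u choose (a - k))) * orbit_weight d n (r - k)) +
      of_nat u * (\<Sum>k\<le>a. of_nat ((r choose k) * (u - 1 choose (a - k))) * orbit_weight d n (r + 1 - k)))"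
    unfolding D_def u_def r_def by (rule sum_perm_weight[OF perm a])
  also have "of_nat u * (\<Sum>k\<le>a. of_nat ((r choose k) * (u - 1 choose (a - k))) * orbit_weight d n (r + 1 - k)) =
      - (fact u * (-1) ^ r * (\<Sum>k\<le>a. (-1) ^ k * of_nat (Suc q choose k) * (fact (D + (a - k)) / fact (a - k))))"
    unfolding sum_distrib_left sum_negf[symmetric] by (rule sum.cong[OF refl]) (rule s2, simp)
  also have "\<dots> = - (of_nat D * (fact u * (-1) ^ r *
      (\<Sum>k\<le>a. (-1) ^ k * of_nat (q choose k) * (fact (D + (a - k) - 1) / fact (a - k)))))"
    unfolding alternating_factorial_sum[OF D1] by (simp only: mult_ac)
  also have "fact u * (-1) ^ r *
      (\<Sum>k\<le>a. (-1) ^ k * of_nat (q choose k) * (fact (D + (a - k) - 1) / fact (a - k))) =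
      (\<Sum>k\<le>a. of_nat ((r - 1 choose k) * (u choose (a - k))) * orbit_weight d n (r - k))"
    unfolding sum_distrib_left by (rule sum.cong[OF refl]) (rule s1[symmetric], simp)
  finally show ?thesis unfolding n_def[symmetric] by (simp only: add.right_inverse mult_zero_right)
qed

text \<open>Here \<open>a = u = 1\<close>. Two trivial orbits cannot be joined, so one term of the identity is missing,
  and the remaining ones add up to \<open>(-1)\<^sup>r d!\<close> times positive factors.\<close>

theorem sum_perm_weight_neq_0:
  assumes perm: "\<tau> permutes {1..d}" and "\<tau> \<noteq> id"
    and u: "card (trivial_orbits {1..d} \<tau>) = 1"
  shows "(\<Sum>xs\<in>spread_lists {1..d} \<tau> 2.
    perm_weight d (perm_norm d \<tau> + 1) (cycle_of_list xs \<circ> \<tau>)) \<noteq> 0"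
proof -
  define r where "r = card (nontrivial_orbits {1..d} \<tau>)"
  define n where "n = perm_norm d \<tau> + 1"
  have num: "n + r = d" using orbit_numbers[OF perm] u by (simp add: r_def n_def)
  have r1: "r \<ge> 1"
    using nontrivial_orbits_eq_empty_iff[OF finite_atLeastAtMost perm] assms(2)
      finite_orbits_split(1)[of "{1..d}" \<tau>] by (simp add: r_def Suc_le_eq card_gt_0_iff)
  then obtain q where q: "r = Suc q" by (cases r) auto
  obtain e where d: "d = Suc (Suc e)" "e + 1 = n + q"
    using num r1 q by (cases d; cases "d - 1") (auto simp: n_def)
  have "n + q - 1 = e" using d(2) by simp
  then have ow: "orbit_weight d n r = (-1) ^ r * fact (Suc e)"
    "orbit_weight d n q = - ((-1) ^ r * fact e)"
    using num d q by (auto simp: orbit_weight_def)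
  have "(\<Sum>xs\<in>spread_lists {1..d} \<tau> 2. perm_weight d n (cycle_of_list xs \<circ> \<tau>)) =
     2 * (\<Prod>P\<in>orbits {1..d} \<tau>. of_nat (card P)) *
     (of_nat (d - 1) * (orbit_weight d n r + of_nat q * orbit_weight d n q) + of_nat r * orbit_weight d n r)"
    using sum_perm_weight[OF perm, of 1 n, unfolded u, folded r_def]
    by (simp add: numeral_2_eq_2 q)
  also have "of_nat (d - 1) * (orbit_weight d n r + of_nat q * orbit_weight d n q) +
      of_nat r * orbit_weight d n r = (-1) ^ r * fact d"
    unfolding ow by (simp add: d q algebra_simps)
  finally have eq: "(\<Sum>xs\<in>spread_lists {1..d} \<tau> 2. perm_weight d n (cycle_of_list xs \<circ> \<tau>)) =
     2 * (\<Prod>P\<in>orbits {1..d} \<tau>. of_nat (card P)) * ((-1) ^ r * fact d)" .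
  have "(\<Prod>P\<in>orbits {1..d} \<tau>. of_nat (card P) :: rat) \<noteq> 0"
    using card_orbit_pos[OF finite_atLeastAtMost perm] finite_orbits[of "{1..d}" \<tau>] by auto
  then show ?thesis unfolding n_def[symmetric] eq by simp
qed

section \<open>The graded group algebra and its invariants\<close>

abbreviation perms :: "nat \<Rightarrow> (nat \<Rightarrow> nat) set" where
  "perms d \<equiv> {\<sigma>. \<sigma> permutes {1..d}}"

lemma carrier_sym_group: "carrier (sym_group d) = perms d"
  by (simp add: sym_group_def)

lemma finite_perms: "finite (perms d)"
  by (simp add: finite_permutations)

lemma hilb_carrier_iff:
  "f \<in> carrier (hilb_algebra d) \<longleftrightarrow>
    (\<forall>\<sigma>. \<not> \<sigma> permutes {1..d} \<longrightarrow> f \<sigma> = 0) \<and>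
    (\<forall>\<pi> \<sigma>. \<pi> permutes {1..d} \<longrightarrow> f (inv' \<pi> \<circ> \<sigma> \<circ> \<pi>) = f \<sigma>)"
  by (auto simp: hilb_algebra_def grad_group_algebra_def carrier_sym_group conj_act_def fun_eq_iff)

lemma hilb_algebra_simps:
  "mult (hilb_algebra d) = grad_mult d"
  "one (hilb_algebra d) = perm_basis id"
  "zero (hilb_algebra d) = (\<lambda>_. 0)"
  "add (hilb_algebra d) = (\<lambda>f g \<sigma>. f \<sigma> + g \<sigma>)"
  "smult (hilb_algebra d) = (\<lambda>c f \<sigma>. c * f \<sigma>)"
  by (simp_all add: hilb_algebra_def grad_group_algebra_def)

lemma hilb_support: "f \<in> carrier (hilb_algebra d) \<Longrightarrow> \<not> \<sigma> permutes {1..d} \<Longrightarrow> f \<sigma> = 0"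
  by (simp add: hilb_carrier_iff)

lemma hilb_conj:
  assumes "f \<in> carrier (hilb_algebra d)" "\<pi> permutes {1..d}"
  shows "f (\<pi> \<circ> \<sigma> \<circ> inv' \<pi>) = f \<sigma>"
proof -
  have "f (inv' (inv' \<pi>) \<circ> \<sigma> \<circ> inv' \<pi>) = f \<sigma>"
    using assms permutes_inv[OF assms(2)] unfolding hilb_carrier_iff by blast
  then show ?thesis by (simp only: permutes_inv_inv[OF assms(2)])
qed

text \<open>Invariance needs to be checked on elements of the symmetric group only, because both sides
  vanish elsewhere.\<close>

lemma hilb_carrierI:
  assumes "\<And>\<sigma>. \<not> \<sigma> permutes {1..d} \<Longrightarrow> f \<sigma> = 0"
    and "\<And>\<pi> \<sigma>. \<pi> permutes {1..d} \<Longrightarrow> \<sigma> permutes {1..d} \<Longrightarrow> f (\<pi> \<circ> \<sigma> \<circ> inv' \<pi>) = f \<sigma>"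
  shows "f \<in> carrier (hilb_algebra d)"
  unfolding hilb_carrier_iff
proof (intro conjI allI impI assms(1))
  fix \<pi> \<sigma> :: "nat \<Rightarrow> nat" assume p: "\<pi> permutes {1..d}"
  define \<tau> where "\<tau> = inv' \<pi> \<circ> \<sigma> \<circ> \<pi>"
  have e: "\<pi> \<circ> \<tau> \<circ> inv' \<pi> = \<sigma>"
    using permutes_inverses(1)[OF p] by (simp add: \<tau>_def fun_eq_iff)
  show "f (inv' \<pi> \<circ> \<sigma> \<circ> \<pi>) = f \<sigma>"
  proof (cases "\<sigma> permutes {1..d}")
    case True
    then have "\<tau> permutes {1..d}" unfolding \<tau>_def by (intro permutes_compose permutes_inv p)
    then have "f (\<pi> \<circ> \<tau> \<circ> inv' \<pi>) = f \<tau>" by (rule assms(2)[OF p])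
    then show ?thesis unfolding e unfolding \<tau>_def by (rule sym)
  next
    case False
    have "\<not> \<tau> permutes {1..d}"
    proof
      assume "\<tau> permutes {1..d}"
      then have "\<pi> \<circ> \<tau> \<circ> inv' \<pi> permutes {1..d}" by (intro permutes_compose permutes_inv p)
      then show False using False unfolding e by blast
    qed
    then show ?thesis using assms(1)[of \<sigma>] assms(1)[of \<tau>] False unfolding \<tau>_def by simp
  qed
qed

lemma conjugate_permutes:
  "\<pi> permutes A \<Longrightarrow> \<sigma> permutes A \<Longrightarrow> \<pi> \<circ> \<sigma> \<circ> inv' \<pi> permutes A"
  by (intro permutes_compose permutes_inv)

lemma bij_betw_conjugate:
  assumes "\<pi> permutes A"
  shows "bij_betw (\<lambda>\<sigma>. \<pi> \<circ> \<sigma> \<circ> inv' \<pi>) {\<sigma>. \<sigma> permutes A} {\<sigma>. \<sigma> permutes A}"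
proof (rule bij_betw_byWitness[where f' = "\<lambda>\<sigma>. inv' \<pi> \<circ> \<sigma> \<circ> \<pi>"])
  show "\<forall>\<sigma>\<in>{\<sigma>. \<sigma> permutes A}. inv' \<pi> \<circ> (\<pi> \<circ> \<sigma> \<circ> inv' \<pi>) \<circ> \<pi> = \<sigma>"
    using permutes_inverses(2)[OF assms] by (simp add: fun_eq_iff)
  show "\<forall>\<sigma>\<in>{\<sigma>. \<sigma> permutes A}. \<pi> \<circ> (inv' \<pi> \<circ> \<sigma> \<circ> \<pi>) \<circ> inv' \<pi> = \<sigma>"
    using permutes_inverses(1)[OF assms] by (simp add: fun_eq_iff)
  show "(\<lambda>\<sigma>. \<pi> \<circ> \<sigma> \<circ> inv' \<pi>) ` {\<sigma>. \<sigma> permutes A} \<subseteq> {\<sigma>. \<sigma> permutes A}"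
    using conjugate_permutes[OF assms] by blast
  show "(\<lambda>\<sigma>. inv' \<pi> \<circ> \<sigma> \<circ> \<pi>) ` {\<sigma>. \<sigma> permutes A} \<subseteq> {\<sigma>. \<sigma> permutes A}"
    using permutes_compose[OF permutes_compose[OF assms] permutes_inv[OF assms]]
    by (auto simp: comp_assoc)
qed

text \<open>The condition under which \<open>[\<sigma>] [\<tau>]\<close> is nonzero: \<open>\<sigma>\<close> lies on a shortest path from \<open>id\<close> to \<open>\<sigma> \<circ> \<tau>\<close> in
  the Cayley graph of the transpositions.\<close>

definition geodesic :: "nat \<Rightarrow> (nat \<Rightarrow> nat) \<Rightarrow> (nat \<Rightarrow> nat) \<Rightarrow> bool" where
  "geodesic d \<sigma> \<tau> \<longleftrightarrow> perm_norm d (\<sigma> \<circ> \<tau>) = perm_norm d \<sigma> + perm_norm d \<tau>"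

lemma grad_mult_eq:
  "grad_mult d f g \<rho> = (\<Sum>\<sigma>\<in>perms d. \<Sum>\<tau>\<in>perms d.
    if geodesic d \<sigma> \<tau> \<and> \<sigma> \<circ> \<tau> = \<rho> then f \<sigma> * g \<tau> else 0)"
proof -
  have "grad_mult d f g \<rho> = (\<Sum>(\<sigma>, \<tau>)\<in>perms d \<times> perms d.
      if geodesic d \<sigma> \<tau> \<and> \<sigma> \<circ> \<tau> = \<rho> then f \<sigma> * g \<tau> else 0)"
    unfolding grad_mult_def carrier_sym_group geodesic_def
    by (rule sum.mono_neutral_cong_left)
      (use finite_perms[of d] in \<open>auto split: if_splits\<close>)
  then show ?thesis by (simp add: sum.cartesian_product)
qed

text \<open>Testing a product against an arbitrary function \<open>W\<close> removes the constraint \<open>\<sigma> \<circ> \<tau> = \<rho>\<close>; it is the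
  form in which associativity is transparent.\<close>

lemma grad_mult_pairing:
  "(\<Sum>\<rho>\<in>perms d. grad_mult d f g \<rho> * W \<rho>) =
    (\<Sum>\<sigma>\<in>perms d. \<Sum>\<tau>\<in>perms d. if geodesic d \<sigma> \<tau> then f \<sigma> * g \<tau> * W (\<sigma> \<circ> \<tau>) else 0)"
proof -
  have "(\<Sum>\<rho>\<in>perms d. grad_mult d f g \<rho> * W \<rho>) = (\<Sum>\<sigma>\<in>perms d. \<Sum>\<tau>\<in>perms d. \<Sum>\<rho>\<in>perms d.
      if geodesic d \<sigma> \<tau> \<and> \<sigma> \<circ> \<tau> = \<rho> then f \<sigma> * g \<tau> * W \<rho> else 0)"
    unfolding grad_mult_eq sum_distrib_right
    by (subst sum.swap, rule sum.cong[OF refl], subst sum.swap) (intro sum.cong refl, simp)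
  also have "\<dots> = (\<Sum>\<sigma>\<in>perms d. \<Sum>\<tau>\<in>perms d. if geodesic d \<sigma> \<tau> then f \<sigma> * g \<tau> * W (\<sigma> \<circ> \<tau>) else 0)"
  proof (intro sum.cong refl)
    fix \<sigma> \<tau> assume "\<sigma> \<in> perms d" "\<tau> \<in> perms d"
    then have "\<sigma> \<circ> \<tau> \<in> perms d" by (simp add: permutes_compose)
    moreover have "(\<Sum>\<rho>\<in>perms d. if geodesic d \<sigma> \<tau> \<and> \<sigma> \<circ> \<tau> = \<rho> then f \<sigma> * g \<tau> * W \<rho> else 0) =
        (\<Sum>\<rho>\<in>perms d. if \<sigma> \<circ> \<tau> = \<rho> then (if geodesic d \<sigma> \<tau> then f \<sigma> * g \<tau> * W \<rho> else 0) else 0)"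
      by (intro sum.cong refl) simp
    ultimately show "(\<Sum>\<rho>\<in>perms d. if geodesic d \<sigma> \<tau> \<and> \<sigma> \<circ> \<tau> = \<rho> then f \<sigma> * g \<tau> * W \<rho> else 0) =
        (if geodesic d \<sigma> \<tau> then f \<sigma> * g \<tau> * W (\<sigma> \<circ> \<tau>) else 0)"
      using finite_perms by (simp only: sum.delta' if_True)
  qed
  finally show ?thesis .
qed

text \<open>Both sides say that the norm of \<open>\<sigma> \<circ> \<tau> \<circ> \<upsilon>\<close> is the sum of the three norms, since the norm is
  subadditive.\<close>

lemma geodesic_assoc:
  assumes "\<sigma> permutes {1..d}" "\<tau> permutes {1..d}" "\<upsilon> permutes {1..d}"
  shows "geodesic d \<sigma> \<tau> \<and> geodesic d (\<sigma> \<circ> \<tau>) \<upsilon> \<longleftrightarrow> geodesic d \<tau> \<upsilon> \<and> geodesic d \<sigma> (\<tau> \<circ> \<upsilon>)"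
  using perm_norm_comp_le[OF assms(1,2)] perm_norm_comp_le[OF assms(2,3)]
    perm_norm_comp_le[OF permutes_compose[OF assms(2,1)] assms(3)]
    perm_norm_comp_le[OF assms(1) permutes_compose[OF assms(3,2)]]
  unfolding geodesic_def comp_assoc by linarith

lemma grad_mult_assoc:
  "grad_mult d f (grad_mult d g h) = grad_mult d (grad_mult d f g) h"
proof
  fix \<rho>
  let ?S = "perms d"
  have "grad_mult d f (grad_mult d g h) \<rho> = (\<Sum>\<sigma>\<in>?S. \<Sum>\<alpha>\<in>?S. grad_mult d g h \<alpha> *
      (if geodesic d \<sigma> \<alpha> \<and> \<sigma> \<circ> \<alpha> = \<rho> then f \<sigma> else 0))"
    unfolding grad_mult_eq[of d f] by (intro sum.cong refl) simp
  also have "\<dots> = (\<Sum>\<sigma>\<in>?S. \<Sum>\<tau>\<in>?S. \<Sum>\<upsilon>\<in>?S. if geodesic d \<tau> \<upsilon> then g \<tau> * h \<upsilon> *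
      (if geodesic d \<sigma> (\<tau> \<circ> \<upsilon>) \<and> \<sigma> \<circ> (\<tau> \<circ> \<upsilon>) = \<rho> then f \<sigma> else 0) else 0)"
    unfolding grad_mult_pairing[where W = "\<lambda>\<alpha>. if geodesic d _ \<alpha> \<and> _ \<circ> \<alpha> = \<rho> then f _ else 0"] ..
  also have "\<dots> = (\<Sum>\<sigma>\<in>?S. \<Sum>\<tau>\<in>?S. \<Sum>\<upsilon>\<in>?S. if geodesic d \<sigma> \<tau> then f \<sigma> * g \<tau> *
      (if geodesic d (\<sigma> \<circ> \<tau>) \<upsilon> \<and> (\<sigma> \<circ> \<tau>) \<circ> \<upsilon> = \<rho> then h \<upsilon> else 0) else 0)"
  proof (intro sum.cong refl)
    fix \<sigma> \<tau> \<upsilon> assume "\<sigma> \<in> ?S" "\<tau> \<in> ?S" "\<upsilon> \<in> ?S"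
    then have "geodesic d \<sigma> \<tau> \<and> geodesic d (\<sigma> \<circ> \<tau>) \<upsilon> \<longleftrightarrow> geodesic d \<tau> \<upsilon> \<and> geodesic d \<sigma> (\<tau> \<circ> \<upsilon>)"
      by (intro geodesic_assoc) simp_all
    then show "(if geodesic d \<tau> \<upsilon> then g \<tau> * h \<upsilon> *
      (if geodesic d \<sigma> (\<tau> \<circ> \<upsilon>) \<and> \<sigma> \<circ> (\<tau> \<circ> \<upsilon>) = \<rho> then f \<sigma> else 0) else 0) =
      (if geodesic d \<sigma> \<tau> then f \<sigma> * g \<tau> *
      (if geodesic d (\<sigma> \<circ> \<tau>) \<upsilon> \<and> (\<sigma> \<circ> \<tau>) \<circ> \<upsilon> = \<rho> then h \<upsilon> else 0) else 0)"
      unfolding comp_assoc by (cases "\<sigma> \<circ> (\<tau> \<circ> \<upsilon>) = \<rho>") (auto simp only: if_True if_False simp_thms mult_ac mult_zero_right split: if_splits)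
  qed
  also have "\<dots> = (\<Sum>\<upsilon>\<in>?S. \<Sum>\<sigma>\<in>?S. \<Sum>\<tau>\<in>?S. if geodesic d \<sigma> \<tau> then f \<sigma> * g \<tau> *
      (if geodesic d (\<sigma> \<circ> \<tau>) \<upsilon> \<and> (\<sigma> \<circ> \<tau>) \<circ> \<upsilon> = \<rho> then h \<upsilon> else 0) else 0)"
    by (subst (2) sum.swap, subst sum.swap, rule refl)
  also have "\<dots> = (\<Sum>\<upsilon>\<in>?S. \<Sum>\<alpha>\<in>?S. grad_mult d f g \<alpha> *
      (if geodesic d \<alpha> \<upsilon> \<and> \<alpha> \<circ> \<upsilon> = \<rho> then h \<upsilon> else 0))"
    unfolding grad_mult_pairing[where W = "\<lambda>\<alpha>. if geodesic d \<alpha> _ \<and> \<alpha> \<circ> _ = \<rho> then h _ else 0"] ..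
  also have "\<dots> = grad_mult d (grad_mult d f g) h \<rho>"
    unfolding grad_mult_eq[of d _ h] by (subst sum.swap) (intro sum.cong refl, simp)
  finally show "grad_mult d f (grad_mult d g h) \<rho> = grad_mult d (grad_mult d f g) h \<rho>" .
qed

lemma grad_mult_add_left:
  "grad_mult d (\<lambda>\<sigma>. f \<sigma> + f' \<sigma>) g = (\<lambda>\<rho>. grad_mult d f g \<rho> + grad_mult d f' g \<rho>)"
  unfolding grad_mult_eq sum.distrib[symmetric] by (intro ext sum.cong refl) (simp add: algebra_simps)

lemma grad_mult_add_right:
  "grad_mult d f (\<lambda>\<sigma>. g \<sigma> + g' \<sigma>) = (\<lambda>\<rho>. grad_mult d f g \<rho> + grad_mult d f g' \<rho>)"
  unfolding grad_mult_eq sum.distrib[symmetric] by (intro ext sum.cong refl) (simp add: algebra_simps)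

lemma grad_mult_scale_left:
  "grad_mult d (\<lambda>\<sigma>. c * f \<sigma>) g = (\<lambda>\<rho>. c * grad_mult d f g \<rho>)"
  unfolding grad_mult_eq sum_distrib_left by (intro ext sum.cong refl) simp

lemma grad_mult_scale_right:
  "grad_mult d f (\<lambda>\<sigma>. c * g \<sigma>) = (\<lambda>\<rho>. c * grad_mult d f g \<rho>)"
  unfolding grad_mult_eq sum_distrib_left by (intro ext sum.cong refl) simp

lemma hilb_one_left:
  assumes "f \<in> carrier (hilb_algebra d)"
  shows "grad_mult d (perm_basis id) f = f"
proof
  fix \<rho>
  have "grad_mult d (perm_basis id) f \<rho> = (\<Sum>\<sigma>\<in>perms d. if \<sigma> = id then
      (\<Sum>\<tau>\<in>perms d. if \<tau> = \<rho> then f \<tau> else 0) else 0)"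
    unfolding grad_mult_eq
    by (intro sum.cong refl)
      (auto simp: perm_basis_def geodesic_def intro!: sum.cong sum.neutral)
  then show "grad_mult d (perm_basis id) f \<rho> = f \<rho>"
    using hilb_support[OF assms, of \<rho>] finite_perms by (simp add: sum.delta permutes_id)
qed

lemma hilb_one_right:
  assumes "f \<in> carrier (hilb_algebra d)"
  shows "grad_mult d f (perm_basis id) = f"
proof
  fix \<rho>
  have "grad_mult d f (perm_basis id) \<rho> = (\<Sum>\<tau>\<in>perms d. if \<tau> = id then
      (\<Sum>\<sigma>\<in>perms d. if \<sigma> = \<rho> then f \<sigma> else 0) else 0)"
    unfolding grad_mult_eq
    by (subst sum.swap, intro sum.cong refl)
      (auto simp: perm_basis_def geodesic_def intro!: sum.cong sum.neutral)
  then show "grad_mult d f (perm_basis id) \<rho> = f \<rho>"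
    using hilb_support[OF assms, of \<rho>] finite_perms by (simp add: sum.delta permutes_id)
qed

lemma grad_mult_id: "grad_mult d f g id = f id * g id"
proof -
  have "grad_mult d f g id = (\<Sum>\<sigma>\<in>perms d. if \<sigma> = id then
      (\<Sum>\<tau>\<in>perms d. if \<tau> = id then f id * g id else 0) else 0)"
    unfolding grad_mult_eq
  proof (intro sum.cong refl)
    fix \<sigma> assume s: "\<sigma> \<in> perms d"
    have "geodesic d \<sigma> \<tau> \<and> \<sigma> \<circ> \<tau> = id \<longleftrightarrow> \<sigma> = id \<and> \<tau> = id" if "\<tau> \<in> perms d" for \<tau>
      using s that perm_norm_eq_0_iff[of \<sigma> d] perm_norm_eq_0_iff[of \<tau> d]
      by (auto simp: geodesic_def)
    then show "(\<Sum>\<tau>\<in>perms d. if geodesic d \<sigma> \<tau> \<and> \<sigma> \<circ> \<tau> = id then f \<sigma> * g \<tau> else 0) =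
        (if \<sigma> = id then \<Sum>\<tau>\<in>perms d. if \<tau> = id then f id * g id else 0 else 0)"
      by (auto intro!: sum.cong sum.neutral)
  qed
  then show ?thesis using finite_perms by (simp add: sum.delta permutes_id)
qed

lemma perm_basis_id_carrier: "perm_basis id \<in> carrier (hilb_algebra d)"
proof (rule hilb_carrierI)
  fix \<sigma> :: "nat \<Rightarrow> nat" assume "\<not> \<sigma> permutes {1..d}"
  then show "perm_basis id \<sigma> = 0" by (auto simp: perm_basis_def permutes_id)
next
  fix \<pi> \<sigma> :: "nat \<Rightarrow> nat" assume p: "\<pi> permutes {1..d}"
  have "\<pi> \<circ> \<sigma> \<circ> inv' \<pi> = id \<longleftrightarrow> \<sigma> = id"
  proof
    assume *: "\<pi> \<circ> \<sigma> \<circ> inv' \<pi> = id"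
    show "\<sigma> = id"
    proof
      fix x
      have "\<pi> (\<sigma> (inv' \<pi> (\<pi> x))) = \<pi> x" using * by (simp add: fun_eq_iff)
      then have "\<pi> (\<sigma> x) = \<pi> x" by (simp only: permutes_inverses(2)[OF p])
      then show "\<sigma> x = id x" using permutes_inj[OF p] by (simp add: inj_eq)
    qed
  next
    assume "\<sigma> = id"
    then show "\<pi> \<circ> \<sigma> \<circ> inv' \<pi> = id" using permutes_inv_o(1)[OF p] by simp
  qed
  then show "perm_basis id (\<pi> \<circ> \<sigma> \<circ> inv' \<pi>) = perm_basis id \<sigma>" by (simp add: perm_basis_def)
qed

lemma grad_mult_support:
  assumes "\<not> \<rho> permutes {1..d}"
  shows "grad_mult d f g \<rho> = 0"
  unfolding grad_mult_eq using assms
  by (intro sum.neutral ballI) (auto simp: permutes_compose)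

lemma geodesic_conjugate:
  assumes "\<pi> permutes {1..d}" "\<sigma> permutes {1..d}" "\<tau> permutes {1..d}"
  shows "geodesic d (\<pi> \<circ> \<sigma> \<circ> inv' \<pi>) (\<pi> \<circ> \<tau> \<circ> inv' \<pi>) \<longleftrightarrow> geodesic d \<sigma> \<tau>"
proof -
  have "(\<pi> \<circ> \<sigma> \<circ> inv' \<pi>) \<circ> (\<pi> \<circ> \<tau> \<circ> inv' \<pi>) = \<pi> \<circ> (\<sigma> \<circ> \<tau>) \<circ> inv' \<pi>"
    using permutes_inverses(2)[OF assms(1)] by (simp add: fun_eq_iff)
  then show ?thesis
    unfolding geodesic_def
    by (simp only: perm_norm_conjugate[OF assms(1,2)] perm_norm_conjugate[OF assms(1,3)]
      perm_norm_conjugate[OF assms(1) permutes_compose[OF assms(3,2)]])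
qed

lemma grad_mult_closed:
  assumes f: "f \<in> carrier (hilb_algebra d)" and g: "g \<in> carrier (hilb_algebra d)"
  shows "grad_mult d f g \<in> carrier (hilb_algebra d)"
proof (rule hilb_carrierI[OF grad_mult_support])
  fix \<pi> \<rho> :: "nat \<Rightarrow> nat" assume p: "\<pi> permutes {1..d}" and r: "\<rho> permutes {1..d}"
  define c where "c \<sigma> = \<pi> \<circ> \<sigma> \<circ> inv' \<pi>" for \<sigma> :: "nat \<Rightarrow> nat"
  have bij: "bij_betw c (perms d) (perms d)" unfolding c_def by (rule bij_betw_conjugate[OF p])
  have inj: "c \<sigma> = c \<tau> \<longleftrightarrow> \<sigma> = \<tau>" if "\<sigma> permutes {1..d}" "\<tau> permutes {1..d}" for \<sigma> \<tau>
    using bij that by (auto simp: bij_betw_def inj_on_def)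
  have comp: "c \<sigma> \<circ> c \<tau> = c (\<sigma> \<circ> \<tau>)" for \<sigma> \<tau>
    using permutes_inverses(2)[OF p] by (simp add: c_def fun_eq_iff)
  have re: "(\<Sum>\<sigma>\<in>perms d. F (c \<sigma>)) = (\<Sum>\<sigma>\<in>perms d. F \<sigma>)" for F :: "_ \<Rightarrow> rat"
    by (rule sum.reindex_bij_betw[OF bij])
  define F where "F \<sigma> \<tau> = (if geodesic d \<sigma> \<tau> \<and> \<sigma> \<circ> \<tau> = c \<rho> then f \<sigma> * g \<tau> else 0)" for \<sigma> \<tau>
  have "grad_mult d f g (c \<rho>) = (\<Sum>\<sigma>\<in>perms d. \<Sum>\<tau>\<in>perms d. F \<sigma> \<tau>)"
    unfolding grad_mult_eq F_def ..
  also have "\<dots> = (\<Sum>\<sigma>\<in>perms d. \<Sum>\<tau>\<in>perms d. F (c \<sigma>) (c \<tau>))"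
    by (simp only: re re[where F = "\<lambda>\<sigma>. \<Sum>\<tau>\<in>perms d. F \<sigma> \<tau>"])
  also have "\<dots> = grad_mult d f g \<rho>"
    unfolding grad_mult_eq F_def comp
  proof (intro sum.cong refl)
    fix \<sigma> \<tau> assume st: "\<sigma> \<in> perms d" "\<tau> \<in> perms d"
    then have "geodesic d (c \<sigma>) (c \<tau>) = geodesic d \<sigma> \<tau>"
      unfolding c_def by (intro geodesic_conjugate p) simp_all
    moreover have "c (\<sigma> \<circ> \<tau>) = c \<rho> \<longleftrightarrow> \<sigma> \<circ> \<tau> = \<rho>"
      by (rule inj) (use st r in \<open>simp_all add: permutes_compose\<close>)
    moreover have "f (c \<sigma>) = f \<sigma>" "g (c \<tau>) = g \<tau>"
      unfolding c_def by (rule hilb_conj[OF f p], rule hilb_conj[OF g p])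
    ultimately show "(if geodesic d (c \<sigma>) (c \<tau>) \<and> c (\<sigma> \<circ> \<tau>) = c \<rho> then f (c \<sigma>) * g (c \<tau>) else 0) =
        (if geodesic d \<sigma> \<tau> \<and> \<sigma> \<circ> \<tau> = \<rho> then f \<sigma> * g \<tau> else 0)" by (simp only:)
  qed
  finally show "grad_mult d f g (\<pi> \<circ> \<rho> \<circ> inv' \<pi>) = grad_mult d f g \<rho>" unfolding c_def .
qed

lemma hilb_add_closed:
  "f \<in> carrier (hilb_algebra d) \<Longrightarrow> g \<in> carrier (hilb_algebra d) \<Longrightarrow>
    (\<lambda>\<sigma>. f \<sigma> + g \<sigma>) \<in> carrier (hilb_algebra d)"
  by (simp add: hilb_carrier_iff)

lemma hilb_scale_closed:
  "f \<in> carrier (hilb_algebra d) \<Longrightarrow> (\<lambda>\<sigma>. c * f \<sigma>) \<in> carrier (hilb_algebra d)"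
  by (simp add: hilb_carrier_iff)

lemma hilb_zero_closed: "(\<lambda>_. 0) \<in> carrier (hilb_algebra d)"
  by (simp add: hilb_carrier_iff)

section \<open>Multiplication by sums of cycles\<close>

text \<open>Lists with entries in distinct orbits of \<open>id\<close> are lists with distinct entries.\<close>

definition cycle_sum :: "nat \<Rightarrow> nat \<Rightarrow> (nat \<Rightarrow> nat) \<Rightarrow> rat" where
  "cycle_sum d a = (\<lambda>\<rho>. \<Sum>xs\<in>spread_lists {1..d} id (Suc a). perm_basis (cycle_of_list xs) \<rho>)"

text \<open>Every invariant is a linear combination of these sums. As the sum runs over all conjugating
  permutations and not over the conjugacy class, no centralizer has to be counted.\<close>

definition conj_sum :: "nat \<Rightarrow> (nat \<Rightarrow> nat) \<Rightarrow> (nat \<Rightarrow> nat) \<Rightarrow> rat" where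
  "conj_sum d \<sigma> = (\<lambda>\<rho>. \<Sum>\<pi>\<in>perms d. perm_basis (\<pi> \<circ> \<sigma> \<circ> inv' \<pi>) \<rho>)"

lemma spread_lists_id:
  "xs \<in> spread_lists A id m \<longleftrightarrow> length xs = m \<and> set xs \<subseteq> A \<and> distinct xs"
  by (auto simp: spread_lists_def distinct_map inj_on_def)

lemma spread_lists_subset: "spread_lists A \<tau> m \<subseteq> spread_lists A id m"
  by (auto simp: spread_lists_id) (auto simp: spread_lists_def distinct_map)

lemma spread_lists_cycle_permutes:
  assumes "xs \<in> spread_lists {1..d::nat} \<tau> m" "\<sigma> permutes {1..d}"
  shows "cycle_of_list xs \<circ> \<sigma> permutes {1..d}"
  using assms by (intro cycle_comp_permutes finite_atLeastAtMost) (auto simp: spread_lists_def)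

lemma geodesic_cycle_iff:
  assumes "xs \<in> spread_lists {1..d} id (Suc a)" and "\<tau> permutes {1..d}"
  shows "geodesic d (cycle_of_list xs) \<tau> \<longleftrightarrow> xs \<in> spread_lists {1..d} \<tau> (Suc a)"
proof -
  have xs: "length xs = Suc a" "set xs \<subseteq> {1..d}" "distinct xs"
    using assms(1) by (auto simp only: spread_lists_id)
  have ne: "xs \<noteq> []" using xs by auto
  have "geodesic d (cycle_of_list xs) \<tau> \<longleftrightarrow> distinct (map (orbit \<tau>) xs)"
    unfolding perm_norm_cycle_comp[OF assms(2) xs(2) ne, symmetric] geodesic_def
      perm_norm_cycle[OF xs(3,2) ne] by (simp add: add.commute)
  then show ?thesis using xs by (simp add: spread_lists_def)
qed

lemma perm_norm_spread:
  assumes "xs \<in> spread_lists {1..d} \<tau> (Suc a)" and "\<tau> permutes {1..d}"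
  shows "perm_norm d (cycle_of_list xs \<circ> \<tau>) = perm_norm d \<tau> + a"
proof -
  have xs: "length xs = Suc a" "set xs \<subseteq> {1..d}" "distinct (map (orbit \<tau>) xs)"
    using assms(1) by (auto simp only: spread_lists_def)
  then show ?thesis using perm_norm_cycle_comp[OF assms(2) xs(2)] by (cases xs) auto
qed

lemma spread_list_cycle_permutes: "xs \<in> spread_lists {1..d::nat} \<tau> m \<Longrightarrow> cycle_of_list xs permutes {1..d}"
  using spread_lists_cycle_permutes[of xs d \<tau> m id] by (simp add: permutes_id)

text \<open>Only the lists that meet distinct orbits of \<open>\<tau>\<close> survive in the graded product.\<close>

lemma cycle_sum_mult:
  "grad_mult d (cycle_sum d a) g \<rho> =
    (\<Sum>\<tau>\<in>perms d. g \<tau> * (\<Sum>xs\<in>spread_lists {1..d} \<tau> (Suc a). perm_basis (cycle_of_list xs \<circ> \<tau>) \<rho>))"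
proof -
  let ?L = "spread_lists {1..d} id (Suc a)"
  have fin: "finite ?L" by (rule finite_spread_lists) simp
  have "grad_mult d (cycle_sum d a) g \<rho> = (\<Sum>\<tau>\<in>perms d. \<Sum>\<sigma>\<in>perms d. \<Sum>xs\<in>?L.
      if cycle_of_list xs = \<sigma> then (if geodesic d \<sigma> \<tau> \<and> \<sigma> \<circ> \<tau> = \<rho> then g \<tau> else 0) else 0)"
    unfolding grad_mult_eq
    by (subst sum.swap, intro sum.cong refl)
      (auto simp: cycle_sum_def perm_basis_def sum_distrib_right intro!: sum.cong sum.neutral)
  also have "\<dots> = (\<Sum>\<tau>\<in>perms d. \<Sum>xs\<in>?L. \<Sum>\<sigma>\<in>perms d.
      if cycle_of_list xs = \<sigma> then (if geodesic d \<sigma> \<tau> \<and> \<sigma> \<circ> \<tau> = \<rho> then g \<tau> else 0) else 0)"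
    by (intro sum.cong refl sum.swap)
  also have "\<dots> = (\<Sum>\<tau>\<in>perms d. \<Sum>xs\<in>?L.
      if geodesic d (cycle_of_list xs) \<tau> then g \<tau> * perm_basis (cycle_of_list xs \<circ> \<tau>) \<rho> else 0)"
  proof (intro sum.cong refl)
    fix \<tau> xs assume "\<tau> \<in> perms d" and xs: "xs \<in> ?L"
    have "cycle_of_list xs \<in> perms d" using spread_list_cycle_permutes[OF xs] by simp
    then show "(\<Sum>\<sigma>\<in>perms d. if cycle_of_list xs = \<sigma> then (if geodesic d \<sigma> \<tau> \<and> \<sigma> \<circ> \<tau> = \<rho> then g \<tau> else 0) else 0)
        = (if geodesic d (cycle_of_list xs) \<tau> then g \<tau> * perm_basis (cycle_of_list xs \<circ> \<tau>) \<rho> else 0)"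
      by (subst sum.delta'[OF finite_perms]) (auto simp: perm_basis_def)
  qed
  also have "\<dots> = (\<Sum>\<tau>\<in>perms d. g \<tau> * (\<Sum>xs\<in>spread_lists {1..d} \<tau> (Suc a). perm_basis (cycle_of_list xs \<circ> \<tau>) \<rho>))"
  proof (rule sum.cong[OF refl])
    fix \<tau> assume t: "\<tau> \<in> perms d"
    have "(\<Sum>xs\<in>?L. if geodesic d (cycle_of_list xs) \<tau> then g \<tau> * perm_basis (cycle_of_list xs \<circ> \<tau>) \<rho> else 0) =
        (\<Sum>xs\<in>spread_lists {1..d} \<tau> (Suc a). g \<tau> * perm_basis (cycle_of_list xs \<circ> \<tau>) \<rho>)"
    proof (rule sum.mono_neutral_cong_right[OF fin spread_lists_subset])
      show "\<forall>xs\<in>?L - spread_lists {1..d} \<tau> (Suc a).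
          (if geodesic d (cycle_of_list xs) \<tau> then g \<tau> * perm_basis (cycle_of_list xs \<circ> \<tau>) \<rho> else 0) = 0"
        using geodesic_cycle_iff t by auto
      fix xs assume xs: "xs \<in> spread_lists {1..d} \<tau> (Suc a)"
      then have "xs \<in> ?L" using spread_lists_subset by blast
      then have "geodesic d (cycle_of_list xs) \<tau>" using geodesic_cycle_iff xs t by blast
      then show "(if geodesic d (cycle_of_list xs) \<tau> then g \<tau> * perm_basis (cycle_of_list xs \<circ> \<tau>) \<rho> else 0) =
          g \<tau> * perm_basis (cycle_of_list xs \<circ> \<tau>) \<rho>" by simp
    qed
    then show "(\<Sum>xs\<in>?L. if geodesic d (cycle_of_list xs) \<tau> then g \<tau> * perm_basis (cycle_of_list xs \<circ> \<tau>) \<rho> else 0) =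
        g \<tau> * (\<Sum>xs\<in>spread_lists {1..d} \<tau> (Suc a). perm_basis (cycle_of_list xs \<circ> \<tau>) \<rho>)"
      by (simp only: sum_distrib_left)
  qed
  finally show ?thesis .
qed

lemma cycle_conjugate:
  assumes "\<pi> permutes A" "distinct xs"
  shows "\<pi> \<circ> (cycle_of_list xs \<circ> \<tau>) \<circ> inv' \<pi> = cycle_of_list (map \<pi> xs) \<circ> (\<pi> \<circ> \<tau> \<circ> inv' \<pi>)"
proof -
  have "cycle_of_list (map \<pi> xs) = \<pi> \<circ> cycle_of_list xs \<circ> inv' \<pi>"
    by (rule conjugation_of_cycle[symmetric]) (use assms permutes_bij in auto)
  then show ?thesis using permutes_inverses(2)[OF assms(1)] by (simp add: fun_eq_iff)
qed

lemma bij_betw_spread_lists_conjugate: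
  assumes fin: "finite A" and p: "\<pi> permutes A" and t: "\<tau> permutes A"
  shows "bij_betw (map \<pi>) (spread_lists A \<tau> m) (spread_lists A (\<pi> \<circ> \<tau> \<circ> inv' \<pi>) m)"
proof -
  have d: "distinct (map (orbit (\<pi> \<circ> \<tau> \<circ> inv' \<pi>)) (map \<pi> xs)) \<longleftrightarrow> distinct (map (orbit \<tau>) xs)" for xs
  proof -
    have "map (\<lambda>x. orbit (\<pi> \<circ> \<tau> \<circ> inv' \<pi>) (\<pi> x)) xs = map (image \<pi>) (map (orbit \<tau>) xs)"
      by (simp only: orbit_conjugate[OF fin p t] map_map o_def[of "image \<pi>"])
    moreover have "map (orbit c) (map \<pi> xs) = map (\<lambda>x. orbit c (\<pi> x)) xs" for c
      by simp
    moreover have "inj_on (image \<pi>) B" for B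
      using permutes_inj[OF p] by (simp add: inj_on_def inj_image_eq_iff)
    ultimately show ?thesis by (simp only: distinct_map[of "image \<pi>"] simp_thms)
  qed
  have s: "set (map \<pi> xs) \<subseteq> A \<longleftrightarrow> set xs \<subseteq> A" for xs
    using permutes_in_image[OF p] by auto
  have inv: "map \<pi> (map (inv' \<pi>) xs) = xs" "map (inv' \<pi>) (map \<pi> xs) = xs" for xs
    using permutes_inverses[OF p] by (simp_all add: map_idI)
  have iff: "map \<pi> xs \<in> spread_lists A (\<pi> \<circ> \<tau> \<circ> inv' \<pi>) m \<longleftrightarrow> xs \<in> spread_lists A \<tau> m" for xs
    unfolding spread_lists_def mem_Collect_eq d s length_map ..
  show ?thesis
  proof (rule bij_betw_byWitness[where f' = "map (inv' \<pi>)"])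
    show "map (inv' \<pi>) ` spread_lists A (\<pi> \<circ> \<tau> \<circ> inv' \<pi>) m \<subseteq> spread_lists A \<tau> m"
    proof (rule image_subsetI)
      fix ys assume "ys \<in> spread_lists A (\<pi> \<circ> \<tau> \<circ> inv' \<pi>) m"
      then show "map (inv' \<pi>) ys \<in> spread_lists A \<tau> m"
        using iff[of "map (inv' \<pi>) ys"] unfolding inv(1) by blast
    qed
  qed (use inv iff in \<open>auto simp del: map_map\<close>)
qed

lemma conjugate_id: "\<pi> permutes A \<Longrightarrow> \<pi> \<circ> id \<circ> inv' \<pi> = id"
  using permutes_inv_o(1) by simp

lemma cycle_sum_carrier: "cycle_sum d a \<in> carrier (hilb_algebra d)"
proof (rule hilb_carrierI)
  fix \<sigma> :: "nat \<Rightarrow> nat" assume "\<not> \<sigma> permutes {1..d}"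
  then show "cycle_sum d a \<sigma> = 0"
    using spread_list_cycle_permutes[of _ d id "Suc a"]
    unfolding cycle_sum_def by (intro sum.neutral) (auto simp: perm_basis_def)
next
  fix \<pi> \<sigma> :: "nat \<Rightarrow> nat" assume p: "\<pi> permutes {1..d}" and "\<sigma> permutes {1..d}"
  define c where "c \<sigma> = \<pi> \<circ> \<sigma> \<circ> inv' \<pi>" for \<sigma> :: "nat \<Rightarrow> nat"
  have bij: "bij_betw c (perms d) (perms d)" unfolding c_def by (rule bij_betw_conjugate[OF p])
  let ?L = "spread_lists {1..d} id (Suc a)"
  have b: "bij_betw (map \<pi>) ?L ?L"
    using bij_betw_spread_lists_conjugate[OF finite_atLeastAtMost p permutes_id]
    unfolding conjugate_id[OF p] .
  have "cycle_sum d a (c \<sigma>) = (\<Sum>xs\<in>?L. perm_basis (cycle_of_list (map \<pi> xs)) (c \<sigma>))"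
    unfolding cycle_sum_def by (rule sum.reindex_bij_betw[OF b, symmetric])
  also have "\<dots> = cycle_sum d a \<sigma>"
    unfolding cycle_sum_def
  proof (rule sum.cong[OF refl])
    fix xs assume xs: "xs \<in> ?L"
    then have "distinct xs" by (simp only: spread_lists_id)
    then have "cycle_of_list (map \<pi> xs) = c (cycle_of_list xs)"
      unfolding c_def using permutes_bij[OF p] by (intro conjugation_of_cycle[symmetric])
    moreover have "c \<sigma> = c (cycle_of_list xs) \<longleftrightarrow> \<sigma> = cycle_of_list xs"
      using bij spread_list_cycle_permutes[OF xs] \<open>\<sigma> permutes {1..d}\<close> by (auto simp: bij_betw_def inj_on_def)
    ultimately show "perm_basis (cycle_of_list (map \<pi> xs)) (c \<sigma>) = perm_basis (cycle_of_list xs) \<sigma>"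
      by (simp add: perm_basis_def)
  qed
  finally show "cycle_sum d a (\<pi> \<circ> \<sigma> \<circ> inv' \<pi>) = cycle_sum d a \<sigma>" unfolding c_def .
qed

lemma conjugate_comp:
  assumes "\<pi> permutes A" "\<pi>' permutes A"
  shows "(\<pi>' \<circ> \<pi>) \<circ> \<sigma> \<circ> inv' (\<pi>' \<circ> \<pi>) = \<pi>' \<circ> (\<pi> \<circ> \<sigma> \<circ> inv' \<pi>) \<circ> inv' \<pi>'"
  using permutes_bij[OF assms(1)] permutes_bij[OF assms(2)]
  by (simp add: o_inv_distrib comp_assoc)

lemma conj_sum_conjugate:
  assumes p: "\<pi> permutes {1..d}"
  shows "conj_sum d (\<pi> \<circ> \<sigma> \<circ> inv' \<pi>) = conj_sum d \<sigma>"
proof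
  fix \<rho>
  have "conj_sum d \<sigma> \<rho> = (\<Sum>\<pi>'\<in>perms d. perm_basis ((\<pi>' \<circ> \<pi>) \<circ> \<sigma> \<circ> inv' (\<pi>' \<circ> \<pi>)) \<rho>)"
    unfolding conj_sum_def by (rule sum_permutations_compose_right[OF p])
  also have "\<dots> = conj_sum d (\<pi> \<circ> \<sigma> \<circ> inv' \<pi>) \<rho>"
    unfolding conj_sum_def by (intro sum.cong refl) (simp add: conjugate_comp[OF p] del: comp_apply)
  finally show "conj_sum d (\<pi> \<circ> \<sigma> \<circ> inv' \<pi>) \<rho> = conj_sum d \<sigma> \<rho>" by (rule sym)
qed

lemma perm_basis_conjugate:
  assumes p: "\<pi> permutes {1..d}"
  shows "perm_basis (\<pi> \<circ> \<sigma> \<circ> inv' \<pi>) (\<pi> \<circ> \<rho> \<circ> inv' \<pi>) = perm_basis \<sigma> \<rho>"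
proof -
  have "\<pi> \<circ> \<rho> \<circ> inv' \<pi> = \<pi> \<circ> \<sigma> \<circ> inv' \<pi> \<longleftrightarrow> \<rho> = \<sigma>"
  proof
    assume e: "\<pi> \<circ> \<rho> \<circ> inv' \<pi> = \<pi> \<circ> \<sigma> \<circ> inv' \<pi>"
    show "\<rho> = \<sigma>"
    proof
      fix x
      have "\<pi> (\<rho> (inv' \<pi> (\<pi> x))) = \<pi> (\<sigma> (inv' \<pi> (\<pi> x)))" using e by (simp add: fun_eq_iff)
      then show "\<rho> x = \<sigma> x"
        using permutes_inj[OF p] by (simp add: permutes_inverses(2)[OF p] inj_eq)
    qed
  qed simp
  then show ?thesis by (simp add: perm_basis_def)
qed

lemma conj_sum_carrier:
  assumes s: "\<sigma> permutes {1..d}"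
  shows "conj_sum d \<sigma> \<in> carrier (hilb_algebra d)"
proof (rule hilb_carrierI)
  fix \<rho> :: "nat \<Rightarrow> nat" assume "\<not> \<rho> permutes {1..d}"
  then show "conj_sum d \<sigma> \<rho> = 0"
    using conjugate_permutes[OF _ s] unfolding conj_sum_def
    by (intro sum.neutral) (auto simp: perm_basis_def)
next
  fix \<pi> \<rho> :: "nat \<Rightarrow> nat" assume p: "\<pi> permutes {1..d}"
  have "conj_sum d \<sigma> (\<pi> \<circ> \<rho> \<circ> inv' \<pi>) =
      (\<Sum>\<pi>'\<in>perms d. perm_basis ((\<pi> \<circ> \<pi>') \<circ> \<sigma> \<circ> inv' (\<pi> \<circ> \<pi>')) (\<pi> \<circ> \<rho> \<circ> inv' \<pi>))"
    unfolding conj_sum_def by (rule setum_permutations_compose_left[OF p])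
  also have "\<dots> = conj_sum d \<sigma> \<rho>"
    unfolding conj_sum_def
    by (intro sum.cong refl) (simp add: conjugate_comp[OF _ p] perm_basis_conjugate[OF p] del: comp_apply)
  finally show "conj_sum d \<sigma> (\<pi> \<circ> \<rho> \<circ> inv' \<pi>) = conj_sum d \<sigma> \<rho>" .
qed

lemma cycle_sum_mult_conj_sum:
  assumes t: "\<tau> permutes {1..d}"
  shows "grad_mult d (cycle_sum d a) (conj_sum d \<tau>) =
    (\<lambda>\<rho>. \<Sum>xs\<in>spread_lists {1..d} \<tau> (Suc a). conj_sum d (cycle_of_list xs \<circ> \<tau>) \<rho>)"
proof
  fix \<rho>
  define G where "G \<tau>' = (\<Sum>xs\<in>spread_lists {1..d} \<tau>' (Suc a). perm_basis (cycle_of_list xs \<circ> \<tau>') \<rho>)" for \<tau>'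
  have "grad_mult d (cycle_sum d a) (conj_sum d \<tau>) \<rho> =
      (\<Sum>\<pi>\<in>perms d. \<Sum>\<tau>'\<in>perms d. perm_basis (\<pi> \<circ> \<tau> \<circ> inv' \<pi>) \<tau>' * G \<tau>')"
    unfolding cycle_sum_mult conj_sum_def G_def[symmetric] sum_distrib_right by (rule sum.swap)
  also have "\<dots> = (\<Sum>\<pi>\<in>perms d. G (\<pi> \<circ> \<tau> \<circ> inv' \<pi>))"
  proof (rule sum.cong[OF refl])
    fix \<pi> assume "\<pi> \<in> perms d"
    then have "\<pi> \<circ> \<tau> \<circ> inv' \<pi> \<in> perms d" using conjugate_permutes[OF _ t] by simp
    then show "(\<Sum>\<tau>'\<in>perms d. perm_basis (\<pi> \<circ> \<tau> \<circ> inv' \<pi>) \<tau>' * G \<tau>') = G (\<pi> \<circ> \<tau> \<circ> inv' \<pi>)"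
      unfolding perm_basis_def using finite_perms by (simp add: if_distrib[of "\<lambda>x. x * _"] sum.delta cong: if_cong)
  qed
  also have "\<dots> = (\<Sum>\<pi>\<in>perms d. \<Sum>xs\<in>spread_lists {1..d} \<tau> (Suc a).
      perm_basis (\<pi> \<circ> (cycle_of_list xs \<circ> \<tau>) \<circ> inv' \<pi>) \<rho>)"
  proof (rule sum.cong[OF refl])
    fix \<pi> assume "\<pi> \<in> perms d"
    then have p: "\<pi> permutes {1..d}" by simp
    have "G (\<pi> \<circ> \<tau> \<circ> inv' \<pi>) = (\<Sum>xs\<in>spread_lists {1..d} \<tau> (Suc a).
        perm_basis (cycle_of_list (map \<pi> xs) \<circ> (\<pi> \<circ> \<tau> \<circ> inv' \<pi>)) \<rho>)"
      unfolding G_def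
      by (rule sum.reindex_bij_betw[OF bij_betw_spread_lists_conjugate[OF finite_atLeastAtMost p t], symmetric])
    also have "\<dots> = (\<Sum>xs\<in>spread_lists {1..d} \<tau> (Suc a).
        perm_basis (\<pi> \<circ> (cycle_of_list xs \<circ> \<tau>) \<circ> inv' \<pi>) \<rho>)"
    proof (rule sum.cong[OF refl])
      fix xs assume "xs \<in> spread_lists {1..d} \<tau> (Suc a)"
      then have "distinct xs" by (auto simp: spread_lists_def distinct_map)
      then show "perm_basis (cycle_of_list (map \<pi> xs) \<circ> (\<pi> \<circ> \<tau> \<circ> inv' \<pi>)) \<rho> =
          perm_basis (\<pi> \<circ> (cycle_of_list xs \<circ> \<tau>) \<circ> inv' \<pi>) \<rho>"
        by (simp only: cycle_conjugate[OF p])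
    qed
    finally show "G (\<pi> \<circ> \<tau> \<circ> inv' \<pi>) = (\<Sum>xs\<in>spread_lists {1..d} \<tau> (Suc a).
        perm_basis (\<pi> \<circ> (cycle_of_list xs \<circ> \<tau>) \<circ> inv' \<pi>) \<rho>)" .
  qed
  also have "\<dots> = (\<Sum>xs\<in>spread_lists {1..d} \<tau> (Suc a). conj_sum d (cycle_of_list xs \<circ> \<tau>) \<rho>)"
    unfolding conj_sum_def by (rule sum.swap)
  finally show "grad_mult d (cycle_sum d a) (conj_sum d \<tau>) \<rho> =
      (\<Sum>xs\<in>spread_lists {1..d} \<tau> (Suc a). conj_sum d (cycle_of_list xs \<circ> \<tau>) \<rho>)" .
qed

lemma hilb_eq_conj_sums:
  assumes f: "f \<in> carrier (hilb_algebra d)"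
  shows "fact d * f \<rho> = (\<Sum>\<sigma>\<in>perms d. f \<sigma> * conj_sum d \<sigma> \<rho>)"
proof -
  have "(\<Sum>\<sigma>\<in>perms d. f \<sigma> * conj_sum d \<sigma> \<rho>) =
      (\<Sum>\<pi>\<in>perms d. \<Sum>\<sigma>\<in>perms d. f (\<pi> \<circ> \<sigma> \<circ> inv' \<pi>) * perm_basis (\<pi> \<circ> \<sigma> \<circ> inv' \<pi>) \<rho>)"
    unfolding conj_sum_def sum_distrib_left
    by (subst sum.swap) (intro sum.cong refl, simp only: mem_Collect_eq hilb_conj[OF f])
  also have "\<dots> = (\<Sum>\<pi>\<in>perms d. \<Sum>\<sigma>\<in>perms d. f \<sigma> * perm_basis \<sigma> \<rho>)"
    by (rule sum.cong[OF refl])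
      (rule sum.reindex_bij_betw[OF bij_betw_conjugate, where g = "\<lambda>\<sigma>. f \<sigma> * perm_basis \<sigma> \<rho>"], simp)
  also have "(\<Sum>\<sigma>\<in>perms d. f \<sigma> * perm_basis \<sigma> \<rho>) = f \<rho>"
  proof -
    have "(\<Sum>\<sigma>\<in>perms d. f \<sigma> * perm_basis \<sigma> \<rho>) = (\<Sum>\<sigma>\<in>perms d. if \<rho> = \<sigma> then f \<sigma> else 0)"
      by (intro sum.cong refl) (simp add: perm_basis_def)
    then show ?thesis using finite_perms hilb_support[OF f, of \<rho>] by (simp add: sum.delta')
  qed
  finally show ?thesis using card_permutations[of "{1..d}" d] by simp
qed

section \<open>A functional on each norm\<close>

lemma perm_extending_lists:
  assumes fin: "finite F" and "distinct xs" "distinct ys" "length xs = length ys"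
    and "set xs \<subseteq> F" "set ys \<subseteq> F"
  obtains \<pi> where "\<pi> permutes F" "map \<pi> xs = ys"
proof -
  define f where "f x = the (map_of (zip xs ys) x)" for x
  have f: "f (xs ! i) = ys ! i" if "i < length xs" for i
    using assms that by (simp add: f_def map_of_zip_nth)
  have mf: "map f xs = ys" using f assms(4) by (intro nth_equalityI) auto
  then have fset: "f ` set xs = set ys" by (metis set_map)
  have finj: "inj_on f (set xs)" using mf assms(3) by (metis distinct_map)
  have "card (F - set xs) = card (F - set ys)"
    using assms fin by (simp add: card_Diff_subset distinct_card)
  then obtain g where g: "bij_betw g (F - set xs) (F - set ys)"
    using fin finite_same_card_bij[of "F - set xs" "F - set ys"] by auto
  define h where "h x = (if x \<in> set xs then f x else g x)" for x
  have "bij_betw h (set xs \<union> (F - set xs)) (set ys \<union> (F - set ys))"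
  proof (rule bij_betw_combine)
    show "bij_betw h (set xs) (set ys)"
      using finj fset by (auto simp: h_def bij_betw_def inj_on_def)
    show "bij_betw h (F - set xs) (F - set ys)"
      using g by (subst bij_betw_cong[where g = g]) (simp_all add: h_def)
  qed auto
  then have "bij_betw h F F" using assms(5,6) by (simp add: Un_absorb1)
  then have "(\<lambda>x. if x \<in> F then h x else x) permutes F"
    by (intro bij_imp_permutes) (auto cong: bij_betw_cong)
  moreover have "map (\<lambda>x. if x \<in> F then h x else x) xs = ys"
    using assms(5) by (subst mf[symmetric]) (auto simp: h_def)
  ultimately show ?thesis using that by blast
qed

lemma orbit_fixed: "\<tau> x = x \<Longrightarrow> orbit \<tau> x = {x}"
  by (simp add: orbit_eq_singleton_iff)

text \<open>A permutation of the fixed points of \<open>\<tau>\<close> that takes one list to the other commutes with \<open>\<tau>\<close>. This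
  special case replaces the classification of conjugacy classes by cycle type.\<close>

lemma cycle_comp_conjugate:
  assumes t: "\<tau> permutes A" and fin: "finite A"
    and xs: "distinct xs" "set xs \<subseteq> {x \<in> A. \<tau> x = x}"
    and ys: "distinct ys" "set ys \<subseteq> {x \<in> A. \<tau> x = x}" and "length xs = length ys"
  obtains \<pi> where "\<pi> permutes A"
    "\<pi> \<circ> (cycle_of_list xs \<circ> \<tau>) \<circ> inv' \<pi> = cycle_of_list ys \<circ> \<tau>"
proof -
  define F where "F = {x \<in> A. \<tau> x = x}"
  obtain \<pi> where p: "\<pi> permutes F" "map \<pi> xs = ys"
    using perm_extending_lists[of F xs ys] assms unfolding F_def by auto
  have pA: "\<pi> permutes A" using p(1) by (rule permutes_subset) (auto simp: F_def)
  have comm: "\<pi> (\<tau> x) = \<tau> (\<pi> x)" for x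
  proof (cases "x \<in> F")
    case True
    then have "\<pi> x \<in> F" using permutes_in_image[OF p(1)] by blast
    then show ?thesis using True by (simp add: F_def)
  next
    case False
    have "\<tau> x \<notin> F"
    proof
      assume *: "\<tau> x \<in> F"
      then have "\<tau> (\<tau> x) = \<tau> x" by (simp add: F_def)
      then have "\<tau> x = x" using permutes_inj[OF t] by (simp add: inj_eq)
      then show False using * False by simp
    qed
    then show ?thesis using False permutes_not_in[OF p(1)] by simp
  qed
  have "\<pi> \<circ> \<tau> \<circ> inv' \<pi> = \<tau>"
    using permutes_inverses(1)[OF p(1)] by (simp add: fun_eq_iff comm)
  then have "\<pi> \<circ> (cycle_of_list xs \<circ> \<tau>) \<circ> inv' \<pi> = cycle_of_list ys \<circ> \<tau>"
    using cycle_conjugate[OF pA xs(1), of \<tau>] p(2) by simp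
  with pA show ?thesis by (rule that)
qed

lemma split_off_cycle:
  assumes s: "\<sigma> permutes A" and fin: "finite A" and "\<sigma> \<noteq> id"
  obtains xs \<tau> where "\<tau> permutes A" "\<sigma> = cycle_of_list xs \<circ> \<tau>" "distinct xs" "length xs \<ge> 2"
    "set xs \<subseteq> {x \<in> A. \<tau> x = x}"
proof -
  have p: "permutation \<sigma>" by (rule permutes_imp_permutation[OF fin s])
  obtain x where x: "\<sigma> x \<noteq> x" using assms(3) by (auto simp: fun_eq_iff)
  then have xA: "x \<in> A" using permutes_not_in[OF s] by blast
  define xs where "xs = support \<sigma> x"
  define \<tau> where "\<tau> y = (if y \<in> A - set xs then \<sigma> y else y)" for y
  have set_xs: "set xs = range (\<lambda>i. (\<sigma> ^^ i) x)" unfolding xs_def by (rule support_set[OF p])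
  have xsA: "set xs \<subseteq> A"
    unfolding set_xs using permutes_in_image[OF permutes_funpow[OF s]] xA by blast
  have "\<tau> permutes A - set xs"
    unfolding \<tau>_def xs_def by (rule semidecomposition[OF s fin])
  then have tA: "\<tau> permutes A" by (rule permutes_subset) blast
  have "\<sigma> = cycle_of_list xs \<circ> \<tau>"
  proof
    fix y
    show "\<sigma> y = (cycle_of_list xs \<circ> \<tau>) y"
    proof (cases "y \<in> set xs")
      case True
      then show ?thesis using cycle_restrict[OF p, of y x] by (simp add: \<tau>_def xs_def)
    next
      case False
      have "\<tau> y \<notin> set xs"
        using False permutes_in_image[OF \<open>\<tau> permutes A - set xs\<close>, of y]
          permutes_not_in[OF \<open>\<tau> permutes A - set xs\<close>, of y] by (cases "y \<in> A") auto
      moreover have "\<tau> y = \<sigma> y" using False permutes_not_in[OF s, of y] by (simp add: \<tau>_def)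
      ultimately show ?thesis by (simp add: id_outside_supp)
    qed
  qed
  moreover have "distinct xs" unfolding xs_def by (rule cycle_of_permutation[OF p])
  moreover have "length xs \<ge> 2"
    using least_power_gt_one[of \<sigma> x, OF p x] by (simp add: xs_def)
  moreover have "set xs \<subseteq> {x \<in> A. \<tau> x = x}" using xsA by (auto simp: \<tau>_def)
  ultimately show ?thesis using that tA by blast
qed

lemma fixed_point_lists_spread:
  assumes "distinct xs" "set xs \<subseteq> {x \<in> A. \<tau> x = x}"
  shows "xs \<in> spread_lists A \<tau> (length xs)" "orbit \<tau> ` set xs \<subseteq> trivial_orbits A \<tau>"
proof -
  have o: "orbit \<tau> x = {x}" if "x \<in> set xs" for x using that assms(2) by (intro orbit_fixed) auto
  show "xs \<in> spread_lists A \<tau> (length xs)"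
    using assms o by (auto simp: spread_lists_def distinct_map inj_on_def)
  show "orbit \<tau> ` set xs \<subseteq> trivial_orbits A \<tau>"
    using assms(2) o by (auto simp: trivial_orbits_def orbits_def)
qed

lemma trivial_orbits_eq: 
  assumes "finite A" "\<tau> permutes A"
  shows "trivial_orbits A \<tau> = (\<lambda>x. {x}) ` {x \<in> A. \<tau> x = x}"
proof (intro equalityI subsetI)
  fix P assume "P \<in> trivial_orbits A \<tau>"
  then obtain x where x: "x \<in> A" "P = orbit \<tau> x" "card P = 1"
    by (auto simp: trivial_orbits_def orbits_def)
  then obtain y where "P = {y}" by (auto simp: card_1_singleton_iff)
  then have "orbit \<tau> x = {x}" using self_in_orbit[OF assms, of x] x by auto
  moreover from this have "\<tau> x = x" by (simp add: orbit_eq_singleton_iff)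
  ultimately show "P \<in> (\<lambda>x. {x}) ` {x \<in> A. \<tau> x = x}" using x by blast
next
  fix P assume "P \<in> (\<lambda>x. {x}) ` {x \<in> A. \<tau> x = x}"
  then obtain x where x: "x \<in> A" "\<tau> x = x" "P = {x}" by blast
  then show "P \<in> trivial_orbits A \<tau>" using orbit_fixed[of \<tau> x]
    by (auto simp: trivial_orbits_def orbits_def)
qed

lemma card_trivial_orbits:
  assumes "finite A" "\<tau> permutes A"
  shows "card (trivial_orbits A \<tau>) = card {x \<in> A. \<tau> x = x}"
  unfolding trivial_orbits_eq[OF assms] by (rule card_image) simp

lemma orbit_counts_join_fixed_points:
  assumes fin: "finite A" and t: "\<tau> permutes A" and xs: "distinct xs" "set xs \<subseteq> {x \<in> A. \<tau> x = x}"
    and "length xs \<ge> 2"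
  shows "card (nontrivial_orbits A (cycle_of_list xs \<circ> \<tau>)) = card (nontrivial_orbits A \<tau>) + 1"
    and "card (trivial_orbits A (cycle_of_list xs \<circ> \<tau>)) = card (trivial_orbits A \<tau>) - length xs"
proof -
  define S where "S = orbit \<tau> ` set xs"
  obtain a where a: "length xs = Suc a" "a \<ge> 1" using assms(5) by (cases "length xs") auto
  have x: "xs \<in> spread_lists A \<tau> (Suc a)" using fixed_point_lists_spread(1)[OF xs] a by simp
  have ST: "S \<subseteq> trivial_orbits A \<tau>" unfolding S_def by (rule fixed_point_lists_spread(2)[OF xs])
  note m = orbits_spread_merge[OF fin t x a(2), folded S_def]
  have cS: "card S = length xs" using m(1) a by (simp add: subsets_of_card_def)
  have e: "nontrivial_orbits A \<tau> - S = nontrivial_orbits A \<tau>"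
    using ST orbits_split(2)[of A \<tau>] by blast
  have "\<Union>S \<notin> nontrivial_orbits A \<tau>" using m(3) e by (auto simp: nontrivial_orbits_def)
  then show "card (nontrivial_orbits A (cycle_of_list xs \<circ> \<tau>)) = card (nontrivial_orbits A \<tau>) + 1"
    unfolding m(6) e using finite_orbits_split(1)[OF fin, of \<tau>] by simp
  show "card (trivial_orbits A (cycle_of_list xs \<circ> \<tau>)) = card (trivial_orbits A \<tau>) - length xs"
    unfolding m(7) using ST cS finite_orbits_split(2)[OF fin, of \<tau>]
    by (simp add: card_Diff_subset finite_subset)
qed

text \<open>Each step joins two fixed points. The first step is different: it joins all fixed points but \<open>v\<close>
  of the identity, so that the points that are left over go into one orbit.\<close>

lemma exists_perm_with_orbit_counts:
  assumes "2 * r + v \<le> d" "r = 0 \<Longrightarrow> v = d"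
  shows "\<exists>\<tau>. \<tau> permutes {1..d} \<and> card (nontrivial_orbits {1..d} \<tau>) = r \<and>
    card (trivial_orbits {1..d} \<tau>) = v"
  using assms
proof (induct r arbitrary: v)
  case 0
  have p: "id permutes {1..d}" by (rule permutes_id)
  have "nontrivial_orbits {1..d} id = {}"
    using nontrivial_orbits_eq_empty_iff[OF finite_atLeastAtMost p] by simp
  moreover have "card (trivial_orbits {1..d} id) = d"
    using card_trivial_orbits[OF finite_atLeastAtMost p] by (simp only: id_apply simp_thms
      Collect_mem_eq card_atLeastAtMost diff_Suc_1 Suc_diff_Suc)
  moreover have "v = d" using 0 by blast
  ultimately show "\<exists>\<tau>. \<tau> permutes {1..d} \<and> card (nontrivial_orbits {1..d} \<tau>) = 0 \<and>
      card (trivial_orbits {1..d} \<tau>) = v"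
    using p by (metis card.empty)
next
  case (Suc r)
  \<comment> \<open>the number of fixed points before the step\<close>
  define w where "w = (if r = 0 then d else v + 2)"
  have "2 * r + w \<le> d" "r = 0 \<Longrightarrow> w = d" using Suc(2) by (auto simp: w_def)
  then obtain \<tau> where t: "\<tau> permutes {1..d}" "card (nontrivial_orbits {1..d} \<tau>) = r"
    "card (trivial_orbits {1..d} \<tau>) = w" using Suc(1) by blast
  have wv: "w \<ge> v + 2" using Suc(2) by (auto simp: w_def)
  define F where "F = {x \<in> {1..d}. \<tau> x = x}"
  have cF: "card F = w" using card_trivial_orbits[OF finite_atLeastAtMost t(1)] t(3) by (simp add: F_def)
  then obtain G where G: "G \<subseteq> F" "card G = w - v" "finite G"
    using obtain_subset_with_card_n[of "w - v" F] by (metis diff_le_self)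
  obtain xs where xs: "set xs = G" "distinct xs" using finite_distinct_list[OF G(3)] by blast
  have l: "length xs = w - v" using xs G distinct_card by metis
  have sx: "set xs \<subseteq> {x \<in> {1..d}. \<tau> x = x}" using xs(1) G(1) by (simp add: F_def)
  have l2: "length xs \<ge> 2" using l wv by simp
  note c = orbit_counts_join_fixed_points[OF finite_atLeastAtMost t(1) xs(2) sx l2]
  have "cycle_of_list xs \<circ> \<tau> permutes {1..d}"
    by (rule cycle_comp_permutes[OF finite_atLeastAtMost t(1)]) (use sx in auto)
  moreover have "card (nontrivial_orbits {1..d} (cycle_of_list xs \<circ> \<tau>)) = Suc r"
    unfolding c(1) t(2) by simp
  moreover have "card (trivial_orbits {1..d} (cycle_of_list xs \<circ> \<tau>)) = v"
    unfolding c(2) t(3) l using wv by simp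
  ultimately show ?case by blast
qed

lemma perm_weight_conjugate:
  assumes p: "\<pi> permutes {1..d}" and s: "\<sigma> permutes {1..d}"
  shows "perm_weight d n (\<pi> \<circ> \<sigma> \<circ> inv' \<pi>) = perm_weight d n \<sigma>"
proof -
  have inj: "inj_on (image \<pi>) X" for X
    using permutes_inj[OF p] by (simp add: inj_on_def inj_image_eq_iff)
  have c: "card (\<pi> ` P) = card P" for P
    by (rule card_image, rule inj_on_subset[OF permutes_inj[OF p] subset_UNIV])
  have o: "orbits {1..d} (\<pi> \<circ> \<sigma> \<circ> inv' \<pi>) = image \<pi> ` orbits {1..d} \<sigma>"
    by (rule orbits_conjugate[OF _ p s]) simp
  have n: "nontrivial_orbits {1..d} (\<pi> \<circ> \<sigma> \<circ> inv' \<pi>) = image \<pi> ` nontrivial_orbits {1..d} \<sigma>"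
    unfolding nontrivial_orbits_def o using c by auto
  show ?thesis
    unfolding perm_weight_def o n prod.reindex[OF inj] card_image[OF inj] by (simp add: c)
qed

lemma perm_weight_neq_0:
  assumes "\<sigma> permutes {1..d}"
  shows "perm_weight d n \<sigma> \<noteq> 0"
  using card_orbit_pos[OF finite_atLeastAtMost assms] finite_orbits[of "{1..d}" \<sigma>]
  by (auto simp: perm_weight_def orbit_weight_def)

definition cycle_functional :: "nat \<Rightarrow> nat \<Rightarrow> ((nat \<Rightarrow> nat) \<Rightarrow> rat) \<Rightarrow> rat" where
  "cycle_functional d n f = (\<Sum>\<sigma>\<in>perms d. f \<sigma> * (if perm_norm d \<sigma> = n then perm_weight d n \<sigma> else 0))"

text \<open>Each \<open>\<tau>\<close> contributes a multiple of the sum of weights over the ways to join \<open>a + 1\<close> of its orbits.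
  For \<open>n \<le> d/2\<close> there are always more than \<open>a\<close> fixed points, so this sum vanishes.\<close>

lemma cycle_functional_cycle_sum_mult:
  assumes "a \<ge> 1" "2 * n \<le> d" "h id = 0"
  shows "cycle_functional d n (grad_mult d (cycle_sum d a) h) = 0"
proof -
  let ?w = "\<lambda>\<sigma>. if perm_norm d \<sigma> = n then perm_weight d n \<sigma> else 0"
  have "cycle_functional d n (grad_mult d (cycle_sum d a) h) =
      (\<Sum>\<tau>\<in>perms d. h \<tau> * (\<Sum>xs\<in>spread_lists {1..d} \<tau> (Suc a). ?w (cycle_of_list xs \<circ> \<tau>)))"
  proof -
    have "cycle_functional d n (grad_mult d (cycle_sum d a) h) =
      (\<Sum>\<rho>\<in>perms d. \<Sum>\<tau>\<in>perms d. \<Sum>xs\<in>spread_lists {1..d} \<tau> (Suc a).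
        h \<tau> * (perm_basis (cycle_of_list xs \<circ> \<tau>) \<rho> * ?w \<rho>))"
      unfolding cycle_functional_def cycle_sum_mult sum_distrib_right sum_distrib_left
      by (simp only: mult.assoc)
    also have "\<dots> = (\<Sum>\<tau>\<in>perms d. \<Sum>xs\<in>spread_lists {1..d} \<tau> (Suc a). \<Sum>\<rho>\<in>perms d.
        h \<tau> * (perm_basis (cycle_of_list xs \<circ> \<tau>) \<rho> * ?w \<rho>))"
      by (subst sum.swap, rule sum.cong[OF refl], rule sum.swap)
    also have "\<dots> = (\<Sum>\<tau>\<in>perms d. \<Sum>xs\<in>spread_lists {1..d} \<tau> (Suc a). h \<tau> * ?w (cycle_of_list xs \<circ> \<tau>))"
    proof (intro sum.cong refl)
      fix \<tau> xs assume "\<tau> \<in> perms d" "xs \<in> spread_lists {1..d} \<tau> (Suc a)"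
      then have c: "cycle_of_list xs \<circ> \<tau> \<in> perms d" using spread_lists_cycle_permutes by blast
      have "(\<Sum>\<rho>\<in>perms d. h \<tau> * (perm_basis (cycle_of_list xs \<circ> \<tau>) \<rho> * ?w \<rho>)) =
          (\<Sum>\<rho>\<in>perms d. if \<rho> = cycle_of_list xs \<circ> \<tau> then h \<tau> * ?w \<rho> else 0)"
        by (intro sum.cong refl) (simp add: perm_basis_def)
      then show "(\<Sum>\<rho>\<in>perms d. h \<tau> * (perm_basis (cycle_of_list xs \<circ> \<tau>) \<rho> * ?w \<rho>)) =
          h \<tau> * ?w (cycle_of_list xs \<circ> \<tau>)"
        by (simp only: sum.delta[OF finite_perms] c if_True)
    qed
    finally show ?thesis by (simp only: sum_distrib_left)
  qed
  also have "\<dots> = 0"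
  proof (rule sum.neutral, rule ballI)
    fix \<tau> assume "\<tau> \<in> perms d"
    then have t: "\<tau> permutes {1..d}" by simp
    show "h \<tau> * (\<Sum>xs\<in>spread_lists {1..d} \<tau> (Suc a). ?w (cycle_of_list xs \<circ> \<tau>)) = 0"
    proof (cases "\<tau> = id \<or> perm_norm d \<tau> + a \<noteq> n")
      case True
      then show ?thesis
        using assms(3) perm_norm_spread[OF _ t, of _ a] by (auto intro!: sum.neutral)
    next
      case False
      then have n: "n = perm_norm d \<tau> + a" and id: "\<tau> \<noteq> id" by auto
      \<comment> \<open>Nontrivial orbits have at least two points, so \<open>d - 2 (n - a)\<close> points at least are fixed.\<close>
      have "card (trivial_orbits {1..d} \<tau>) > a"
      proof -
        have "2 * card (nontrivial_orbits {1..d} \<tau>) + card (trivial_orbits {1..d} \<tau>) \<le> d"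
        proof -
          note fo = finite_orbits_split[of "{1..d}" \<tau>]
          have "(\<Sum>P\<in>nontrivial_orbits {1..d} \<tau>. 2) \<le> (\<Sum>P\<in>nontrivial_orbits {1..d} \<tau>. card P)"
          proof (rule sum_mono)
            fix P assume "P \<in> nontrivial_orbits {1..d} \<tau>"
            then show "2 \<le> card P"
              using card_orbit_pos[OF finite_atLeastAtMost t, of P]
              by (auto simp: nontrivial_orbits_def)
          qed
          moreover have "(\<Sum>P\<in>trivial_orbits {1..d} \<tau>. card P) = card (trivial_orbits {1..d} \<tau>)"
            by (simp add: trivial_orbits_def)
          moreover have "(\<Sum>P\<in>orbits {1..d} \<tau>. card P) =
              (\<Sum>P\<in>nontrivial_orbits {1..d} \<tau>. card P) + (\<Sum>P\<in>trivial_orbits {1..d} \<tau>. card P)"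
            by (subst orbits_split(1), rule sum.union_disjoint) (use fo orbits_split(2) in auto)
          ultimately show ?thesis using sum_card_orbits[OF finite_atLeastAtMost t] by simp
        qed
        then show ?thesis using orbit_numbers[OF t] n assms(1,2) by linarith
      qed
      then have "(\<Sum>xs\<in>spread_lists {1..d} \<tau> (Suc a). perm_weight d n (cycle_of_list xs \<circ> \<tau>)) = 0"
        unfolding n using sum_perm_weight_eq_0[OF t id assms(1)] by blast
      moreover have "(\<Sum>xs\<in>spread_lists {1..d} \<tau> (Suc a). ?w (cycle_of_list xs \<circ> \<tau>)) =
          (\<Sum>xs\<in>spread_lists {1..d} \<tau> (Suc a). perm_weight d n (cycle_of_list xs \<circ> \<tau>))"
        using perm_norm_spread[OF _ t, of _ a] n by (intro sum.cong refl) simp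
      ultimately show ?thesis by simp
    qed
  qed
  finally show ?thesis .
qed

section \<open>Congruences modulo products with cycle sums\<close>

definition standard_cycle :: "nat \<Rightarrow> nat \<Rightarrow> nat" where
  "standard_cycle n = cycle_of_list [1..<n + 2]"

text \<open>Scaled such that \<open>cycle_functional d n\<close> is \<open>1\<close> on it for \<open>n < d\<close>.\<close>

definition standard_element :: "nat \<Rightarrow> nat \<Rightarrow> (nat \<Rightarrow> nat) \<Rightarrow> rat" where
  "standard_element d n =
    (\<lambda>\<rho>. conj_sum d (standard_cycle n) \<rho> / (fact d * perm_weight d n (standard_cycle n)))"

lemma standard_list_spread: "n < d \<Longrightarrow> [1..<n + 2] \<in> spread_lists {1..d} id (Suc n)"
  by (auto simp: spread_lists_id)

lemma standard_cycle_permutes: "n < d \<Longrightarrow> standard_cycle n permutes {1..d}"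
  unfolding standard_cycle_def by (rule spread_list_cycle_permutes[OF standard_list_spread])

lemma perm_norm_standard_cycle: "n < d \<Longrightarrow> perm_norm d (standard_cycle n) = n"
  unfolding standard_cycle_def
  by (subst perm_norm_cycle) auto

lemma conj_sum_id:
  assumes t: "\<tau> permutes {1..d}" and "\<tau> \<noteq> id"
  shows "conj_sum d \<tau> id = 0"
  unfolding conj_sum_def
proof (rule sum.neutral, rule ballI)
  fix \<pi> assume "\<pi> \<in> perms d"
  then have "\<pi> \<circ> \<tau> \<circ> inv' \<pi> \<noteq> id"
    using perm_norm_conjugate[of \<pi> d \<tau>, OF _ t] perm_norm_eq_0_iff[OF t] assms(2) by auto
  then show "perm_basis (\<pi> \<circ> \<tau> \<circ> inv' \<pi>) id = 0" by (auto simp: perm_basis_def)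
qed

text \<open>Subspaces that contain all products of a cycle sum of positive norm with an element of the
  augmentation ideal. The congruences below are used for three of them: the square of the
  augmentation ideal, the span of all products with cycle sums, and the space of elements whose
  component of a fixed norm lies in a given subalgebra.\<close>

locale cycle_closed =
  fixes d :: nat and V :: "((nat \<Rightarrow> nat) \<Rightarrow> rat) set"
  assumes V_add: "f \<in> V \<Longrightarrow> g \<in> V \<Longrightarrow> (\<lambda>\<rho>. f \<rho> + g \<rho>) \<in> V"
    and V_scale: "f \<in> V \<Longrightarrow> (\<lambda>\<rho>. c * f \<rho>) \<in> V"
    and V_cycle_mult: "a \<ge> 1 \<Longrightarrow> h \<in> carrier (hilb_algebra d) \<Longrightarrow> h id = 0 \<Longrightarrow>
      grad_mult d (cycle_sum d a) h \<in> V"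
begin

lemma V_zero: "(\<lambda>_. 0) \<in> V"
  using V_scale[OF V_cycle_mult[OF order.refl hilb_zero_closed refl], of 0] by simp

lemma V_sum:
  assumes "\<And>i. i \<in> I \<Longrightarrow> f i \<in> V"
  shows "(\<lambda>\<rho>. \<Sum>i\<in>I. f i \<rho>) \<in> V"
proof (cases "finite I")
  case True
  then show ?thesis using assms
  proof (induct I)
    case empty
    show "(\<lambda>\<rho>. \<Sum>i\<in>{}. f i \<rho>) \<in> V" using V_zero by simp
  next
    case (insert i I)
    have "(\<lambda>\<rho>. f i \<rho> + (\<Sum>i\<in>I. f i \<rho>)) \<in> V"
      by (rule V_add) (use insert in auto)
    then show "(\<lambda>\<rho>. \<Sum>i\<in>insert i I. f i \<rho>) \<in> V" using insert by simp
  qed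
qed (use V_zero in simp)

lemma V_diff: "f \<in> V \<Longrightarrow> g \<in> V \<Longrightarrow> (\<lambda>\<rho>. f \<rho> - g \<rho>) \<in> V"
  using V_add[OF _ V_scale[of g "-1"], of f] by simp

text \<open>Induction on the number of nontrivial orbits. Write \<open>\<sigma>\<close> as a cycle on fixed points of \<open>\<tau>\<close> times
  \<open>\<tau>\<close>, and expand the product of a cycle sum with \<open>conj_sum d \<tau>\<close>. As the weights of the terms add
  up to zero, the sum of the claimed differences over all terms is in \<open>V\<close>. For the lists of
  fixed points of \<open>\<tau>\<close> the difference is the one for \<open>\<sigma>\<close>; all other terms have fewer nontrivial
  orbits than \<open>\<sigma>\<close> and are covered by the induction hypothesis. If \<open>\<tau> = id\<close>, then \<open>\<sigma>\<close> is
  conjugate to the standard cycle.\<close>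

lemma conj_sum_mod:
  assumes "\<sigma> permutes {1..d}" "\<sigma> \<noteq> id" "perm_norm d \<sigma> = n"
  shows "(\<lambda>\<rho>. conj_sum d \<sigma> \<rho> - perm_weight d n \<sigma> * fact d * standard_element d n \<rho>) \<in> V"
  using assms
proof (induct "card (nontrivial_orbits {1..d} \<sigma>)" arbitrary: \<sigma> rule: less_induct)
  case less
  let ?A = "{1..d}"
  let ?R = "\<lambda>\<sigma> \<rho>. conj_sum d \<sigma> \<rho> - perm_weight d n \<sigma> * fact d * standard_element d n \<rho>"
  have s: "\<sigma> permutes ?A" by fact
  obtain xs \<tau> where t: "\<tau> permutes ?A" and st: "\<sigma> = cycle_of_list xs \<circ> \<tau>"
    and xs: "distinct xs" "length xs \<ge> 2" "set xs \<subseteq> {x \<in> ?A. \<tau> x = x}"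
    by (rule split_off_cycle[OF s finite_atLeastAtMost less(3)])
  obtain a where a: "length xs = Suc a" "a \<ge> 1" using xs(2) by (cases "length xs") auto
  have xsp: "xs \<in> spread_lists ?A \<tau> (Suc a)" using fixed_point_lists_spread(1)[OF xs(1,3)] a by simp
  have nt: "n = perm_norm d \<tau> + a" using perm_norm_spread[OF xsp t] less(4) st by simp
  have same: "conj_sum d (cycle_of_list ys \<circ> \<tau>) = conj_sum d \<sigma>"
    "perm_weight d n (cycle_of_list ys \<circ> \<tau>) = perm_weight d n \<sigma>"
    if ys: "distinct ys" "length ys = Suc a" "set ys \<subseteq> {x \<in> ?A. \<tau> x = x}" for ys
  proof -
    obtain \<pi> where p: "\<pi> permutes ?A" and e: "\<pi> \<circ> (cycle_of_list xs \<circ> \<tau>) \<circ> inv' \<pi> = cycle_of_list ys \<circ> \<tau>"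
      using cycle_comp_conjugate[OF t finite_atLeastAtMost xs(1,3) ys(1,3)] a(1) ys(2) by metis
    show "conj_sum d (cycle_of_list ys \<circ> \<tau>) = conj_sum d \<sigma>"
      unfolding e[symmetric] st by (rule conj_sum_conjugate[OF p])
    show "perm_weight d n (cycle_of_list ys \<circ> \<tau>) = perm_weight d n \<sigma>"
      unfolding e[symmetric] st[symmetric] by (rule perm_weight_conjugate[OF p s])
  qed
  show ?case
  proof (cases "\<tau> = id")
    case True
    then have na: "n = a" using nt by simp
    have l: "length xs \<le> d"
      using xs card_mono[of ?A "set xs"] distinct_card[OF xs(1)] by force
    then have nd: "n < d" using a na by simp
    have std: "standard_cycle n = cycle_of_list [1..<n + 2] \<circ> \<tau>"
      unfolding True standard_cycle_def by simp
    have "conj_sum d (standard_cycle n) = conj_sum d \<sigma>"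
      "perm_weight d n (standard_cycle n) = perm_weight d n \<sigma>"
      unfolding std by (rule same; use nd na True in auto)+
    then have "?R \<sigma> = (\<lambda>_. 0)"
      unfolding standard_element_def using perm_weight_neq_0[OF s, of n] by (simp add: fun_eq_iff)
    then show ?thesis using V_zero by simp
  next
    case False
    define L where "L = spread_lists ?A \<tau> (Suc a)"
    \<comment> \<open>the lists whose terms are conjugate to \<open>\<sigma>\<close>\<close>
    define L0 where "L0 = {ys \<in> L. set ys \<subseteq> {x \<in> ?A. \<tau> x = x}}"
    have finL: "finite L" unfolding L_def by (rule finite_spread_lists) simp
    have xsL0: "xs \<in> L0" using xsp xs(3) by (simp add: L0_def L_def)
    have au: "a < card (trivial_orbits ?A \<tau>)"
    proof -
      have "card (set xs) \<le> card {x \<in> ?A. \<tau> x = x}" using xs(3) by (intro card_mono) auto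
      then show ?thesis
        using card_trivial_orbits[OF finite_atLeastAtMost t] distinct_card[OF xs(1)] a(1) by simp
    qed
    have w0: "(\<Sum>ys\<in>L. perm_weight d n (cycle_of_list ys \<circ> \<tau>)) = 0"
      unfolding L_def nt by (rule sum_perm_weight_eq_0[OF t False a(2) au])
    have idt: "conj_sum d \<tau> id = 0" by (rule conj_sum_id[OF t False])
    have total: "(\<lambda>\<rho>. \<Sum>ys\<in>L. ?R (cycle_of_list ys \<circ> \<tau>) \<rho>) \<in> V"
    proof -
      have "(\<Sum>ys\<in>L. ?R (cycle_of_list ys \<circ> \<tau>) \<rho>) =
          grad_mult d (cycle_sum d a) (conj_sum d \<tau>) \<rho>" for \<rho>
        unfolding cycle_sum_mult_conj_sum[OF t] sum_subtractf sum_distrib_right[symmetric] w0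
        by (simp add: L_def)
      then show ?thesis using V_cycle_mult[OF a(2) conj_sum_carrier[OF t] idt] by simp
    qed
    have rest: "(\<lambda>\<rho>. \<Sum>ys\<in>L - L0. ?R (cycle_of_list ys \<circ> \<tau>) \<rho>) \<in> V"
    proof (rule V_sum)
      fix ys assume ys: "ys \<in> L - L0"
      then have ysp: "ys \<in> spread_lists ?A \<tau> (Suc a)" by (simp add: L_def)
      note m = orbits_spread_merge[OF finite_atLeastAtMost t ysp a(2)]
      have yA: "set ys \<subseteq> ?A" using ysp by (simp only: spread_lists_def mem_Collect_eq)
      then obtain y where y: "y \<in> set ys" "\<tau> y \<noteq> y" using ys by (auto simp: L0_def)
      let ?B = "nontrivial_orbits ?A \<tau>" and ?S = "orbit \<tau> ` set ys"
      have oy: "orbit \<tau> y \<in> ?B"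
      proof -
        have "orbit \<tau> y \<noteq> {z}" for z
          using y(2) self_in_orbit[OF finite_atLeastAtMost t, of y] orbit.base[of \<tau> y] by auto
        then have "card (orbit \<tau> y) \<noteq> 1" by (auto simp: card_1_singleton_iff)
        then show ?thesis using y(1) yA by (auto simp: nontrivial_orbits_def orbits_def)
      qed
      have fB: "finite ?B" by (rule finite_orbits_split) simp
      have "card (?B - ?S) < card ?B"
        using oy y(1) fB by (intro psubset_card_mono) auto
      then have "card (nontrivial_orbits ?A (cycle_of_list ys \<circ> \<tau>)) \<le> card ?B"
        unfolding m(6) using fB by (simp add: card_insert_if)
      moreover have "card (nontrivial_orbits ?A \<sigma>) = card ?B + 1"
        unfolding st by (rule orbit_counts_join_fixed_points(1)[OF finite_atLeastAtMost t xs(1,3,2)])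
      ultimately have c: "card (nontrivial_orbits ?A (cycle_of_list ys \<circ> \<tau>)) <
          card (nontrivial_orbits ?A \<sigma>)" by simp
      have p: "cycle_of_list ys \<circ> \<tau> permutes ?A" by (rule spread_lists_cycle_permutes[OF ysp t])
      have pn: "perm_norm d (cycle_of_list ys \<circ> \<tau>) = n" unfolding nt by (rule perm_norm_spread[OF ysp t])
      have "cycle_of_list ys \<circ> \<tau> \<noteq> id"
        using pn nt a(2) perm_norm_eq_0_iff[OF p] by linarith
      then show "?R (cycle_of_list ys \<circ> \<tau>) \<in> V" by (rule less(1)[OF c p _ pn])
    qed
    have "of_nat (card L0) * ?R \<sigma> \<rho> = (\<Sum>ys\<in>L0. ?R (cycle_of_list ys \<circ> \<tau>) \<rho>)" for \<rho>
    proof -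
      have "?R (cycle_of_list ys \<circ> \<tau>) \<rho> = ?R \<sigma> \<rho>" if "ys \<in> L0" for ys
      proof -
        have "length ys = Suc a" "distinct ys" "set ys \<subseteq> {x \<in> ?A. \<tau> x = x}"
          using that by (auto simp: L0_def L_def spread_lists_def distinct_map)
        then show ?thesis using same[of ys] by simp
      qed
      then show ?thesis by simp
    qed
    moreover have "(\<Sum>ys\<in>L0. ?R (cycle_of_list ys \<circ> \<tau>) \<rho>) =
        (\<Sum>ys\<in>L. ?R (cycle_of_list ys \<circ> \<tau>) \<rho>) - (\<Sum>ys\<in>L - L0. ?R (cycle_of_list ys \<circ> \<tau>) \<rho>)" for \<rho>
      using sum.subset_diff[of L0 L "\<lambda>ys. ?R (cycle_of_list ys \<circ> \<tau>) \<rho>"] finL by (simp add: L0_def)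
    ultimately have "(\<lambda>\<rho>. of_nat (card L0) * ?R \<sigma> \<rho>) \<in> V" using V_diff[OF total rest] by simp
    then have "(\<lambda>\<rho>. 1 / of_nat (card L0) * (of_nat (card L0) * ?R \<sigma> \<rho>)) \<in> V" by (rule V_scale)
    moreover have "card L0 \<noteq> 0" using xsL0 finL by (auto simp: L0_def)
    ultimately show ?thesis by simp
  qed
qed

lemma component_mod:
  assumes f: "f \<in> hilb_component d n" and n: "n \<ge> 1"
  shows "(\<lambda>\<rho>. f \<rho> - cycle_functional d n f * standard_element d n \<rho>) \<in> V"
proof -
  let ?R = "\<lambda>\<sigma> \<rho>. conj_sum d \<sigma> \<rho> - perm_weight d n \<sigma> * fact d * standard_element d n \<rho>"
  have fc: "f \<in> carrier (hilb_algebra d)" and fn: "\<And>\<sigma>. f \<sigma> \<noteq> 0 \<Longrightarrow> perm_norm d \<sigma> = n"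
    using f by (auto simp: hilb_component_def)
  have "(\<lambda>\<rho>. \<Sum>\<sigma>\<in>perms d. f \<sigma> * ?R \<sigma> \<rho>) \<in> V"
  proof (rule V_sum)
    fix \<sigma> assume s: "\<sigma> \<in> perms d"
    show "(\<lambda>\<rho>. f \<sigma> * ?R \<sigma> \<rho>) \<in> V"
    proof (cases "f \<sigma> = 0")
      case True
      then show ?thesis using V_zero by simp
    next
      case False
      then have "perm_norm d \<sigma> = n" by (rule fn)
      moreover from this have "\<sigma> \<noteq> id" using n by auto
      ultimately show ?thesis using s by (intro V_scale conj_sum_mod) auto
    qed
  qed
  then have "(\<lambda>\<rho>. 1 / fact d * (\<Sum>\<sigma>\<in>perms d. f \<sigma> * ?R \<sigma> \<rho>)) \<in> V" by (rule V_scale)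
  moreover have "1 / fact d * (\<Sum>\<sigma>\<in>perms d. f \<sigma> * ?R \<sigma> \<rho>) =
      f \<rho> - cycle_functional d n f * standard_element d n \<rho>" for \<rho>
  proof -
    have "cycle_functional d n f = (\<Sum>\<sigma>\<in>perms d. f \<sigma> * perm_weight d n \<sigma>)"
      unfolding cycle_functional_def using fn by (intro sum.cong refl) auto
    then have "(\<Sum>\<sigma>\<in>perms d. f \<sigma> * ?R \<sigma> \<rho>) =
        fact d * f \<rho> - fact d * (cycle_functional d n f * standard_element d n \<rho>)"
      unfolding hilb_eq_conj_sums[OF fc]
      by (simp add: right_diff_distrib sum_subtractf sum_distrib_left sum_distrib_right mult_ac)
    then show ?thesis by (simp add: diff_divide_distrib)
  qed
  ultimately show ?thesis by simp
qed

lemma component_mem: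
  assumes f: "f \<in> hilb_component d n" and n: "n \<ge> 1" and d: "d \<ge> 1"
    and std: "n < d \<Longrightarrow> standard_element d n \<in> V"
  shows "f \<in> V"
proof (cases "n < d")
  case True
  have "(\<lambda>\<rho>. (f \<rho> - cycle_functional d n f * standard_element d n \<rho>) +
      cycle_functional d n f * standard_element d n \<rho>) \<in> V"
    by (intro V_add V_scale component_mod[OF f n] std[OF True])
  then show ?thesis by simp
next
  case False
  have "f \<sigma> = 0" for \<sigma>
    using f False perm_norm_less[OF _ d, of \<sigma>] hilb_support[of f d \<sigma>]
    by (cases "\<sigma> permutes {1..d}") (auto simp: hilb_component_def)
  then have "f = (\<lambda>_. 0)" by auto
  then show ?thesis using V_zero by simp
qed

text \<open>For a \<open>\<tau>\<close> with a single fixed point and norm \<open>n - 1\<close> the weights do not add up to zero, so the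
  expansion of the product with \<open>conj_sum d \<tau>\<close> gives a nonzero multiple of the standard element.\<close>

lemma standard_element_mem:
  assumes "d < 2 * n" "n < d"
  shows "standard_element d n \<in> V"
proof -
  let ?R = "\<lambda>\<sigma> \<rho>. conj_sum d \<sigma> \<rho> - perm_weight d n \<sigma> * fact d * standard_element d n \<rho>"
  have le: "2 * (d - n) + 1 \<le> d" and pos: "d - n = 0 \<Longrightarrow> 1 = d" using assms by auto
  obtain \<tau> where t: "\<tau> permutes {1..d}" "card (nontrivial_orbits {1..d} \<tau>) = d - n"
    "card (trivial_orbits {1..d} \<tau>) = 1"
    using exists_perm_with_orbit_counts[OF le pos] by blast
  have nt: "n = perm_norm d \<tau> + 1" using orbit_numbers[OF t(1)] t(2,3) assms by simp
  have id: "\<tau> \<noteq> id" using nt assms by auto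
  define L where "L = spread_lists {1..d} \<tau> 2"
  have idt: "conj_sum d \<tau> id = 0" by (rule conj_sum_id[OF t(1) id])
  define w where "w = (\<Sum>ys\<in>L. perm_weight d n (cycle_of_list ys \<circ> \<tau>))"
  have w: "w \<noteq> 0" unfolding w_def L_def nt by (rule sum_perm_weight_neq_0[OF t(1) id t(3)])
  have "(\<lambda>\<rho>. \<Sum>ys\<in>L. ?R (cycle_of_list ys \<circ> \<tau>) \<rho>) \<in> V"
  proof (rule V_sum)
    fix ys assume "ys \<in> L"
    then have ysp: "ys \<in> spread_lists {1..d} \<tau> (Suc 1)" by (simp add: L_def numeral_2_eq_2)
    have p: "cycle_of_list ys \<circ> \<tau> permutes {1..d}" by (rule spread_lists_cycle_permutes[OF ysp t(1)])
    have pn: "perm_norm d (cycle_of_list ys \<circ> \<tau>) = n" unfolding nt by (rule perm_norm_spread[OF ysp t(1)])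
    have "cycle_of_list ys \<circ> \<tau> \<noteq> id" using pn nt perm_norm_eq_0_iff[OF p] by linarith
    then show "?R (cycle_of_list ys \<circ> \<tau>) \<in> V" by (rule conj_sum_mod[OF p _ pn])
  qed
  then have "(\<lambda>\<rho>. grad_mult d (cycle_sum d 1) (conj_sum d \<tau>) \<rho> -
      (\<Sum>ys\<in>L. ?R (cycle_of_list ys \<circ> \<tau>) \<rho>)) \<in> V"
    by (rule V_diff[OF V_cycle_mult[OF order.refl conj_sum_carrier[OF t(1)] idt]])
  moreover have "(\<Sum>ys\<in>L. ?R (cycle_of_list ys \<circ> \<tau>) \<rho>) =
      grad_mult d (cycle_sum d 1) (conj_sum d \<tau>) \<rho> - w * fact d * standard_element d n \<rho>" for \<rho>
    unfolding cycle_sum_mult_conj_sum[OF t(1)] sum_subtractf sum_distrib_right[symmetric] w_def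
    by (simp add: L_def numeral_2_eq_2)
  ultimately have "(\<lambda>\<rho>. w * fact d * standard_element d n \<rho>) \<in> V" by simp
  then have "(\<lambda>\<rho>. 1 / (w * fact d) * (w * fact d * standard_element d n \<rho>)) \<in> V" by (rule V_scale)
  then show ?thesis using w by simp
qed

end

section \<open>Quotients of vector spaces with one generator\<close>

lemma quotient_module_simps:
  "zero (quotient_module M I) = I"
  "add (quotient_module M I) = set_add M"
  "smult (quotient_module M I) = (\<lambda>c X. \<Union>x\<in>X. I +>\<^bsub>M\<^esub> (c \<odot>\<^bsub>M\<^esub> x))"
  by (simp_all add: quotient_module_def ring.extend_def FactRing_def)

lemma submodule_imp_abelian_subgroup:
  fixes M (structure)
  assumes "Module.module K M" "submodule K I M"
  shows "abelian_subgroup I M"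
proof -
  interpret Module.module K M by fact
  interpret I: submodule K I M by fact
  show ?thesis
  proof (rule abelian_subgroupI3)
    show "additive_subgroup I M"
    proof (rule additive_subgroup.intro)
      show "subgroup I (add_monoid M)"
      proof
        show "I \<subseteq> carrier (add_monoid M)" using I.subset by simp
        show "x \<otimes>\<^bsub>add_monoid M\<^esub> y \<in> I" if "x \<in> I" "y \<in> I" for x y using that by simp
        show "\<one>\<^bsub>add_monoid M\<^esub> \<in> I" by simp
        fix x assume x: "x \<in> I"
        then have xM: "x \<in> carrier M" using I.subset by blast
        have "(\<ominus>\<^bsub>K\<^esub> \<one>\<^bsub>K\<^esub>) \<odot> x \<in> I" using x by (intro I.smult_closed) auto
        then have "\<ominus> x \<in> I" using smult_l_minus[of "\<one>\<^bsub>K\<^esub>" x] xM by simp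
        then show "inv\<^bsub>add_monoid M\<^esub> x \<in> I" by (simp add: a_inv_def)
      qed
    qed
    show "abelian_group M" ..
  qed
qed

lemma quotient_smult:
  fixes M (structure)
  assumes "Module.module K M" "submodule K I M" "c \<in> carrier K" "x \<in> carrier M"
  shows "c \<odot>\<^bsub>quotient_module M I\<^esub> (I +> x) = I +> (c \<odot> x)"
proof -
  interpret Module.module K M by fact
  interpret I: submodule K I M by fact
  interpret abelian_subgroup I M by (rule submodule_imp_abelian_subgroup[OF assms(1,2)])
  have "I +> (c \<odot> y) = I +> (c \<odot> x)" if y: "y \<in> I +> x" for y
  proof -
    obtain h where h: "h \<in> I" "y = h \<oplus> x" using y by (auto simp: a_r_coset_def')
    then have hM: "h \<in> carrier M" using I.subset by blast
    have "c \<odot> y = c \<odot> h \<oplus> c \<odot> x" using h hM assms by (simp add: smult_r_distr)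
    moreover have "c \<odot> h \<in> I" using h assms(3) by simp
    ultimately have "c \<odot> y \<in> I +> (c \<odot> x)" by (auto simp: a_r_coset_def')
    then show ?thesis
      using a_repr_independence[of "c \<odot> y" I "c \<odot> x"] assms a_subgroup by simp
  qed
  moreover have "x \<in> I +> x" by (rule a_rcos_self[OF assms(4)])
  ultimately show ?thesis unfolding quotient_module_simps by blast
qed

lemma quotient_vectorspace:
  fixes M (structure)
  assumes "vectorspace K M" and I: "submodule K I M" and X: "submodule K X M"
  shows "vectorspace K ((quotient_module M I)\<lparr>carrier := {I +> x | x. x \<in> X}\<rparr>)" (is "vectorspace K ?Q")
proof -
  interpret vectorspace K M by fact
  interpret I: submodule K I M by fact
  interpret X: submodule K X M by fact
  have mod: "Module.module K M" ..
  interpret abelian_subgroup I M by (rule submodule_imp_abelian_subgroup[OF mod I])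
  interpret XS: abelian_subgroup X M by (rule submodule_imp_abelian_subgroup[OF mod X])
  have XM: "x \<in> carrier M" if "x \<in> X" for x using that X.subset by blast
  have sum: "(I +> x) <+> (I +> y) = I +> (x \<oplus> y)" if "x \<in> X" "y \<in> X" for x y
    using a_rcos_sum[of x y] that XM by blast
  have sm: "c \<odot>\<^bsub>quotient_module M I\<^esub> (I +> x) = I +> (c \<odot> x)" if "c \<in> carrier K" "x \<in> X" for c x
    by (rule quotient_smult[OF mod I that(1) XM[OF that(2)]])
  have z: "I = I +> \<zero>" using I.subset by simp
  have ag: "abelian_group ?Q"
  proof (rule abelian_groupI)
    show "x \<oplus>\<^bsub>?Q\<^esub> y \<in> carrier ?Q" if "x \<in> carrier ?Q" "y \<in> carrier ?Q" for x y
      using that X.m_closed by (auto simp: quotient_module_simps sum)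
    show "\<zero>\<^bsub>?Q\<^esub> \<in> carrier ?Q"
      using z X.zero_closed by (auto simp: quotient_module_simps)
    show "x \<oplus>\<^bsub>?Q\<^esub> y \<oplus>\<^bsub>?Q\<^esub> w = x \<oplus>\<^bsub>?Q\<^esub> (y \<oplus>\<^bsub>?Q\<^esub> w)"
      if "x \<in> carrier ?Q" "y \<in> carrier ?Q" "w \<in> carrier ?Q" for x y w
      using that XM by (auto simp: quotient_module_simps sum a_assoc)
    show "x \<oplus>\<^bsub>?Q\<^esub> y = y \<oplus>\<^bsub>?Q\<^esub> x" if "x \<in> carrier ?Q" "y \<in> carrier ?Q" for x y
      using that XM by (auto simp: quotient_module_simps sum a_comm)
    show "\<zero>\<^bsub>?Q\<^esub> \<oplus>\<^bsub>?Q\<^esub> x = x" if xQ: "x \<in> carrier ?Q" for x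
    proof -
      obtain y where y: "y \<in> X" "x = I +> y" using xQ by auto
      have "(I +> \<zero>) <+> (I +> y) = I +> (\<zero> \<oplus> y)" by (rule sum) (use y in auto)
      then show ?thesis using y XM z by (simp add: quotient_module_simps)
    qed
    show "\<exists>y\<in>carrier ?Q. y \<oplus>\<^bsub>?Q\<^esub> x = \<zero>\<^bsub>?Q\<^esub>" if xQ: "x \<in> carrier ?Q" for x
    proof -
      obtain y where y: "y \<in> X" "x = I +> y" using xQ by auto
      have my: "\<ominus> y \<in> X" by (rule XS.a_inv_closed[OF y(1)])
      have "(I +> \<ominus> y) <+> (I +> y) = I +> (\<ominus> y \<oplus> y)" by (rule sum[OF my y(1)])
      also have "\<dots> = I" using XM[OF y(1)] z by (simp add: l_neg)
      finally show ?thesis using y my by (auto simp: quotient_module_simps)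
    qed
  qed
  have smQ: "c \<odot>\<^bsub>?Q\<^esub> (I +> x) = I +> (c \<odot> x)" if "c \<in> carrier K" "x \<in> X" for c x
    using sm[OF that] by simp
  have addQ: "(I +> x) \<oplus>\<^bsub>?Q\<^esub> (I +> y) = I +> (x \<oplus> y)" if "x \<in> X" "y \<in> X" for x y
    using sum[OF that] by (simp add: quotient_module_simps)
  have obt: "\<exists>x\<in>X. q = I +> x" if "q \<in> carrier ?Q" for q using that by auto
  have "Module.module K ?Q"
  proof (rule moduleI)
    show "cring K" ..
    show "abelian_group ?Q" by (rule ag)
  next
    fix c q assume c: "c \<in> carrier K" and "q \<in> carrier ?Q"
    then obtain x where x: "x \<in> X" "q = I +> x" using obt by blast
    show "c \<odot>\<^bsub>?Q\<^esub> q \<in> carrier ?Q"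
      unfolding x(2) smQ[OF c x(1)] using X.smult_closed[OF c x(1)] by auto
  next
    fix a b q assume ab: "a \<in> carrier K" "b \<in> carrier K" and "q \<in> carrier ?Q"
    then obtain x where x: "x \<in> X" "q = I +> x" using obt by blast
    show "(a \<oplus>\<^bsub>K\<^esub> b) \<odot>\<^bsub>?Q\<^esub> q = a \<odot>\<^bsub>?Q\<^esub> q \<oplus>\<^bsub>?Q\<^esub> b \<odot>\<^bsub>?Q\<^esub> q"
      unfolding x(2) smQ[OF ab(1) x(1)] smQ[OF ab(2) x(1)]
        addQ[OF X.smult_closed[OF ab(1) x(1)] X.smult_closed[OF ab(2) x(1)]]
      using smQ[of "a \<oplus>\<^bsub>K\<^esub> b" x] ab x(1) XM[OF x(1)] by (simp add: smult_l_distr)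
    show "(a \<otimes>\<^bsub>K\<^esub> b) \<odot>\<^bsub>?Q\<^esub> q = a \<odot>\<^bsub>?Q\<^esub> (b \<odot>\<^bsub>?Q\<^esub> q)"
      unfolding x(2) smQ[OF ab(2) x(1)] smQ[OF ab(1) X.smult_closed[OF ab(2) x(1)]]
      using smQ[of "a \<otimes>\<^bsub>K\<^esub> b" x] ab x(1) XM[OF x(1)] by (simp add: smult_assoc1)
  next
    fix a p q assume a: "a \<in> carrier K" and "p \<in> carrier ?Q" "q \<in> carrier ?Q"
    then obtain x y where x: "x \<in> X" "p = I +> x" and y: "y \<in> X" "q = I +> y" using obt by blast
    show "a \<odot>\<^bsub>?Q\<^esub> (p \<oplus>\<^bsub>?Q\<^esub> q) = a \<odot>\<^bsub>?Q\<^esub> p \<oplus>\<^bsub>?Q\<^esub> a \<odot>\<^bsub>?Q\<^esub> q"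
      unfolding x(2) y(2) addQ[OF x(1) y(1)] smQ[OF a x(1)] smQ[OF a y(1)]
        addQ[OF X.smult_closed[OF a x(1)] X.smult_closed[OF a y(1)]]
        smQ[OF a X.m_closed[OF x(1) y(1)]]
      using a XM x(1) y(1) by (simp add: smult_r_distr)
  next
    fix q assume "q \<in> carrier ?Q"
    then obtain x where x: "x \<in> X" "q = I +> x" using obt by blast
    show "\<one>\<^bsub>K\<^esub> \<odot>\<^bsub>?Q\<^esub> q = q"
      unfolding x(2) using smQ[of "\<one>\<^bsub>K\<^esub>" x] x(1) XM[OF x(1)] by simp
  qed
  then show ?thesis
    by (rule vectorspace.intro) (rule field_axioms)
qed

text \<open>Every class is a multiple of the class of \<open>e\<close>, which vanishes if and only if \<open>e\<close> is in \<open>I\<close>.\<close>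

lemma dim_quotient_one_generator:
  fixes M (structure)
  assumes "vectorspace K M" and I: "submodule K I M" and X: "submodule K X M" and e: "e \<in> X"
    and gen: "\<And>x. x \<in> X \<Longrightarrow> \<exists>c\<in>carrier K. x \<in> I +> (c \<odot> e)"
  defines "Q \<equiv> (quotient_module M I)\<lparr>carrier := {I +> x | x. x \<in> X}\<rparr>"
  shows "vectorspace.fin_dim K Q" and "vectorspace.dim K Q = (if e \<in> I then 0 else 1)"
proof -
  interpret vectorspace K M by fact
  interpret I: submodule K I M by fact
  interpret X: submodule K X M by fact
  have mod: "Module.module K M" ..
  interpret abelian_subgroup I M by (rule submodule_imp_abelian_subgroup[OF mod I])
  interpret Q: vectorspace K Q unfolding Q_def by (rule quotient_vectorspace[OF assms(1) I X])
  have XM: "x \<in> carrier M" if "x \<in> X" for x using that X.subset by blast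
  have eQ: "I +> e \<in> carrier Q" using e by (auto simp: Q_def)
  have zQ: "\<zero>\<^bsub>Q\<^esub> = I" by (simp add: Q_def quotient_module_simps)
  have gs: "Q.gen_set {I +> e}"
  proof
    show "Q.span {I +> e} \<subseteq> carrier Q" by (rule Q.span_is_subset2) (use eQ in simp)
    show "carrier Q \<subseteq> Q.span {I +> e}"
    proof
      fix q assume "q \<in> carrier Q"
      then obtain x where x: "x \<in> X" "q = I +> x" by (auto simp: Q_def)
      obtain c where c: "c \<in> carrier K" "x \<in> I +> (c \<odot> e)" using gen[OF x(1)] by blast
      have "I +> (c \<odot> e) = I +> x"
        by (rule a_repr_independence[OF c(2) _ a_subgroup]) (use c(1) XM[OF e] in simp)
      then have "q = c \<odot>\<^bsub>Q\<^esub> (I +> e)"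
        using quotient_smult[OF mod I c(1) XM[OF e]] x(2) by (simp add: Q_def)
      moreover have "I +> e \<in> Q.span {I +> e}" using Q.in_own_span[of "{I +> e}"] eQ by simp
      moreover have "submodule K (Q.span {I +> e}) Q" by (rule Q.span_is_submodule) (use eQ in simp)
      ultimately show "q \<in> Q.span {I +> e}" using submodule.smult_closed c(1) by metis
    qed
  qed
  show "Q.fin_dim" unfolding Q.fin_dim_def using gs eQ by (intro exI[of _ "{I +> e}"]) simp
  have eI: "I +> e = I \<longleftrightarrow> e \<in> I"
    using a_coset_join1[OF _ XM[OF e] a_subgroup] a_coset_join2[OF XM[OF e] a_subgroup] by blast
  show "Q.dim = (if e \<in> I then 0 else 1)"
  proof (cases "e \<in> I")
    case True
    then show ?thesis using Q.dim0I gs eI zQ by simp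
  next
    case False
    then show ?thesis using Q.dim1I[OF gs _ eQ] eI zQ by simp
  qed
qed

section \<open>The norm parts of the algebra\<close>

definition norm_part :: "nat \<Rightarrow> nat \<Rightarrow> ((nat \<Rightarrow> nat) \<Rightarrow> rat) \<Rightarrow> (nat \<Rightarrow> nat) \<Rightarrow> rat" where
  "norm_part d j f = (\<lambda>\<sigma>. if perm_norm d \<sigma> = j then f \<sigma> else 0)"

lemma norm_part_mem:
  assumes f: "f \<in> carrier (hilb_algebra d)"
  shows "norm_part d j f \<in> hilb_component d j"
proof -
  have "norm_part d j f \<in> carrier (hilb_algebra d)"
  proof (rule hilb_carrierI)
    show "norm_part d j f \<sigma> = 0" if "\<not> \<sigma> permutes {1..d}" for \<sigma>
      using hilb_support[OF f that] by (simp add: norm_part_def)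
    show "norm_part d j f (\<pi> \<circ> \<sigma> \<circ> inv' \<pi>) = norm_part d j f \<sigma>"
      if "\<pi> permutes {1..d}" "\<sigma> permutes {1..d}" for \<pi> \<sigma>
      unfolding norm_part_def perm_norm_conjugate[OF that] hilb_conj[OF f that(1)] ..
  qed
  then show ?thesis by (simp add: hilb_component_def norm_part_def)
qed

lemma norm_part_same: "f \<in> hilb_component d j \<Longrightarrow> norm_part d j f = f"
  by (auto simp: norm_part_def hilb_component_def fun_eq_iff)

lemma hilb_component_carrier: "f \<in> hilb_component d j \<Longrightarrow> f \<in> carrier (hilb_algebra d)"
  by (simp add: hilb_component_def)

lemma sum_norm_parts:
  assumes f: "f \<in> carrier (hilb_algebra d)" and d: "d \<ge> 1"
  shows "f = (\<lambda>\<sigma>. \<Sum>j<d. norm_part d j f \<sigma>)"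
proof
  fix \<sigma>
  show "f \<sigma> = (\<Sum>j<d. norm_part d j f \<sigma>)"
  proof (cases "\<sigma> permutes {1..d}")
    case True
    then show ?thesis using perm_norm_less[OF True d] by (simp add: norm_part_def)
  next
    case False
    then show ?thesis using hilb_support[OF f False] by (simp add: norm_part_def)
  qed
qed

lemma hilb_component_zero_norm:
  assumes "f \<in> hilb_component d 0"
  shows "f = (\<lambda>\<sigma>. f id * perm_basis id \<sigma>)"
proof
  fix \<sigma>
  show "f \<sigma> = f id * perm_basis id \<sigma>"
    using assms perm_norm_eq_0_iff[of \<sigma> d] hilb_support[of f d \<sigma>]
    by (cases "\<sigma> permutes {1..d}") (auto simp: hilb_component_def perm_basis_def)
qed

lemma hilb_component_id:
  "f \<in> hilb_component d j \<Longrightarrow> j \<ge> 1 \<Longrightarrow> f id = 0"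
  by (auto simp: hilb_component_def)

lemma norm_part_0:
  assumes "f \<in> carrier (hilb_algebra d)" "f id = 0"
  shows "norm_part d 0 f = (\<lambda>_. 0)"
  using hilb_component_zero_norm[OF norm_part_mem[OF assms(1), of 0]] assms(2)
  by (simp add: norm_part_def)

text \<open>The norm is less than \<open>d\<close>, so an element is the finite sum of its norm parts.\<close>

lemma mem_if_norm_parts_mem:
  assumes f: "f \<in> carrier (hilb_algebra d)" and d: "d \<ge> 1"
    and zero: "(\<lambda>_. 0) \<in> X"
    and add: "\<And>g h. g \<in> X \<Longrightarrow> h \<in> X \<Longrightarrow> (\<lambda>\<sigma>. g \<sigma> + h \<sigma>) \<in> X"
    and part: "\<And>j. norm_part d j f \<in> X"
  shows "f \<in> X"
proof -
  have "(\<lambda>\<sigma>. \<Sum>j<m. norm_part d j f \<sigma>) \<in> X" for m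
  proof (induct m)
    case 0
    show "(\<lambda>\<sigma>. \<Sum>j<0. norm_part d j f \<sigma>) \<in> X" using zero by simp
  next
    case (Suc m)
    show "(\<lambda>\<sigma>. \<Sum>j<Suc m. norm_part d j f \<sigma>) \<in> X" using add[OF Suc part[of m]] by simp
  qed
  from this[of d] show ?thesis by (simp only: sum_norm_parts[OF f d, symmetric])
qed

lemma cycle_functional_add:
  "cycle_functional d n (\<lambda>\<sigma>. f \<sigma> + g \<sigma>) = cycle_functional d n f + cycle_functional d n g"
  by (simp add: cycle_functional_def distrib_right sum.distrib)

lemma cycle_functional_scale:
  "cycle_functional d n (\<lambda>\<sigma>. c * f \<sigma>) = c * cycle_functional d n f"
  by (simp add: cycle_functional_def sum_distrib_left mult.assoc)

lemma cycle_functional_other_component: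
  "f \<in> hilb_component d i \<Longrightarrow> i \<noteq> n \<Longrightarrow> cycle_functional d n f = 0"
  unfolding cycle_functional_def by (intro sum.neutral) (auto simp: hilb_component_def)

lemma cycle_functional_one: "n \<ge> 1 \<Longrightarrow> cycle_functional d n (perm_basis id) = 0"
  unfolding cycle_functional_def by (intro sum.neutral) (auto simp: perm_basis_def)

lemma standard_element_component:
  assumes "n < d"
  shows "standard_element d n \<in> hilb_component d n"
proof -
  let ?c = "standard_cycle n"
  have c: "?c permutes {1..d}" by (rule standard_cycle_permutes[OF assms])
  have e: "standard_element d n = (\<lambda>\<rho>. 1 / (fact d * perm_weight d n ?c) * conj_sum d ?c \<rho>)"
    by (simp add: standard_element_def)
  have "standard_element d n \<in> carrier (hilb_algebra d)"
    unfolding e by (rule hilb_scale_closed[OF conj_sum_carrier[OF c]])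
  moreover have "perm_norm d \<sigma> = n" if nz: "standard_element d n \<sigma> \<noteq> 0" for \<sigma>
  proof -
    have "conj_sum d ?c \<sigma> \<noteq> 0" using nz by (auto simp: standard_element_def)
    then obtain \<pi> where p: "\<pi> \<in> perms d" "perm_basis (\<pi> \<circ> ?c \<circ> inv' \<pi>) \<sigma> \<noteq> 0"
      unfolding conj_sum_def using sum.not_neutral_contains_not_neutral by blast
    then have "\<sigma> = \<pi> \<circ> ?c \<circ> inv' \<pi>" by (simp add: perm_basis_def split: if_splits)
    then show ?thesis
      using perm_norm_conjugate[OF _ c] p(1) perm_norm_standard_cycle[OF assms] by simp
  qed
  ultimately show ?thesis by (simp add: hilb_component_def)
qed

lemma cycle_functional_standard_element:
  assumes "n < d"
  shows "cycle_functional d n (standard_element d n) = 1"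
proof -
  let ?c = "standard_cycle n"
  let ?w = "\<lambda>\<sigma>. if perm_norm d \<sigma> = n then perm_weight d n \<sigma> else 0"
  have c: "?c permutes {1..d}" by (rule standard_cycle_permutes[OF assms])
  have "(\<Sum>\<rho>\<in>perms d. conj_sum d ?c \<rho> * ?w \<rho>) =
      (\<Sum>\<pi>\<in>perms d. \<Sum>\<rho>\<in>perms d. perm_basis (\<pi> \<circ> ?c \<circ> inv' \<pi>) \<rho> * ?w \<rho>)"
    unfolding conj_sum_def sum_distrib_right by (rule sum.swap)
  also have "\<dots> = (\<Sum>\<pi>\<in>perms d. perm_weight d n ?c)"
  proof (rule sum.cong[OF refl])
    fix \<pi> assume "\<pi> \<in> perms d"
    then have p: "\<pi> permutes {1..d}" by simp
    have m: "\<pi> \<circ> ?c \<circ> inv' \<pi> \<in> perms d" using conjugate_permutes[OF p c] by simp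
    have "(\<Sum>\<rho>\<in>perms d. perm_basis (\<pi> \<circ> ?c \<circ> inv' \<pi>) \<rho> * ?w \<rho>) =
        (\<Sum>\<rho>\<in>perms d. if \<rho> = \<pi> \<circ> ?c \<circ> inv' \<pi> then ?w \<rho> else 0)"
      by (intro sum.cong refl) (simp add: perm_basis_def)
    also have "\<dots> = ?w (\<pi> \<circ> ?c \<circ> inv' \<pi>)"
      by (simp only: sum.delta[OF finite_perms] m if_True)
    also have "\<dots> = perm_weight d n ?c"
      unfolding perm_norm_conjugate[OF p c] perm_norm_standard_cycle[OF assms]
        perm_weight_conjugate[OF p c] by simp
    finally show "(\<Sum>\<rho>\<in>perms d. perm_basis (\<pi> \<circ> ?c \<circ> inv' \<pi>) \<rho> * ?w \<rho>) = perm_weight d n ?c" .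
  qed
  also have "\<dots> = fact d * perm_weight d n ?c"
    using card_permutations[of "{1..d}" d] by simp
  finally have *: "(\<Sum>\<rho>\<in>perms d. conj_sum d ?c \<rho> * ?w \<rho>) = fact d * perm_weight d n ?c" .
  have "cycle_functional d n (standard_element d n) =
      (\<Sum>\<rho>\<in>perms d. conj_sum d ?c \<rho> * ?w \<rho>) / (fact d * perm_weight d n ?c)"
    unfolding cycle_functional_def standard_element_def sum_divide_distrib
    by (intro sum.cong refl) simp
  then show ?thesis unfolding * using perm_weight_neq_0[OF c, of n] by simp
qed

inductive_set cycle_span :: "nat \<Rightarrow> ((nat \<Rightarrow> nat) \<Rightarrow> rat) set" for d where
  mult: "a \<ge> 1 \<Longrightarrow> h \<in> carrier (hilb_algebra d) \<Longrightarrow> grad_mult d (cycle_sum d a) h \<in> cycle_span d"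
| add: "f \<in> cycle_span d \<Longrightarrow> g \<in> cycle_span d \<Longrightarrow> (\<lambda>\<rho>. f \<rho> + g \<rho>) \<in> cycle_span d"

lemma cycle_span_scale:
  assumes "f \<in> cycle_span d"
  shows "(\<lambda>\<rho>. c * f \<rho>) \<in> cycle_span d"
  using assms
proof induct
  case (mult a h)
  then show ?case
    using cycle_span.mult[OF mult(1) hilb_scale_closed[OF mult(2), of c]]
    by (simp add: grad_mult_scale_right)
next
  case (add f g)
  have "(\<lambda>\<rho>. c * f \<rho> + c * g \<rho>) \<in> cycle_span d" by (rule cycle_span.add[OF add(2,4)])
  then show ?case by (simp add: distrib_left)
qed

interpretation cycle_span: cycle_closed d "cycle_span d" for d
  by standard (auto intro: cycle_span.intros cycle_span_scale)

text \<open>The cycles on \<open>n + 1\<close> points are all conjugate, so \<open>cycle_sum d n * conj_sum d id\<close> is a multiple of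
  the standard element. In \<open>cycle_span\<close> the second factor may be a unit, in contrast to the square
  of the augmentation ideal.\<close>

lemma standard_element_cycle_span:
  assumes n: "n \<ge> 1" "n < d"
  shows "standard_element d n \<in> cycle_span d"
proof -
  let ?c = "standard_cycle n"
  let ?L = "spread_lists {1..d} id (Suc n)"
  have c: "?c permutes {1..d}" by (rule standard_cycle_permutes[OF n(2)])
  have fin: "finite ?L" by (rule finite_spread_lists) simp
  have "conj_sum d (cycle_of_list xs \<circ> id) = conj_sum d ?c" if "xs \<in> ?L" for xs
  proof -
    have xs: "distinct xs" "set xs \<subseteq> {x \<in> {1..d}. id x = x}" "length xs = Suc n"
      using that by (auto simp: spread_lists_id)
    have ys: "distinct [1..<n + 2]" "set [1..<n + 2] \<subseteq> {x \<in> {1..d}. id x = x}"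
      "length [1..<n + 2] = length xs"
      using n xs by auto
    obtain \<pi> where p: "\<pi> permutes {1..d}"
      "\<pi> \<circ> (cycle_of_list [1..<n + 2] \<circ> id) \<circ> inv' \<pi> = cycle_of_list xs \<circ> id"
      by (rule cycle_comp_conjugate[OF permutes_id finite_atLeastAtMost ys(1,2) xs(1,2) ys(3)])
    have "conj_sum d (cycle_of_list xs \<circ> id) = conj_sum d (cycle_of_list [1..<n + 2] \<circ> id)"
      unfolding p(2)[symmetric] by (rule conj_sum_conjugate[OF p(1)])
    then show ?thesis by (simp add: standard_cycle_def)
  qed
  then have "grad_mult d (cycle_sum d n) (conj_sum d id) = (\<lambda>\<rho>. of_nat (card ?L) * conj_sum d ?c \<rho>)"
    unfolding cycle_sum_mult_conj_sum[OF permutes_id] by (simp cong: sum.cong_simp)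
  then have "(\<lambda>\<rho>. of_nat (card ?L) * conj_sum d ?c \<rho>) \<in> cycle_span d"
    using cycle_span.mult[OF n(1) conj_sum_carrier[OF permutes_id]] by metis
  then have "(\<lambda>\<rho>. 1 / (of_nat (card ?L) * (fact d * perm_weight d n ?c)) *
      (of_nat (card ?L) * conj_sum d ?c \<rho>)) \<in> cycle_span d" by (rule cycle_span_scale)
  moreover have "card ?L \<noteq> 0" using standard_list_spread[OF n(2)] fin by auto
  ultimately show ?thesis by (simp add: standard_element_def)
qed

lemma augmentation_cycle_span:
  assumes f: "f \<in> carrier (hilb_algebra d)" "f id = 0" and d: "d \<ge> 1"
  shows "f \<in> cycle_span d"
proof (rule mem_if_norm_parts_mem[OF f(1) d cycle_span.V_zero cycle_span.add])
  fix j
  show "norm_part d j f \<in> cycle_span d"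
  proof (cases "j = 0")
    case True
    then show ?thesis using norm_part_0[OF f] cycle_span.V_zero by simp
  next
    case False
    then have j: "j \<ge> 1" by simp
    show ?thesis
      by (rule cycle_span.component_mem[OF norm_part_mem[OF f(1)] j d])
        (rule standard_element_cycle_span[OF j])
  qed
qed

text \<open>Write the first factor as a combination of products \<open>cycle_sum d a * h\<close>. By associativity, the
  second factor can be absorbed into \<open>h\<close>, which brings \<open>h\<close> into the augmentation ideal.\<close>

lemma cycle_functional_mult_eq_0:
  assumes "f \<in> carrier (hilb_algebra d)" "f id = 0" "g \<in> carrier (hilb_algebra d)" "g id = 0"
    and d: "d \<ge> 1" and n: "2 * n \<le> d"
  shows "cycle_functional d n (grad_mult d f g) = 0"
proof -
  have "f \<in> cycle_span d" by (rule augmentation_cycle_span) (use assms in auto)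
  then show ?thesis
  proof induct
    case (mult a h)
    have "grad_mult d h g id = 0" using assms(4) by (simp add: grad_mult_id)
    then show ?case
      using cycle_functional_cycle_sum_mult[OF mult(1) n, of "grad_mult d h g"]
      by (simp only: grad_mult_assoc)
  next
    case (add f f')
    then show ?case by (simp add: grad_mult_add_left cycle_functional_add)
  qed
qed

text \<open>The functional vanishes on products of two elements of the augmentation ideal and on \<open>1\<close>, so it
  is a derivation with respect to the augmentation \<open>f \<mapsto> f id\<close>.\<close>

lemma cycle_functional_derivation:
  assumes f: "f \<in> carrier (hilb_algebra d)" and g: "g \<in> carrier (hilb_algebra d)"
    and d: "d \<ge> 1" and n: "n \<ge> 1" "2 * n \<le> d"
  shows "cycle_functional d n (grad_mult d f g) =
    f id * cycle_functional d n g + g id * cycle_functional d n f"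
proof -
  let ?e = "perm_basis id"
  have e: "?e \<in> carrier (hilb_algebra d)" by (rule perm_basis_id_carrier)
  have eid: "?e id = 1" by (simp add: perm_basis_def)
  define f0 where "f0 = (\<lambda>\<sigma>. f \<sigma> + (- f id) * ?e \<sigma>)"
  define g0 where "g0 = (\<lambda>\<sigma>. g \<sigma> + (- g id) * ?e \<sigma>)"
  have c: "f0 \<in> carrier (hilb_algebra d)" "g0 \<in> carrier (hilb_algebra d)"
    unfolding f0_def g0_def by (intro hilb_add_closed hilb_scale_closed f g e)+
  have z: "f0 id = 0" "g0 id = 0" by (simp_all add: f0_def g0_def eid)
  have fe: "f = (\<lambda>\<sigma>. f0 \<sigma> + f id * ?e \<sigma>)" and ge: "g = (\<lambda>\<sigma>. g0 \<sigma> + g id * ?e \<sigma>)"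
    by (auto simp: f0_def g0_def)
  have "grad_mult d f g = (\<lambda>\<rho>. grad_mult d f0 g \<rho> + f id * g \<rho>)"
    by (subst fe, simp only: grad_mult_add_left grad_mult_scale_left
        hilb_one_left[OF g])
  moreover have "grad_mult d f0 g = (\<lambda>\<rho>. grad_mult d f0 g0 \<rho> + g id * f0 \<rho>)"
    by (subst ge, simp only: grad_mult_add_right grad_mult_scale_right
        hilb_one_right[OF c(1)])
  moreover have "cycle_functional d n f0 = cycle_functional d n f"
    unfolding f0_def cycle_functional_add cycle_functional_scale cycle_functional_one[OF n(1)] by simp
  ultimately show ?thesis
    using cycle_functional_mult_eq_0[OF c(1) z(1) c(2) z(2) d n(2)]
    by (simp only: cycle_functional_add cycle_functional_scale)
qed

lemma norm_part_cycle_sum_mult: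
  "norm_part d j (grad_mult d (cycle_sum d a) h) =
    (if a \<le> j then grad_mult d (cycle_sum d a) (norm_part d (j - a) h) else (\<lambda>_. 0))"
proof
  fix \<rho>
  let ?g = "\<lambda>\<tau>. \<Sum>xs\<in>spread_lists {1..d} \<tau> (Suc a). perm_basis (cycle_of_list xs \<circ> \<tau>) \<rho>"
  have nz: "perm_norm d \<rho> = perm_norm d \<tau> + a" if t: "\<tau> permutes {1..d}" and g: "?g \<tau> \<noteq> 0" for \<tau>
  proof -
    obtain xs where xs: "xs \<in> spread_lists {1..d} \<tau> (Suc a)"
      "perm_basis (cycle_of_list xs \<circ> \<tau>) \<rho> \<noteq> 0"
      using g sum.not_neutral_contains_not_neutral by blast
    then have "\<rho> = cycle_of_list xs \<circ> \<tau>" by (simp add: perm_basis_def split: if_splits)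
    then show ?thesis using perm_norm_spread[OF xs(1) t] by simp
  qed
  have "norm_part d j (grad_mult d (cycle_sum d a) h) \<rho> =
      (\<Sum>\<tau>\<in>perms d. if perm_norm d \<rho> = j then h \<tau> * ?g \<tau> else 0)"
    unfolding norm_part_def cycle_sum_mult by simp
  also have "\<dots> = (\<Sum>\<tau>\<in>perms d. if a \<le> j \<and> perm_norm d \<tau> = j - a then h \<tau> * ?g \<tau> else 0)"
  proof (rule sum.cong[OF refl])
    fix \<tau> assume "\<tau> \<in> perms d"
    then show "(if perm_norm d \<rho> = j then h \<tau> * ?g \<tau> else 0) =
        (if a \<le> j \<and> perm_norm d \<tau> = j - a then h \<tau> * ?g \<tau> else 0)"
      using nz[of \<tau>] by (cases "?g \<tau> = 0") auto
  qed
  also have "\<dots> = (if a \<le> j then grad_mult d (cycle_sum d a) (norm_part d (j - a) h) else (\<lambda>_. 0)) \<rho>"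
    unfolding cycle_sum_mult norm_part_def by (auto intro!: sum.cong)
  finally show "norm_part d j (grad_mult d (cycle_sum d a) h) \<rho> =
      (if a \<le> j then grad_mult d (cycle_sum d a) (norm_part d (j - a) h) else (\<lambda>_. 0)) \<rho>" .
qed

lemma cycle_sum_component: "cycle_sum d a \<in> hilb_component d a"
proof -
  have "perm_norm d \<sigma> = a" if nz: "cycle_sum d a \<sigma> \<noteq> 0" for \<sigma>
  proof -
    obtain xs where xs: "xs \<in> spread_lists {1..d} id (Suc a)" "perm_basis (cycle_of_list xs) \<sigma> \<noteq> 0"
      using nz unfolding cycle_sum_def using sum.not_neutral_contains_not_neutral by blast
    then have "\<sigma> = cycle_of_list xs" by (simp add: perm_basis_def split: if_splits)
    then show ?thesis using perm_norm_spread[OF xs(1) permutes_id] by simp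
  qed
  then show ?thesis using cycle_sum_carrier by (simp add: hilb_component_def)
qed

section \<open>Indecomposables and generators\<close>

lemma hilb_vectorspace: "vectorspace rat_field (hilb_algebra d)"
proof (rule vectorspace.intro)
  show "field rat_field" by (rule class_field)
  show "Module.module rat_field (hilb_algebra d)"
  proof (rule moduleI)
    show "cring rat_field" ..
    show "abelian_group (hilb_algebra d)"
    proof (rule abelian_groupI)
      fix x assume x: "x \<in> carrier (hilb_algebra d)"
      show "\<exists>y\<in>carrier (hilb_algebra d). y \<oplus>\<^bsub>hilb_algebra d\<^esub> x = \<zero>\<^bsub>hilb_algebra d\<^esub>"
        by (rule bexI[OF _ hilb_scale_closed[OF x, of "-1"]]) (simp add: hilb_algebra_simps)
    qed (simp_all add: hilb_algebra_simps hilb_add_closed hilb_zero_closed add_ac)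
  qed (simp_all add: hilb_algebra_simps class_ring_simps hilb_scale_closed algebra_simps)
qed

lemma hilb_submoduleI:
  assumes "X \<subseteq> carrier (hilb_algebra d)" "(\<lambda>_. 0) \<in> X"
    and "\<And>f g. f \<in> X \<Longrightarrow> g \<in> X \<Longrightarrow> (\<lambda>\<sigma>. f \<sigma> + g \<sigma>) \<in> X"
    and "\<And>c f. f \<in> X \<Longrightarrow> (\<lambda>\<sigma>. c * f \<sigma>) \<in> X"
  shows "submodule rat_field X (hilb_algebra d)"
proof -
  interpret vectorspace rat_field "hilb_algebra d" by (rule hilb_vectorspace)
  show ?thesis
    by (rule submodule.intro) (use assms in \<open>auto simp: hilb_algebra_simps\<close>, unfold_locales)
qed

lemma hilb_submoduleD:
  assumes "submodule rat_field X (hilb_algebra d)"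
  shows "(\<lambda>_. 0) \<in> X" "f \<in> X \<Longrightarrow> g \<in> X \<Longrightarrow> (\<lambda>\<sigma>. f \<sigma> + g \<sigma>) \<in> X" "f \<in> X \<Longrightarrow> (\<lambda>\<sigma>. c * f \<sigma>) \<in> X"
proof -
  interpret submodule rat_field X "hilb_algebra d" by fact
  show "(\<lambda>_. 0) \<in> X" using zero_closed by (simp add: hilb_algebra_simps)
  show "f \<in> X \<Longrightarrow> g \<in> X \<Longrightarrow> (\<lambda>\<sigma>. f \<sigma> + g \<sigma>) \<in> X" using m_closed by (simp add: hilb_algebra_simps)
  show "f \<in> X \<Longrightarrow> (\<lambda>\<sigma>. c * f \<sigma>) \<in> X"
    using smult_closed[of c f] by (simp add: hilb_algebra_simps class_ring_simps)
qed

text \<open>Elements of positive norm are those without a component of norm \<open>0\<close>, and the identity is the only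
  permutation of norm \<open>0\<close>.\<close>

lemma hilb_plus_eq:
  assumes d: "d \<ge> 1"
  shows "hilb_plus d = {f \<in> carrier (hilb_algebra d). f id = 0}" (is "_ = ?P")
proof -
  interpret vectorspace rat_field "hilb_algebra d" by (rule hilb_vectorspace)
  let ?U = "\<Union>j\<in>{1..}. hilb_component d j"
  have U: "?U \<subseteq> carrier (hilb_algebra d)" using hilb_component_carrier by blast
  have sub: "submodule rat_field (span ?U) (hilb_algebra d)" by (rule span_is_submodule[OF U])
  have own: "?U \<subseteq> span ?U" by (rule in_own_span[OF U])
  note D = hilb_submoduleD[OF sub]
  have "span ?U \<subseteq> ?P"
  proof (rule span_is_subset)
    show "?U \<subseteq> ?P" using U hilb_component_id by auto
    show "submodule rat_field ?P (hilb_algebra d)"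
      by (rule hilb_submoduleI) (auto simp: hilb_add_closed hilb_scale_closed hilb_zero_closed)
  qed
  moreover have "?P \<subseteq> span ?U"
  proof
    fix f assume f: "f \<in> ?P"
    then have fc: "f \<in> carrier (hilb_algebra d)" by simp
    show "f \<in> span ?U"
    proof (rule mem_if_norm_parts_mem[OF fc d D(1,2)])
      fix j
      show "norm_part d j f \<in> span ?U"
      proof (cases "j = 0")
        case True
        then show ?thesis using norm_part_0[OF fc] f D(1) by simp
      next
        case False
        then have "norm_part d j f \<in> ?U" using norm_part_mem[OF fc, of j] by auto
        then show ?thesis using own by blast
      qed
    qed
  qed
  ultimately show ?thesis unfolding hilb_plus_def by blast
qed

context
  fixes d :: nat
  assumes d: "d \<ge> 1"
begin

lemma hilb_plus_mult:
  "f \<in> hilb_plus d \<Longrightarrow> g \<in> hilb_plus d \<Longrightarrow> grad_mult d f g \<in> hilb_plus_sq d"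
  unfolding hilb_plus_sq_def using ideal_prod.prod[of f "hilb_plus d" g "hilb_plus d" "hilb_algebra d"]
  by (simp add: hilb_algebra_simps)

lemma hilb_plus_sq_add:
  "f \<in> hilb_plus_sq d \<Longrightarrow> g \<in> hilb_plus_sq d \<Longrightarrow> (\<lambda>\<sigma>. f \<sigma> + g \<sigma>) \<in> hilb_plus_sq d"
  unfolding hilb_plus_sq_def using ideal_prod.sum[of f "hilb_algebra d" "hilb_plus d" "hilb_plus d" g]
  by (simp add: hilb_algebra_simps)

lemma hilb_plus_sq_induct [consumes 1, case_names mult add]:
  assumes "f \<in> hilb_plus_sq d"
    and "\<And>f g. f \<in> hilb_plus d \<Longrightarrow> g \<in> hilb_plus d \<Longrightarrow> P (grad_mult d f g)"
    and "\<And>f g. f \<in> hilb_plus_sq d \<Longrightarrow> g \<in> hilb_plus_sq d \<Longrightarrow> P f \<Longrightarrow> P g \<Longrightarrow> P (\<lambda>\<sigma>. f \<sigma> + g \<sigma>)"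
  shows "P f"
  using assms(1) unfolding hilb_plus_sq_def
proof (induct rule: ideal_prod.induct)
  case (prod f g)
  then show ?case using assms(2)[of f g] by (simp add: hilb_algebra_simps)
next
  case (sum f g)
  then show ?case using assms(3)[of f g] unfolding hilb_plus_sq_def by (simp add: hilb_algebra_simps)
qed

lemma hilb_plus_scale: "f \<in> hilb_plus d \<Longrightarrow> (\<lambda>\<sigma>. c * f \<sigma>) \<in> hilb_plus d"
  by (simp add: hilb_plus_eq[OF d] hilb_scale_closed)

lemma hilb_plus_sq_scale: "f \<in> hilb_plus_sq d \<Longrightarrow> (\<lambda>\<sigma>. c * f \<sigma>) \<in> hilb_plus_sq d"
proof (induct rule: hilb_plus_sq_induct)
  case (mult f g)
  show ?case
    using hilb_plus_mult[OF hilb_plus_scale[OF mult(1), of c] mult(2)]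
    by (simp add: grad_mult_scale_left)
next
  case (add f g)
  show ?case using hilb_plus_sq_add[OF add(3,4)] by (simp add: distrib_left)
qed

lemma hilb_plus_sq_subset: "f \<in> hilb_plus_sq d \<Longrightarrow> f \<in> hilb_plus d"
proof (induct rule: hilb_plus_sq_induct)
  case (mult f g)
  then show ?case by (simp add: hilb_plus_eq[OF d] grad_mult_closed grad_mult_id)
next
  case (add f g)
  then show ?case by (simp add: hilb_plus_eq[OF d] hilb_add_closed)
qed

lemma hilb_plus_sq_functional:
  assumes "2 * n \<le> d"
  shows "f \<in> hilb_plus_sq d \<Longrightarrow> cycle_functional d n f = 0"
proof (induct rule: hilb_plus_sq_induct)
  case (mult f g)
  then show ?case
    by (intro cycle_functional_mult_eq_0 d assms) (simp_all add: hilb_plus_eq[OF d])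
next
  case (add f g)
  then show ?case by (simp add: cycle_functional_add)
qed

lemma cycle_closed_hilb_plus_sq: "cycle_closed d (hilb_plus_sq d)"
proof
  fix a :: nat and h assume a: "a \<ge> 1" and h: "h \<in> carrier (hilb_algebra d)" "h id = 0"
  have "cycle_sum d a id = 0" by (rule hilb_component_id[OF cycle_sum_component a])
  then have "cycle_sum d a \<in> hilb_plus d" by (simp add: hilb_plus_eq[OF d] cycle_sum_carrier)
  moreover have "h \<in> hilb_plus d" using h by (simp add: hilb_plus_eq[OF d])
  ultimately show "grad_mult d (cycle_sum d a) h \<in> hilb_plus_sq d" by (rule hilb_plus_mult)
qed (rule hilb_plus_sq_add hilb_plus_sq_scale; assumption)+

lemma hilb_plus_sq_submodule: "submodule rat_field (hilb_plus_sq d) (hilb_algebra d)"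
proof (rule hilb_submoduleI)
  show "hilb_plus_sq d \<subseteq> carrier (hilb_algebra d)"
    using hilb_plus_sq_subset by (auto simp: hilb_plus_eq[OF d])
  show "(\<lambda>_. 0) \<in> hilb_plus_sq d" by (rule cycle_closed.V_zero[OF cycle_closed_hilb_plus_sq])
qed (rule hilb_plus_sq_add hilb_plus_sq_scale; assumption)+

lemma hilb_plus_component_submodule:
  "submodule rat_field (hilb_plus d \<inter> hilb_component d j) (hilb_algebra d)"
proof (rule hilb_submoduleI)
  fix f g assume "f \<in> hilb_plus d \<inter> hilb_component d j" "g \<in> hilb_plus d \<inter> hilb_component d j"
  moreover from this have "perm_norm d \<sigma> = j" if "f \<sigma> + g \<sigma> \<noteq> 0" for \<sigma>
    using that by (cases "f \<sigma> = 0") (auto simp: hilb_component_def)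
  ultimately show "(\<lambda>\<sigma>. f \<sigma> + g \<sigma>) \<in> hilb_plus d \<inter> hilb_component d j"
    by (simp add: hilb_plus_eq[OF d] hilb_component_def hilb_add_closed)
qed (auto simp: hilb_plus_eq[OF d] hilb_component_def hilb_scale_closed hilb_zero_closed)

lemma hilb_plus_component:
  "j \<ge> 1 \<Longrightarrow> hilb_plus d \<inter> hilb_component d j = hilb_component d j"
  using hilb_component_id hilb_component_carrier by (auto simp: hilb_plus_eq[OF d])

lemma component_decomposable:
  assumes f: "f \<in> hilb_component d j" and j: "d < 2 * j"
  shows "f \<in> hilb_plus_sq d"
proof -
  interpret cycle_closed d "hilb_plus_sq d" by (rule cycle_closed_hilb_plus_sq)
  show ?thesis
    by (rule component_mem[OF f _ d standard_element_mem[OF j]]) (use j in simp)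
qed

text \<open>In norms \<open>1 \<le> j \<le> d/2\<close> the standard element spans modulo decomposables and is not decomposable,
  as the functional is \<open>1\<close> on it. In all other norms everything is decomposable, and \<open>0\<close> serves as
  the generator.\<close>

lemma indecomposables_component_dim:
  "vectorspace.fin_dim rat_field (indecomposables_component d j) \<and>
    vectorspace.dim rat_field (indecomposables_component d j) = (if 1 \<le> j \<and> 2 * j \<le> d then 1 else 0)"
proof -
  let ?I = "hilb_plus_sq d" and ?X = "hilb_plus d \<inter> hilb_component d j" and ?M = "hilb_algebra d"
  have Q: "indecomposables_component d j =
      (quotient_module ?M ?I)\<lparr>carrier := {?I +>\<^bsub>?M\<^esub> x | x. x \<in> ?X}\<rparr>"
    by (simp add: indecomposables_component_def indecomposables_def)
  note I = hilb_plus_sq_submodule and X = hilb_plus_component_submodule[of j]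
  show ?thesis
  proof (cases "1 \<le> j \<and> 2 * j \<le> d")
    case True
    then have j: "j \<ge> 1" "2 * j \<le> d" "j < d" by auto
    let ?e = "standard_element d j"
    have e: "?e \<in> ?X"
      unfolding hilb_plus_component[OF j(1)] by (rule standard_element_component[OF j(3)])
    have gen: "\<exists>c\<in>carrier rat_field. x \<in> ?I +>\<^bsub>?M\<^esub> (c \<odot>\<^bsub>?M\<^esub> ?e)" if "x \<in> ?X" for x
    proof (rule bexI)
      have "(\<lambda>\<rho>. x \<rho> - cycle_functional d j x * ?e \<rho>) \<in> ?I"
        by (rule cycle_closed.component_mod[OF cycle_closed_hilb_plus_sq]) (use that j in auto)
      then show "x \<in> ?I +>\<^bsub>?M\<^esub> (cycle_functional d j x \<odot>\<^bsub>?M\<^esub> ?e)"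
        unfolding a_r_coset_def' by (auto simp: hilb_algebra_simps intro!: bexI)
    qed (simp add: class_ring_simps)
    have "?e \<notin> ?I"
      using hilb_plus_sq_functional[OF j(2)] cycle_functional_standard_element[OF j(3)] by force
    then show ?thesis
      using dim_quotient_one_generator[OF hilb_vectorspace I X e gen] True unfolding Q by simp
  next
    case False
    have XI: "?X \<subseteq> ?I"
    proof
      fix x assume x: "x \<in> ?X"
      show "x \<in> ?I"
      proof (cases "j = 0")
        case True
        have "x id = 0" using x by (simp add: hilb_plus_eq[OF d])
        then have "x = (\<lambda>_. 0)" using hilb_component_zero_norm[of x d] x True by auto
        then show ?thesis using hilb_submoduleD(1)[OF I] by simp
      next
        case False
        then show ?thesis using component_decomposable[of x j] x \<open>\<not> (1 \<le> j \<and> 2 * j \<le> d)\<close> by simp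
      qed
    qed
    let ?e = "\<lambda>_::nat \<Rightarrow> nat. 0 :: rat"
    have e: "?e \<in> ?X" by (rule hilb_submoduleD(1)[OF X])
    have gen: "\<exists>c\<in>carrier rat_field. x \<in> ?I +>\<^bsub>?M\<^esub> (c \<odot>\<^bsub>?M\<^esub> ?e)" if "x \<in> ?X" for x
    proof (rule bexI)
      show "x \<in> ?I +>\<^bsub>?M\<^esub> (0 \<odot>\<^bsub>?M\<^esub> ?e)"
        unfolding a_r_coset_def' using XI that by (auto simp: hilb_algebra_simps intro!: bexI)
    qed (simp add: class_ring_simps)
    have "?e \<in> ?I" using e XI by blast
    then show ?thesis
      using dim_quotient_one_generator[OF hilb_vectorspace I X e gen] False unfolding Q by auto
  qed
qed

abbreviation generated :: "((nat \<Rightarrow> nat) \<Rightarrow> rat) set \<Rightarrow> ((nat \<Rightarrow> nat) \<Rightarrow> rat) set" where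
  "generated G \<equiv> generated_algebra rat_field (hilb_algebra d) G"

lemma generated_closed:
  shows "x \<in> generated G \<Longrightarrow> y \<in> generated G \<Longrightarrow> (\<lambda>\<sigma>. x \<sigma> + y \<sigma>) \<in> generated G"
    and "x \<in> generated G \<Longrightarrow> (\<lambda>\<sigma>. c * x \<sigma>) \<in> generated G"
    and "x \<in> generated G \<Longrightarrow> y \<in> generated G \<Longrightarrow> grad_mult d x y \<in> generated G"
    and "perm_basis id \<in> generated G"
    and "(\<lambda>_. 0) \<in> generated G"
proof -
  note [simp] = hilb_algebra_simps class_ring_simps
  show "x \<in> generated G \<Longrightarrow> y \<in> generated G \<Longrightarrow> (\<lambda>\<sigma>. x \<sigma> + y \<sigma>) \<in> generated G"
    using generated_algebra.add[of x rat_field "hilb_algebra d" G y] by simp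
  show sc: "x \<in> generated G \<Longrightarrow> (\<lambda>\<sigma>. c * x \<sigma>) \<in> generated G" for c x
    using generated_algebra.smult[of c rat_field x "hilb_algebra d" G] by simp
  show "x \<in> generated G \<Longrightarrow> y \<in> generated G \<Longrightarrow> grad_mult d x y \<in> generated G"
    using generated_algebra.mult[of x rat_field "hilb_algebra d" G y] by simp
  show one: "perm_basis id \<in> generated G"
    using generated_algebra.one[of "hilb_algebra d" rat_field G] by simp
  show "(\<lambda>_. 0) \<in> generated G" using sc[OF one, of 0] by simp
qed

lemma generated_subset:
  assumes "G \<subseteq> carrier (hilb_algebra d)"
  shows "generated G \<subseteq> carrier (hilb_algebra d)"
proof
  fix x assume "x \<in> generated G"
  then show "x \<in> carrier (hilb_algebra d)"
    by induct (use assms in \<open>auto simp: hilb_algebra_simps perm_basis_id_carrier hilb_add_closed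
      hilb_scale_closed grad_mult_closed\<close>)
qed

text \<open>A derivation that vanishes on a set of generators vanishes on the algebra that they generate.\<close>

lemma generated_functional_eq_0:
  assumes G: "G \<subseteq> (\<Union>j. hilb_component d j)" and j: "1 \<le> j" "2 * j \<le> d"
    and z: "\<And>g. g \<in> G \<inter> hilb_component d j \<Longrightarrow> cycle_functional d j g = 0"
    and x: "x \<in> generated G"
  shows "cycle_functional d j x = 0"
proof -
  have Gc: "G \<subseteq> carrier (hilb_algebra d)" using G hilb_component_carrier by blast
  note gc = generated_subset[OF Gc]
  show ?thesis
    using x
  proof induct
    case (gen g)
    then obtain i where i: "g \<in> hilb_component d i" using G by blast
    show ?case
    proof (cases "i = j")
      case True
      then show ?thesis using z gen i by blast
    next
      case False
      then show ?thesis by (rule cycle_functional_other_component[OF i])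
    qed
  next
    case one
    show ?case using cycle_functional_one[OF j(1)] by (simp add: hilb_algebra_simps)
  next
    case (add x y)
    then show ?case by (simp add: hilb_algebra_simps cycle_functional_add)
  next
    case (smult c x)
    then show ?case by (simp add: hilb_algebra_simps cycle_functional_scale)
  next
    case (mult x y)
    have "x \<in> carrier (hilb_algebra d)" "y \<in> carrier (hilb_algebra d)" using mult(1,3) gc by blast+
    then have "cycle_functional d j (grad_mult d x y) = 0"
      using cycle_functional_derivation[OF _ _ d j] mult(2,4) by simp
    then show ?case by (simp add: hilb_algebra_simps)
  qed
qed

text \<open>Induction on the norm \<open>j\<close>. The elements whose component of norm \<open>j\<close> is generated contain all
  products of cycle sums of positive norm with elements of the augmentation ideal: the norm \<open>j\<close>
  part of such a product is zero or a product of two elements of smaller norm. Hence it suffices to show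
  that the standard element of norm \<open>j\<close> is generated. For \<open>j > d/2\<close> this is automatic, and
  otherwise it is congruent to a nonzero multiple of the given element of \<open>G\<close>.\<close>

lemma component_generated:
  assumes G: "\<And>j. 1 \<le> j \<Longrightarrow> 2 * j \<le> d \<Longrightarrow> \<exists>g\<in>G \<inter> hilb_component d j. cycle_functional d j g \<noteq> 0"
    and "f \<in> hilb_component d j"
  shows "f \<in> generated G"
  using assms(2)
proof (induct j arbitrary: f rule: less_induct)
  case (less j)
  note gc = generated_closed[where G = G]
  show ?case
  proof (cases "j = 0")
    case True
    then have "f = (\<lambda>\<sigma>. f id * perm_basis id \<sigma>)" using hilb_component_zero_norm less(2) by blast
    then show ?thesis using gc(2)[OF gc(4), of "f id"] by simp
  next
    case False
    then have j: "j \<ge> 1" by simp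
    define V where "V = {f \<in> carrier (hilb_algebra d). norm_part d j f \<in> generated G}"
    interpret V: cycle_closed d V
    proof
      fix f g assume fg: "f \<in> V" "g \<in> V"
      have "norm_part d j (\<lambda>\<rho>. f \<rho> + g \<rho>) = (\<lambda>\<rho>. norm_part d j f \<rho> + norm_part d j g \<rho>)"
        by (auto simp: norm_part_def)
      then show "(\<lambda>\<rho>. f \<rho> + g \<rho>) \<in> V" using fg gc(1) by (simp add: V_def hilb_add_closed)
    next
      fix f c assume f: "f \<in> V"
      have "norm_part d j (\<lambda>\<rho>. c * f \<rho>) = (\<lambda>\<rho>. c * norm_part d j f \<rho>)"
        by (auto simp: norm_part_def)
      then show "(\<lambda>\<rho>. c * f \<rho>) \<in> V" using f gc(2) by (simp add: V_def hilb_scale_closed)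
    next
      fix a :: nat and h assume a: "a \<ge> 1" and h: "h \<in> carrier (hilb_algebra d)" "h id = 0"
      have "norm_part d j (grad_mult d (cycle_sum d a) h) \<in> generated G"
      proof (cases "a < j")
        case True
        have "cycle_sum d a \<in> generated G" by (rule less(1)[OF True cycle_sum_component])
        moreover have "norm_part d (j - a) h \<in> generated G"
          by (rule less(1)[OF _ norm_part_mem[OF h(1)]]) (use a j in simp)
        ultimately show ?thesis
          unfolding norm_part_cycle_sum_mult using True gc(3) by simp
      next
        case False
        have "norm_part d 0 h = (\<lambda>_. 0)" by (rule norm_part_0[OF h])
        then have "norm_part d j (grad_mult d (cycle_sum d a) h) = (\<lambda>_. 0)"
          unfolding norm_part_cycle_sum_mult using False
          by (auto simp: cycle_sum_mult)
        then show ?thesis using gc(5) by simp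
      qed
      then show "grad_mult d (cycle_sum d a) h \<in> V"
        using grad_mult_closed[OF cycle_sum_carrier h(1)] by (simp add: V_def)
    qed
    have Vj: "f \<in> generated G" if "f \<in> V" "f \<in> hilb_component d j" for f
      using that norm_part_same[of f d j] by (simp add: V_def)
    have mem: "f \<in> V" if "f \<in> generated G" "f \<in> hilb_component d j" for f
      using that norm_part_same[of f d j] hilb_component_carrier by (simp add: V_def)
    let ?e = "standard_element d j"
    have std: "?e \<in> V" if jd: "j < d"
    proof (cases "2 * j \<le> d")
      case True
      obtain g where g: "g \<in> G" "g \<in> hilb_component d j" "cycle_functional d j g \<noteq> 0"
        using G[OF j True] by blast
      have "g \<in> V" by (rule mem[OF generated_algebra.gen[OF g(1)] g(2)])
      then have "(\<lambda>\<rho>. g \<rho> - (g \<rho> - cycle_functional d j g * ?e \<rho>)) \<in> V"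
        by (rule V.V_diff[OF _ V.component_mod[OF g(2) j]])
      then have "(\<lambda>\<rho>. cycle_functional d j g * ?e \<rho>) \<in> V" by simp
      from V.V_scale[OF this, of "1 / cycle_functional d j g"] show ?thesis using g(3) by simp
    next
      case False
      then show ?thesis using jd by (intro V.standard_element_mem) auto
    qed
    have "f \<in> V" by (rule V.component_mem[OF less(2) j d std])
    then show ?thesis using less(2) by (rule Vj)
  qed
qed

lemma homogeneous_generators_iff:
  assumes G: "G \<subseteq> (\<Union>j. hilb_component d j)"
  shows "homogeneous_generators d G \<longleftrightarrow>
    (\<forall>j. 1 \<le> j \<and> 2 * j \<le> d \<longrightarrow> (\<exists>g\<in>G \<inter> hilb_component d j. cycle_functional d j g \<noteq> 0))"
    (is "_ \<longleftrightarrow> ?R")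
proof
  assume gen: "homogeneous_generators d G"
  show ?R
  proof (intro allI impI, rule ccontr)
    fix j assume j: "1 \<le> j \<and> 2 * j \<le> d"
      and "\<not> (\<exists>g\<in>G \<inter> hilb_component d j. cycle_functional d j g \<noteq> 0)"
    then have z: "cycle_functional d j g = 0" if "g \<in> G \<inter> hilb_component d j" for g using that by blast
    have jd: "j < d" using j by auto
    have "standard_element d j \<in> carrier (hilb_algebra d)"
      by (rule hilb_component_carrier[OF standard_element_component[OF jd]])
    then have "standard_element d j \<in> generated G"
      using gen by (simp add: homogeneous_generators_def)
    then have "cycle_functional d j (standard_element d j) = 0"
      using generated_functional_eq_0[OF G _ _ z] j by blast
    then show False using cycle_functional_standard_element[OF jd] by simp
  qed
next
  assume R: ?R
  have "carrier (hilb_algebra d) \<subseteq> generated G"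
  proof
    fix f assume f: "f \<in> carrier (hilb_algebra d)"
    show "f \<in> generated G"
    proof (rule mem_if_norm_parts_mem[OF f d generated_closed(5)])
      show "norm_part d j f \<in> generated G" for j
        by (rule component_generated[OF _ norm_part_mem[OF f]]) (use R in blast)
    qed (rule generated_closed(1))
  qed
  moreover have "generated G \<subseteq> carrier (hilb_algebra d)"
    using G hilb_component_carrier by (intro generated_subset) blast
  ultimately show "homogeneous_generators d G" using G by (simp add: homogeneous_generators_def)
qed

lemma exists_minimal_generators: "\<exists>G. minimal_homogeneous_generators d G"
proof -
  define J where "J = {j. 1 \<le> j \<and> 2 * j \<le> d}"
  have Jd: "j < d" if "j \<in> J" for j using that by (auto simp: J_def)
  define G where "G = standard_element d ` J"
  have Gc: "G \<subseteq> (\<Union>j. hilb_component d j)"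
    using standard_element_component Jd by (auto simp: G_def)
  have "homogeneous_generators d G"
    unfolding homogeneous_generators_iff[OF Gc]
  proof (intro allI impI)
    fix j assume "1 \<le> j \<and> 2 * j \<le> d"
    then have j: "j \<in> J" by (simp add: J_def)
    then show "\<exists>g\<in>G \<inter> hilb_component d j. cycle_functional d j g \<noteq> 0"
      using standard_element_component[OF Jd[OF j]] cycle_functional_standard_element[OF Jd[OF j]]
      by (intro bexI[of _ "standard_element d j"]) (auto simp: G_def)
  qed
  moreover have "H = G" if H: "H \<subseteq> G" "homogeneous_generators d H" for H
  proof
    show "G \<subseteq> H"
    proof
      fix x assume "x \<in> G"
      then obtain j where j: "j \<in> J" "x = standard_element d j" by (auto simp: G_def)
      have Hc: "H \<subseteq> (\<Union>j. hilb_component d j)" using H(1) Gc by blast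
      obtain g where g: "g \<in> H" "cycle_functional d j g \<noteq> 0"
        using H(2) j(1) unfolding homogeneous_generators_iff[OF Hc] J_def by blast
      obtain i where i: "i \<in> J" "g = standard_element d i" using g(1) H(1) by (auto simp: G_def)
      have "i = j"
        using cycle_functional_other_component[OF standard_element_component[OF Jd[OF i(1)]], of j] g(2) i(2)
        by auto
      then show "x \<in> H" using g(1) i(2) j(2) by simp
    qed
  qed (rule H(1))
  ultimately show ?thesis unfolding minimal_homogeneous_generators_def minimal_def by blast
qed

text \<open>Choose one element of \<open>G\<close> per norm \<open>j \<le> d/2\<close> on which the functional does not vanish. The chosen
  elements already generate, so by minimality there are no others. A chosen element is nonzero, so
  it lies in one component only.\<close>

lemma minimal_generators_components:
  assumes min: "minimal_homogeneous_generators d G"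
  shows "1 \<le> j \<Longrightarrow> 2 * j \<le> d \<Longrightarrow> \<exists>!x. x \<in> G \<inter> hilb_component d j"
    and "\<not> (1 \<le> j \<and> 2 * j \<le> d) \<Longrightarrow> G \<inter> hilb_component d j = {}"
proof -
  define J where "J = {j. 1 \<le> j \<and> 2 * j \<le> d}"
  have gen: "homogeneous_generators d G"
    and minG: "\<And>H. H \<subseteq> G \<Longrightarrow> homogeneous_generators d H \<Longrightarrow> H = G"
    using min by (auto simp: minimal_homogeneous_generators_def minimal_def)
  have Gc: "G \<subseteq> (\<Union>j. hilb_component d j)" using gen by (simp add: homogeneous_generators_def)
  have "\<exists>g. g \<in> G \<inter> hilb_component d j \<and> cycle_functional d j g \<noteq> 0" if "j \<in> J" for j
    using gen that unfolding homogeneous_generators_iff[OF Gc] J_def by blast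
  then obtain g where g: "\<And>j. j \<in> J \<Longrightarrow> g j \<in> G \<inter> hilb_component d j"
    and gn: "\<And>j. j \<in> J \<Longrightarrow> cycle_functional d j (g j) \<noteq> 0" by metis
  have "g ` J = G"
  proof (rule minG)
    show "g ` J \<subseteq> G" using g by blast
    have c: "g ` J \<subseteq> (\<Union>j. hilb_component d j)" using g by blast
    show "homogeneous_generators d (g ` J)"
      unfolding homogeneous_generators_iff[OF c]
    proof (intro allI impI)
      fix j assume "1 \<le> j \<and> 2 * j \<le> d"
      then have j: "j \<in> J" by (simp add: J_def)
      then show "\<exists>x\<in>g ` J \<inter> hilb_component d j. cycle_functional d j x \<noteq> 0"
        using g[OF j] gn[OF j] by blast
    qed
  qed
  have same: "i = j" if i: "i \<in> J" and gi: "g i \<in> hilb_component d j" for i j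
  proof (rule ccontr)
    assume "i \<noteq> j"
    then have "cycle_functional d i (g i) = 0"
      using cycle_functional_other_component[OF gi, of i] by simp
    then show False using gn[OF i] by simp
  qed
  show "\<exists>!x. x \<in> G \<inter> hilb_component d j" if "1 \<le> j" "2 * j \<le> d"
  proof
    have j: "j \<in> J" using that by (simp add: J_def)
    show "g j \<in> G \<inter> hilb_component d j" by (rule g[OF j])
    fix x assume x: "x \<in> G \<inter> hilb_component d j"
    then obtain i where "i \<in> J" "x = g i" using \<open>g ` J = G\<close> by blast
    then show "x = g j" using same x by blast
  qed
  show "G \<inter> hilb_component d j = {}" if nj: "\<not> (1 \<le> j \<and> 2 * j \<le> d)"
  proof (rule ccontr)
    assume "G \<inter> hilb_component d j \<noteq> {}"
    then obtain i where "i \<in> J" "g i \<in> hilb_component d j" using \<open>g ` J = G\<close> by blast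
    then have "j \<in> J" using same by blast
    then show False using nj by (simp add: J_def)
  qed
qed

end

theorem theorem1p1:
  fixes d :: nat
  assumes "d \<ge> 1"
  shows "(\<exists>G. minimal_homogeneous_generators d G) \<and>
    (\<forall>G. minimal_homogeneous_generators d G \<longrightarrow>
       (\<forall>j. (1 \<le> j \<and> real j \<le> real d / 2 \<longrightarrow> (\<exists>!x. x \<in> G \<inter> hilb_component d j)) \<and>
            (\<not> (1 \<le> j \<and> real j \<le> real d / 2) \<longrightarrow> G \<inter> hilb_component d j = {}))) \<and>
    (\<forall>j. vectorspace.fin_dim rat_field (indecomposables_component d j) \<and>
         vectorspace.dim rat_field (indecomposables_component d j) =
           (if 1 \<le> j \<and> real j \<le> real d / 2 then 1 else 0))"
proof -
  have half: "real j \<le> real d / 2 \<longleftrightarrow> 2 * j \<le> d" for j by linarith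
  show ?thesis
    unfolding half
    using exists_minimal_generators[OF assms] minimal_generators_components[OF assms]
      indecomposables_component_dim[OF assms] by blast
qed

end
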